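(* Let $E$ be a real Banach lattice and let $K$ be a bounded subset of $E$. The following statements are equivalent: (1) $K$ is a reciprocal Dunford--Pettis set (RDP-set), i.e. $T(K)$ is relatively weakly compact for every real Banach space $Y$ and every Dunford--Pettis operator $T:E\to Y$. (2) $K$ is a V$^{*}$-set, i.e. $\lim_{n\to\infty}\sup_{x\in K}|x_n'(x)|=0$ for every weakly unconditionally Cauchy series $\sum_n x_n'$ in $E'$. (3) $K$ is a disjointly weakly compact set, i.e. every disjoint sequence $(x_n)$ contained in the solid hull $Sol(K)$ converges weakly to $0$. (4) $T(K)$ is relatively weakly compact for every real Banach space $X$ and every almost Dunford--Pettis operator $T:E\to X$.
   Context: All Banach spaces and Banach lattices are real; $E'$ denotes the topological dual of $E$. All operators are bounded and linear. The solid hull of $K\subseteq E$ is $Sol(K)=\{y\in E: |y|\le |x| \text{ for some } x\in K\}$. A sequence $(x_n)$ in a Banach lattice is disjoint if $|x_n|\wedge|x_m|=0$ whenever $n\neq m$. A series $\sum_n z_n$ in a Banach space $Z$ is weakly unconditionally Cauchy if $\sum_n |f(z_n)|<\infty$ for every $f\in Z'$. An operator between Banach spaces is a Dunford--Pettis operator if it maps weakly null sequences to norm null sequences. An operator $T:E\to X$ from a Banach lattice $E$ into a Banach space $X$ is an almost Dunford--Pettis operator if $\|Tx_n\|\to 0$ for every disjoint weakly null sequence $(x_n)$ in $E$. *)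

theory Defs
  imports "HOL-Analysis.Analysis" "HOL-Library.Lattice_Algebras"
begin

text \<open>
  The lattice operations are \<^term>\<open>inf\<close> and \<^term>\<open>sup\<close>; the superclass
  \<^class>\<open>lattice_ab_group_add_abs\<close> makes the modulus \<open>\<bar>x\<bar>\<close> equal to \<open>sup x (- x)\<close>.
\<close>

class banach_lattice = banach + ordered_real_vector + lattice_ab_group_add_abs +
  assumes norm_mono_abs: "\<bar>x\<bar> \<le> \<bar>y\<bar> \<Longrightarrow> norm x \<le> norm y"

instance real :: banach_lattice
  by standard simp

definition solid_hull :: "'a::banach_lattice set \<Rightarrow> 'a set" where
  "solid_hull K = {y. \<exists>x\<in>K. \<bar>y\<bar> \<le> \<bar>x\<bar>}"

definition disjoint_seq :: "(nat \<Rightarrow> 'a::banach_lattice) \<Rightarrow> bool" where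
  "disjoint_seq x \<longleftrightarrow> (\<forall>m n. m \<noteq> n \<longrightarrow> inf \<bar>x n\<bar> \<bar>x m\<bar> = 0)"

definition weakly_null :: "(nat \<Rightarrow> 'a::real_normed_vector) \<Rightarrow> bool" where
  "weakly_null x \<longleftrightarrow> (\<forall>f :: 'a \<Rightarrow>\<^sub>L real. (\<lambda>n. blinfun_apply f (x n)) \<longlonglongrightarrow> 0)"

definition weakly_unconditionally_Cauchy :: "(nat \<Rightarrow> 'z::real_normed_vector) \<Rightarrow> bool" where
  "weakly_unconditionally_Cauchy z \<longleftrightarrow>
     (\<forall>f :: 'z \<Rightarrow>\<^sub>L real. summable (\<lambda>n. \<bar>blinfun_apply f (z n)\<bar>))"

text \<open>
  Being a reciprocal Dunford--Pettis set is a condition on operators into \<^emph>\<open>all\<close> Banach spaces.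
  Since types cannot be quantified inside a formula, the codomains are Banach spaces whose points
  form a subset of a type \<^typ>\<open>'u\<close>, so that a bound variable can range over them. The operations
  are irrelevant outside the set of points.
\<close>

record 'u normed_structure =
  points :: "'u set"
  vzero :: 'u
  vadd :: "'u \<Rightarrow> 'u \<Rightarrow> 'u"
  vscale :: "real \<Rightarrow> 'u \<Rightarrow> 'u"
  vnorm :: "'u \<Rightarrow> real"

definition vdist :: "'u normed_structure \<Rightarrow> 'u \<Rightarrow> 'u \<Rightarrow> real" where
  "vdist Y x y = vnorm Y (vadd Y x (vscale Y (- 1) y))"

definition real_vector_space :: "'u normed_structure \<Rightarrow> bool" where
  "real_vector_space Y \<longleftrightarrow>
     vzero Y \<in> points Y \<and>
     (\<forall>x\<in>points Y. \<forall>y\<in>points Y. vadd Y x y \<in> points Y) \<and>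
     (\<forall>a. \<forall>x\<in>points Y. vscale Y a x \<in> points Y) \<and>
     (\<forall>x\<in>points Y. \<forall>y\<in>points Y. \<forall>z\<in>points Y.
        vadd Y (vadd Y x y) z = vadd Y x (vadd Y y z)) \<and>
     (\<forall>x\<in>points Y. \<forall>y\<in>points Y. vadd Y x y = vadd Y y x) \<and>
     (\<forall>x\<in>points Y. vadd Y (vzero Y) x = x) \<and>
     (\<forall>x\<in>points Y. \<exists>y\<in>points Y. vadd Y x y = vzero Y) \<and>
     (\<forall>a. \<forall>x\<in>points Y. \<forall>y\<in>points Y.
        vscale Y a (vadd Y x y) = vadd Y (vscale Y a x) (vscale Y a y)) \<and>
     (\<forall>a b. \<forall>x\<in>points Y. vscale Y (a + b) x = vadd Y (vscale Y a x) (vscale Y b x)) \<and>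
     (\<forall>a b. \<forall>x\<in>points Y. vscale Y a (vscale Y b x) = vscale Y (a * b) x) \<and>
     (\<forall>x\<in>points Y. vscale Y 1 x = x)"

definition banach_space :: "'u normed_structure \<Rightarrow> bool" where
  "banach_space Y \<longleftrightarrow>
     real_vector_space Y \<and>
     (\<forall>x\<in>points Y. vnorm Y x = 0 \<longleftrightarrow> x = vzero Y) \<and>
     (\<forall>a. \<forall>x\<in>points Y. vnorm Y (vscale Y a x) = \<bar>a\<bar> * vnorm Y x) \<and>
     (\<forall>x\<in>points Y. \<forall>y\<in>points Y. vnorm Y (vadd Y x y) \<le> vnorm Y x + vnorm Y y) \<and>
     (\<forall>s :: nat \<Rightarrow> 'u. (\<forall>n. s n \<in> points Y) \<longrightarrow>
        (\<forall>e>0. \<exists>N. \<forall>m\<ge>N. \<forall>n\<ge>N. vdist Y (s m) (s n) < e) \<longrightarrow>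
        (\<exists>l\<in>points Y. (\<lambda>n. vdist Y (s n) l) \<longlonglongrightarrow> 0))"

text \<open>
  Every Banach space in the sense of the class \<^class>\<open>banach\<close> that injects into the type
  \<^typ>\<open>'u\<close> gives such a structure.
\<close>

definition transported_structure :: "('y::banach \<Rightarrow> 'u) \<Rightarrow> 'u normed_structure" where
  "transported_structure j =
     \<lparr>points = range j, vzero = j 0, vadd = (\<lambda>a b. j (inv j a + inv j b)),
      vscale = (\<lambda>c a. j (c *\<^sub>R inv j a)), vnorm = (\<lambda>a. norm (inv j a))\<rparr>"

lemma banach_space_transported_structure:
  fixes j :: "'y::banach \<Rightarrow> 'u"
  assumes "inj j"
  shows "banach_space (transported_structure j)"
proof -
  let ?Y = "transported_structure j"
  note simps = transported_structure_def vdist_def inv_f_f[OF assms] inj_eq[OF assms]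
  have "real_vector_space ?Y"
    unfolding real_vector_space_def
    by (auto simp: simps algebra_simps intro: exI[of _ "- x" for x])
  moreover have "\<exists>l\<in>points ?Y. (\<lambda>n. vdist ?Y (s n) l) \<longlonglongrightarrow> 0"
    if s: "\<forall>n. s n \<in> points ?Y"
      and C: "\<forall>e>0. \<exists>N. \<forall>m\<ge>N. \<forall>n\<ge>N. vdist ?Y (s m) (s n) < e" for s
  proof -
    have "\<forall>n. \<exists>y. s n = j y" using s by (auto simp: simps)
    then obtain t where t: "\<And>n. s n = j (t n)" by metis
    have "Cauchy t" using C by (simp add: t simps Cauchy_def dist_norm)
    then obtain l where "t \<longlonglongrightarrow> l" using Cauchy_convergent convergent_def by blast
    then have "(\<lambda>n. norm (t n - l)) \<longlonglongrightarrow> 0" using LIM_zero tendsto_norm_zero by blast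
    then show ?thesis by (intro bexI[of _ "j l"]) (auto simp: t simps)
  qed
  ultimately show ?thesis
    unfolding banach_space_def
    by (auto simp: simps norm_triangle_ineq)
qed

definition bounded_operator :: "('a::real_normed_vector \<Rightarrow> 'u) \<Rightarrow> 'u normed_structure \<Rightarrow> bool" where
  "bounded_operator T Y \<longleftrightarrow>
     (\<forall>x. T x \<in> points Y) \<and>
     (\<forall>x y. T (x + y) = vadd Y (T x) (T y)) \<and>
     (\<forall>a x. T (a *\<^sub>R x) = vscale Y a (T x)) \<and>
     (\<exists>C. \<forall>x. vnorm Y (T x) \<le> C * norm x)"

definition dual_space :: "'u normed_structure \<Rightarrow> ('u \<Rightarrow> real) set" where
  "dual_space Y = {f.
     (\<forall>x\<in>points Y. \<forall>y\<in>points Y. f (vadd Y x y) = f x + f y) \<and>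
     (\<forall>a. \<forall>x\<in>points Y. f (vscale Y a x) = a * f x) \<and>
     (\<exists>C. \<forall>x\<in>points Y. \<bar>f x\<bar> \<le> C * vnorm Y x)}"

definition weak_topology :: "'u normed_structure \<Rightarrow> 'u topology" where
  "weak_topology Y =
     topology_generated_by {{x \<in> points Y. f x \<in> U} | f U. f \<in> dual_space Y \<and> open U}"

definition relatively_weakly_compact :: "'u normed_structure \<Rightarrow> 'u set \<Rightarrow> bool" where
  "relatively_weakly_compact Y A \<longleftrightarrow>
     A \<subseteq> points Y \<and> compactin (weak_topology Y) (weak_topology Y closure_of A)"

definition Dunford_Pettis_operator ::
    "('a::banach \<Rightarrow> 'u) \<Rightarrow> 'u normed_structure \<Rightarrow> bool" where
  "Dunford_Pettis_operator T Y \<longleftrightarrow> bounded_operator T Y \<and>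
     (\<forall>x. weakly_null x \<longrightarrow> (\<lambda>n. vnorm Y (T (x n))) \<longlonglongrightarrow> 0)"

definition almost_Dunford_Pettis_operator ::
    "('a::banach_lattice \<Rightarrow> 'u) \<Rightarrow> 'u normed_structure \<Rightarrow> bool" where
  "almost_Dunford_Pettis_operator T Y \<longleftrightarrow> bounded_operator T Y \<and>
     (\<forall>x. disjoint_seq x \<and> weakly_null x \<longrightarrow> (\<lambda>n. vnorm Y (T (x n))) \<longlonglongrightarrow> 0)"

definition RDP_set :: "'u itself \<Rightarrow> 'a::banach set \<Rightarrow> bool" where
  "RDP_set U K \<longleftrightarrow>
     (\<forall>(Y :: 'u normed_structure) T. banach_space Y \<and> Dunford_Pettis_operator T Y \<longrightarrow>
        relatively_weakly_compact Y (T ` K))"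

text \<open>
  The supremum is taken in \<^typ>\<open>ennreal\<close>, so that it is \<open>0\<close> for empty \<open>K\<close>.
\<close>

definition V_star_set :: "'a::banach set \<Rightarrow> bool" where
  "V_star_set K \<longleftrightarrow>
     (\<forall>x' :: nat \<Rightarrow> ('a \<Rightarrow>\<^sub>L real). weakly_unconditionally_Cauchy x' \<longrightarrow>
        (\<lambda>n. SUP x\<in>K. ennreal \<bar>blinfun_apply (x' n) x\<bar>) \<longlonglongrightarrow> 0)"

definition disjointly_weakly_compact :: "'a::banach_lattice set \<Rightarrow> bool" where
  "disjointly_weakly_compact K \<longleftrightarrow>
     (\<forall>x. (\<forall>n. x n \<in> solid_hull K) \<and> disjoint_seq x \<longrightarrow> weakly_null x)"

definition almost_DP_images_relatively_weakly_compact ::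
    "'u itself \<Rightarrow> 'a::banach_lattice set \<Rightarrow> bool" where
  "almost_DP_images_relatively_weakly_compact U K \<longleftrightarrow>
     (\<forall>(X :: 'u normed_structure) T. banach_space X \<and> almost_Dunford_Pettis_operator T X \<longrightarrow>
        relatively_weakly_compact X (T ` K))"

text \<open>
  Which type of points makes the quantification cover every Banach space? Relative weak
  compactness of \<open>T ` K\<close> and the (almost) Dunford--Pettis property of \<open>T\<close> do not change when the
  codomain is replaced by the closure of the range of \<open>T\<close>, whose points are limits of sequences
  \<open>T (x n)\<close>, or by an isometric copy of it. So over any type into which \<^typ>\<open>nat \<Rightarrow> 'a\<close> injects
  the quantification is over all Banach spaces up to isometry. Such a type is
  \<^typ>\<open>(nat \<Rightarrow> 'a) + 'u\<close>; the arbitrary type \<^typ>\<open>'u\<close> in it moreover admits any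
  given Banach space directly as a codomain.
\<close>

type_synonym ('a, 'u) universe = "(nat \<Rightarrow> 'a) + 'u"

end

theory Submission imports Defs begin

text \<open>
  The four conditions are linked in a cycle. Every Dunford--Pettis operator is almost
  Dunford--Pettis, so weak compactness of the almost Dunford--Pettis images gives an RDP-set at
  once. The other three links are the content.

  \<^item> An RDP-set is a V*-set (\<open>RDP_imp_V_star\<close>). A weakly unconditionally Cauchy series
    \<open>x' n\<close> defines the operator \<open>x \<mapsto> (x' n x)\<close> into the space of absolutely
    summable sequences. By Schur's theorem weakly null sequences of that space are norm null, so
    the operator is Dunford--Pettis, and by Schur's theorem again the image of \<open>K\<close>,
    being relatively weakly compact, has uniformly small coordinates.

  \<^item> A V*-set is disjointly weakly compact (\<open>V_star_imp_disjointly_weakly_compact\<close>). If a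
    functional \<open>f\<close> does not tend to zero on a disjoint sequence in the solid hull, cut
    \<open>\<bar>f\<bar>\<close> down to the bands generated by suitable disjoint elements. The pieces form a
    weakly unconditionally Cauchy series, because they add up to at most \<open>\<bar>f\<bar>\<close>, and they
    stay large at points of \<open>K\<close>.

  \<^item> A disjointly weakly compact set has relatively weakly compact images under almost
    Dunford--Pettis operators \<open>T\<close>
    (\<open>disjointly_weakly_compact_imp_almost_DP_image\<close>). Here \<open>T\<close> is small along disjoint
    sequences in the solid hull of \<open>K\<close> and in order intervals. The first fact puts \<open>K\<close>
    into some \<open>[-u, u]\<close> up to an error that \<open>T\<close> makes small
    (\<open>uniform_truncation\<close>). The second yields a positive functional \<open>g\<close> such that, for
    \<open>z\<close> in the order interval, \<open>T z\<close> is small as soon as \<open>g \<bar>z\<bar>\<close> is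
    (\<open>controlling_functional\<close>).
    A weak* limit \<open>F\<close> of points of \<open>T K\<close> in the bidual is then approximated in norm by a
    point \<open>T x\<close>: among the \<open>x\<close> in \<open>[-u, u]\<close> for which \<open>T x\<close> nearly agrees with
    \<open>F\<close> on a large finite set of functionals, choose one that nearly minimises a convex function
    built from \<open>g\<close>. The function is
    convex strongly enough that near-minimisers for larger finite sets remain close to \<open>x\<close> with
    respect to \<open>g\<close> (\<open>near_minimiser\<close>). So \<open>F\<close> comes from a point of the space.
\<close>

section \<open>Vector lattices\<close>

lemma inf_le_sum_inf:
  fixes x y z :: "'a::lattice_ab_group_add"
  assumes "0 \<le> x" "0 \<le> y" "0 \<le> z"
  shows "inf x (y + z) \<le> inf x y + inf x z"
proof -
  have "inf x (y + z) \<le> y + inf x z"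
    using assms by (simp add: add_inf_distrib_left le_infI1 add_increasing)
  moreover have "inf x (y + z) \<le> x + inf x z"
    using assms by (intro le_infI1) (simp add: add_increasing2)
  ultimately show ?thesis
    by (simp add: add_inf_distrib_right)
qed

text \<open>
  A lattice ordered group is a distributive lattice: translating by \<open>y - sup y z\<close>, which is
  at most \<open>0\<close>, moves \<open>inf x (sup y z)\<close> below both \<open>x\<close> and \<open>y\<close>, and
  similarly for \<open>z\<close>; the supremum of the two translations is no translation at all.
\<close>

lemma distrib_lattice_ab_group:
  fixes x y z :: "'a::lattice_ab_group_add"
  shows "inf x (sup y z) = sup (inf x y) (inf x z)"
proof (rule antisym)
  let ?r = "sup (inf x y) (inf x z)"
  have *: "w - sup y z + inf x (sup y z) \<le> inf x w" if "w \<le> sup y z" for w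
  proof (rule inf_greatest)
    have "inf x (sup y z) + (w - sup y z) \<le> inf x (sup y z)"
      using that by (subst add_le_same_cancel1) (simp only: le_diff_eq diff_le_eq, simp)
    then show "w - sup y z + inf x (sup y z) \<le> x"
      by (metis add.commute inf.cobounded1 order_trans)
    show "w - sup y z + inf x (sup y z) \<le> w"
      by (metis add.commute diff_add_cancel add_left_mono inf.cobounded2)
  qed
  have a: "y - sup y z + inf x (sup y z) \<le> ?r" and b: "z - sup y z + inf x (sup y z) \<le> ?r"
    using *[of y] *[of z] by (auto intro: le_supI1 le_supI2)
  have "y \<le> ?r + (sup y z - inf x (sup y z))" "z \<le> ?r + (sup y z - inf x (sup y z))"
    using a b by (simp_all only: algebra_simps)
  then have "sup y z \<le> ?r + (sup y z - inf x (sup y z))"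
    by (rule le_supI)
  then show "inf x (sup y z) \<le> ?r"
    by (simp only: algebra_simps) (metis add_le_cancel_right add.commute)
qed (auto intro: le_infI2 le_supI1)

lemma scaleR_sup:
  fixes x y :: "'a::{ordered_real_vector, lattice}"
  assumes "0 \<le> c"
  shows "c *\<^sub>R sup x y = sup (c *\<^sub>R x) (c *\<^sub>R y)"
proof (cases "c = 0")
  case False
  then have c: "0 < c" using assms by simp
  show ?thesis
  proof (rule antisym)
    have "sup x y \<le> inverse c *\<^sub>R sup (c *\<^sub>R x) (c *\<^sub>R y)"
      using c by (intro le_supI) (simp_all add: pos_le_divideR_eq[of c] divideR_right)
    then show "c *\<^sub>R sup x y \<le> sup (c *\<^sub>R x) (c *\<^sub>R y)"
      using c scaleR_left_mono[of "sup x y" _ c] by fastforce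
  qed (use assms in \<open>auto intro!: le_supI scaleR_left_mono\<close>)
qed simp

lemma scaleR_inf:
  fixes x y :: "'a::{ordered_real_vector, lattice_ab_group_add}"
  assumes "0 \<le> c"
  shows "c *\<^sub>R inf x y = inf (c *\<^sub>R x) (c *\<^sub>R y)"
  using scaleR_sup[OF assms, of "- x" "- y"] by (simp add: inf_eq_neg_sup del: neg_sup_eq_inf)

lemma scaleR_abs:
  fixes x :: "'a::banach_lattice"
  shows "\<bar>c *\<^sub>R x\<bar> = \<bar>c\<bar> *\<^sub>R \<bar>x\<bar>"
proof -
  have *: "\<bar>c *\<^sub>R x\<bar> = c *\<^sub>R \<bar>x\<bar>" if "0 \<le> c" for c
    using that by (simp add: abs_lattice scaleR_sup)
  show ?thesis
    using *[of c] *[of "- c"] by (cases "0 \<le> c") auto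
qed

lemma pprt_add_le:
  fixes x y :: "'a::lattice_ab_group_add"
  shows "pprt (x + y) \<le> pprt x + pprt y"
  unfolding pprt_def by (intro le_supI add_mono) (auto intro: add_nonneg_nonneg)

lemma pprt_le_abs:
  fixes x :: "'a::lattice_ab_group_add_abs"
  shows "pprt x \<le> \<bar>x\<bar>"
  by (auto simp: pprt_def intro: le_supI abs_ge_self)

lemma pprt_minus:
  fixes x y :: "'a::lattice_ab_group_add"
  shows "pprt (x - y) = x - inf x y"
  by (simp add: pprt_def add_sup_distrib_left sup_commute)

lemma pprt_inf_nprt: "inf (pprt x) (- nprt x) = (0 :: 'a::lattice_ab_group_add)"
proof -
  have "inf (sup x 0) (sup (- x) 0) = inf (x + sup (-x) 0) (sup (-x) 0)"
    by (simp add: add_sup_distrib_left sup_commute)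
  also have "\<dots> = inf x 0 + sup (- x) 0"
    by (metis add_inf_distrib_right add_0)
  also have "\<dots> = 0"
    by (metis add.right_inverse minus_zero neg_inf_eq_sup)
  finally show ?thesis
    by (simp add: pprt_def nprt_def)
qed

lemma inf_scaleR_eq_0:
  fixes p q :: "'a::banach_lattice"
  assumes "0 \<le> p" "0 \<le> q" "inf p q = 0" "0 \<le> c"
  shows "inf p (c *\<^sub>R q) = 0"
proof (rule antisym)
  define M where "M = max 1 c"
  have "inf p (c *\<^sub>R q) \<le> inf (M *\<^sub>R p) (M *\<^sub>R q)"
    using assms scaleR_right_mono[of 1 M p] scaleR_right_mono[of c M q]
    by (intro inf_mono) (auto simp: M_def)
  also have "\<dots> = 0"
    using assms scaleR_inf[of M p q] by (simp add: M_def)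
  finally show "inf p (c *\<^sub>R q) \<le> 0" .
qed (use assms in \<open>auto intro: scaleR_nonneg_nonneg\<close>)

text \<open>
  Up to a positive factor the two elements are the positive and the negative part of
  \<open>x - A *\<^sub>R y\<close>. This is how disjoint sequences are manufactured below.
\<close>

lemma disjoint_pprt_differences:
  fixes x y :: "'a::banach_lattice"
  assumes "0 < A"
  shows "inf (pprt (x - A *\<^sub>R y)) (pprt (y - inverse A *\<^sub>R x)) = 0"
proof -
  have "y - inverse A *\<^sub>R x = inverse A *\<^sub>R (- (x - A *\<^sub>R y))"
    using assms by (simp add: algebra_simps)
  then have "pprt (y - inverse A *\<^sub>R x) = inverse A *\<^sub>R pprt (- (x - A *\<^sub>R y))"
    using assms by (simp add: pprt_def scaleR_sup del: minus_diff_eq)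
  then have "pprt (y - inverse A *\<^sub>R x) = inverse A *\<^sub>R (- nprt (x - A *\<^sub>R y))"
    by (simp only: pprt_neg)
  then show ?thesis
    using assms pprt_inf_nprt[of "x - A *\<^sub>R y"]
    by (simp add: inf_scaleR_eq_0 del: scaleR_minus_right)
qed

lemma disjoint_mono:
  fixes a b :: "'a::lattice_ab_group_add"
  assumes "inf a b = 0" "0 \<le> a'" "a' \<le> a" "0 \<le> b'" "b' \<le> b"
  shows "inf a' b' = 0"
  by (metis assms inf_mono inf_greatest antisym)

lemma disjoint_seqI:
  fixes x :: "nat \<Rightarrow> 'a::banach_lattice"
  assumes "\<And>m n. m < n \<Longrightarrow> inf \<bar>x m\<bar> \<bar>x n\<bar> = 0"
  shows "disjoint_seq x"
  unfolding disjoint_seq_def by (metis assms inf_commute linorder_neqE_nat)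

lemma disjoint_seq_dominated:
  fixes x y :: "nat \<Rightarrow> 'a::banach_lattice"
  assumes "disjoint_seq x" "\<And>n. \<bar>y n\<bar> \<le> \<bar>x n\<bar>"
  shows "disjoint_seq y"
  using assms unfolding disjoint_seq_def by (meson abs_ge_zero disjoint_mono)

text \<open>
  Disjoint positive elements have their supremum as sum.
\<close>

lemma disjoint_sum_le:
  fixes w :: "nat \<Rightarrow> 'a::banach_lattice"
  assumes "disjoint_seq w" "\<And>n. 0 \<le> w n" "\<And>n. w n \<le> y"
  shows "(\<Sum>i<n. w i) \<le> y"
proof -
  have y: "0 \<le> y" using assms order_trans by blast
  have nn: "0 \<le> (\<Sum>i<n. w i)" for n using assms by (simp add: sum_nonneg)
  have disj: "inf (w m) (\<Sum>i<n. w i) = 0" if "n \<le> m" for n m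
    using that
  proof (induction n)
    case 0
    then show ?case using assms by (simp add: inf_absorb2)
  next
    case (Suc n)
    have "inf (w m) (\<Sum>i<Suc n. w i) \<le> inf (w m) (\<Sum>i<n. w i) + inf (w m) (w n)"
      using inf_le_sum_inf[of "w m" "\<Sum>i<n. w i" "w n"] assms nn by simp
    also have "\<dots> = 0"
      using Suc assms by (force simp: disjoint_seq_def)
    finally show ?case using assms nn[of "Suc n"] by (simp add: antisym)
  qed
  show ?thesis
  proof (induction n)
    case (Suc n)
    have "(\<Sum>i<Suc n. w i) = sup (w n) (\<Sum>i<n. w i)"
      using disj[of n n] add_eq_inf_sup[of "w n" "\<Sum>i<n. w i"] by (simp add: add.commute)
    then show ?case using Suc assms by simp
  qed (simp add: y)
qed

text \<open>
  The first summand is \<open>y\<close> truncated to \<open>[-a, a]\<close>.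
\<close>

lemma Riesz_decomposition:
  fixes y :: "'a::lattice_ab_group_add_abs"
  assumes "\<bar>y\<bar> \<le> a + b" "0 \<le> a" "0 \<le> b"
  obtains y1 y2 where "y = y1 + y2" "\<bar>y1\<bar> \<le> a" "\<bar>y2\<bar> \<le> b"
proof
  define y1 where "y1 = sup (inf y a) (- a)"
  show "y = y1 + (y - y1)" by simp
  show "\<bar>y1\<bar> \<le> a"
    unfolding y1_def using assms
    by (intro abs_leI) (auto simp: minus_le_iff intro: order_trans[of _ 0])
  have eq: "y - y1 = inf (sup 0 (y - a)) (y + a)"
    unfolding y1_def by (simp add: add_inf_distrib_left add_sup_distrib_left)
  have "y \<le> a + b" "- y \<le> a + b" using assms(1) by (auto simp: abs_le_iff)
  then have "y - a \<le> b" "- b \<le> y + a"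
    using add_right_mono[of "- y" "a + b" "y - b"] by (simp_all add: algebra_simps)
  then have "y - y1 \<le> b" "- b \<le> y - y1"
    unfolding eq using assms(3) by (auto intro: le_infI1 le_supI1)
  then show "\<bar>y - y1\<bar> \<le> b"
    by (meson abs_leI minus_le_iff)
qed

lemma abs_add_abs_eq_sup:
  fixes a b :: "'a::lattice_ab_group_add_abs"
  shows "\<bar>a\<bar> + \<bar>b\<bar> = sup \<bar>a + b\<bar> \<bar>a - b\<bar>"
  by (simp add: abs_lattice add_sup_inf_distribs ac_simps)

section \<open>Order and norm\<close>

lemma norm_abs [simp]: "norm \<bar>x :: 'a::banach_lattice\<bar> = norm x"
  by (intro antisym norm_mono_abs) auto

lemma norm_mono_nonneg:
  fixes x y :: "'a::banach_lattice"
  shows "0 \<le> x \<Longrightarrow> x \<le> y \<Longrightarrow> norm x \<le> norm y"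
  by (intro norm_mono_abs) (simp add: order_trans[of 0 x y])

lemma pprt_diff_le:
  fixes x y :: "'a::lattice_ab_group_add_abs"
  shows "\<bar>pprt x - pprt y\<bar> \<le> \<bar>x - y\<bar>"
proof -
  have *: "pprt x - pprt y \<le> \<bar>x - y\<bar>" for x y :: 'a
  proof -
    have "pprt x \<le> pprt (x - y) + pprt y"
      using pprt_add_le[of "x - y" y] by simp
    also have "\<dots> \<le> \<bar>x - y\<bar> + pprt y"
      by (simp add: pprt_le_abs)
    finally show ?thesis by (simp add: diff_le_eq)
  qed
  show ?thesis
    using *[of x y] *[of y x] by (intro abs_leI) (simp_all add: abs_minus_commute)
qed

lemma nonneg_limit:
  fixes x :: "nat \<Rightarrow> 'a::banach_lattice"
  assumes "x \<longlonglongrightarrow> l" "\<forall>\<^sub>F n in sequentially. 0 \<le> x n"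
  shows "0 \<le> l"
proof -
  have "\<forall>\<^sub>F n in sequentially. norm (pprt (- l)) \<le> norm (x n - l)"
    using assms(2)
  proof eventually_elim
    case (elim n)
    then have "pprt (- x n) = 0" by simp
    then show ?case
      using pprt_diff_le[of "- l" "- x n"] norm_mono_abs[of "pprt (- l)" "x n - l"] by simp
  qed
  moreover have "(\<lambda>n. norm (x n - l)) \<longlonglongrightarrow> 0"
    using assms(1) by (simp add: LIM_zero tendsto_norm_zero)
  ultimately have "norm (pprt (- l)) \<le> 0"
    by (intro tendsto_lowerbound) auto
  then show ?thesis by (simp add: le_zero_iff_zero_pprt[symmetric])
qed

lemma summand_le_suminf:
  fixes x :: "nat \<Rightarrow> 'a::banach_lattice"
  assumes "summable x" "\<And>n. 0 \<le> x n"
  shows "x n \<le> suminf x"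
proof -
  have "(\<lambda>N. (\<Sum>i<N. x i) - x n) \<longlonglongrightarrow> suminf x - x n"
    using assms(1) by (intro tendsto_intros summable_LIMSEQ)
  moreover have "\<forall>\<^sub>F N in sequentially. 0 \<le> (\<Sum>i<N. x i) - x n"
    using eventually_gt_at_top[of n]
  proof eventually_elim
    case (elim N)
    then show ?case
      using assms(2) sum_mono2[of "{..<N}" "{n}" x] by simp
  qed
  ultimately have "0 \<le> suminf x - x n" by (rule nonneg_limit)
  then show ?thesis by simp
qed

section \<open>Positive functionals\<close>

definition positive_functional :: "('a::banach_lattice \<Rightarrow> real) \<Rightarrow> bool" where
  "positive_functional g \<longleftrightarrow> bounded_linear g \<and> (\<forall>x\<ge>0. 0 \<le> g x)"

lemma positive_functional_mono:
  assumes "positive_functional g" "x \<le> y"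
  shows "g x \<le> g y"
proof -
  interpret bounded_linear g using assms(1) by (simp add: positive_functional_def)
  have "0 \<le> g (y - x)" using assms by (simp add: positive_functional_def)
  then show ?thesis by (simp add: diff)
qed

lemma positive_functional_abs_le:
  assumes "positive_functional g"
  shows "\<bar>g x\<bar> \<le> g \<bar>x\<bar>"
proof -
  interpret bounded_linear g using assms(1) by (simp add: positive_functional_def)
  show ?thesis
    using positive_functional_mono[OF assms, of x "\<bar>x\<bar>"]
      positive_functional_mono[OF assms, of "- x" "\<bar>x\<bar>"]
    by (simp add: neg abs_ge_self abs_ge_minus_self)
qed

text \<open>
  On the difference of two positive elements the extension has to be the difference of the values.
  The bound makes it continuous.
\<close>

lemma positive_functional_extension:
  fixes \<phi> :: "'a::banach_lattice \<Rightarrow> real"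
  assumes add: "\<And>x y. 0 \<le> x \<Longrightarrow> 0 \<le> y \<Longrightarrow> \<phi> (x + y) = \<phi> x + \<phi> y"
    and scale: "\<And>c x. 0 < c \<Longrightarrow> 0 \<le> x \<Longrightarrow> \<phi> (c *\<^sub>R x) = c * \<phi> x"
    and nonneg: "\<And>x. 0 \<le> x \<Longrightarrow> 0 \<le> \<phi> x"
    and bound: "\<And>x. 0 \<le> x \<Longrightarrow> \<phi> x \<le> C * norm x"
  obtains g where "positive_functional g" "\<And>x. 0 \<le> x \<Longrightarrow> g x = \<phi> x"
proof
  define g where "g x = \<phi> (pprt x) - \<phi> (- nprt x)" for x
  have zero: "\<phi> 0 = 0" using add[of 0 0] by simp
  show eq: "g x = \<phi> x" if "0 \<le> x" for x using that by (simp add: g_def zero)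
  have diff: "g (a - b) = \<phi> a - \<phi> b" if "0 \<le> a" "0 \<le> b" for a b
  proof -
    have "pprt (a - b) + b = - nprt (a - b) + a"
      using prts[of "a - b"] by (simp add: algebra_simps)
    then have "\<phi> (pprt (a - b) + b) = \<phi> (- nprt (a - b) + a)" by simp
    then have "\<phi> (pprt (a - b)) + \<phi> b = \<phi> (- nprt (a - b)) + \<phi> a"
      using add[of "pprt (a - b)" b] add[of "- nprt (a - b)" a] that by simp
    then show ?thesis by (simp add: g_def)
  qed
  have parts: "x = pprt x - (- nprt x)" for x :: 'a using prts[of x] by simp
  have g_add: "g (x + y) = g x + g y" for x y
  proof -
    have "x + y = (pprt x + pprt y) - (- nprt x + - nprt y)"
      by (subst (1) parts[of x], subst (1) parts[of y]) simp
    then have "g (x + y) = \<phi> (pprt x + pprt y) - \<phi> (- nprt x + - nprt y)"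
      by (simp only:) (intro diff add_nonneg_nonneg, auto)
    moreover have "\<phi> (- nprt x + - nprt y) = \<phi> (- nprt x) + \<phi> (- nprt y)"
      by (rule add) auto
    ultimately show ?thesis by (simp add: add g_def)
  qed
  have g_minus: "g (- x) = - g x" for x
    using g_add[of x "- x"] eq[of 0] zero by simp
  have g_pos: "g (c *\<^sub>R x) = c * g x" if "0 < c" for c x
  proof -
    have "c *\<^sub>R x = c *\<^sub>R pprt x - c *\<^sub>R (- nprt x)"
      by (subst (1) parts[of x]) (simp only: scaleR_diff_right)
    then have "g (c *\<^sub>R x) = \<phi> (c *\<^sub>R pprt x) - \<phi> (c *\<^sub>R (- nprt x))"
      using diff[of "c *\<^sub>R pprt x" "c *\<^sub>R (- nprt x)"] that
      by (simp add: scaleR_nonneg_nonneg scaleR_nonneg_nonpos del: scaleR_minus_right)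
    then show ?thesis using that by (simp add: g_def scale right_diff_distrib del: scaleR_minus_right)
  qed
  have g_scale: "g (c *\<^sub>R x) = c * g x" for c x
    using g_pos[of c x] g_pos[of "- c" x] g_minus[of "c *\<^sub>R x"] eq[of 0] zero
    by (cases c "0::real" rule: linorder_cases) auto
  have g_le: "g x \<le> \<bar>C\<bar> * norm x" for x
  proof -
    have "g x \<le> \<phi> (pprt x)" by (simp add: g_def nonneg)
    also have "\<dots> \<le> C * norm (pprt x)" by (simp add: bound)
    also have "\<dots> \<le> \<bar>C\<bar> * norm (pprt x)" by (simp add: mult_right_mono)
    also have "\<dots> \<le> \<bar>C\<bar> * norm x"
      using norm_mono_nonneg[of "pprt x" "\<bar>x\<bar>"] by (intro mult_left_mono) (auto simp: pprt_le_abs)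
    finally show ?thesis .
  qed
  have "\<bar>g x\<bar> \<le> norm x * \<bar>C\<bar>" for x
    using g_le[of x] g_le[of "- x"] g_minus[of x] by (simp add: mult.commute)
  then have "bounded_linear g"
    by (intro bounded_linear_intro[where K = "\<bar>C\<bar>"]) (simp_all add: g_add g_scale)
  then show "positive_functional g"
    unfolding positive_functional_def using eq nonneg by simp
qed

text \<open>
  The functional constructed here is the modulus \<open>\<bar>f\<bar>\<close>, given on the positive cone by
  \<open>\<bar>f\<bar> x = sup {f y | \<bar>y\<bar> \<le> x}\<close>; additivity is the Riesz decomposition property.
\<close>

lemma modulus_exists:
  fixes f :: "'a::banach_lattice \<Rightarrow> real"
  assumes "bounded_linear f"
  obtains g where "positive_functional g" "\<And>x. \<bar>f x\<bar> \<le> g \<bar>x\<bar>"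
    "\<And>x c. 0 \<le> x \<Longrightarrow> c < g x \<Longrightarrow> \<exists>y. \<bar>y\<bar> \<le> x \<and> c < f y"
proof -
  interpret bounded_linear f by fact
  obtain C where C: "\<And>x. norm (f x) \<le> norm x * C" "0 \<le> C" using nonneg_bounded by blast
  define \<phi> where "\<phi> x = (SUP y\<in>{y. \<bar>y\<bar> \<le> x}. f y)" for x
  have le: "f y \<le> C * norm x" if "\<bar>y\<bar> \<le> x" for x y
  proof -
    have "f y \<le> norm y * C" using C(1)[of y] by simp
    also have "\<dots> \<le> norm x * C"
      using that C(2) norm_mono_nonneg[of "\<bar>y\<bar>" x] by (intro mult_right_mono) auto
    finally show ?thesis by (simp add: mult.commute)
  qed
  have bdd: "bdd_above (f ` {y. \<bar>y\<bar> \<le> x})" for x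
    using le by (auto intro!: bdd_aboveI[of _ "C * norm x"])
  have ne: "{y. \<bar>y\<bar> \<le> x} \<noteq> {}" if "0 \<le> x" for x :: 'a using that by (auto intro!: exI[of _ 0])
  have upper: "f y \<le> \<phi> x" if "\<bar>y\<bar> \<le> x" for x y
    unfolding \<phi>_def using that bdd by (intro cSUP_upper) auto
  have least: "\<phi> x \<le> c" if "0 \<le> x" "\<And>y. \<bar>y\<bar> \<le> x \<Longrightarrow> f y \<le> c" for x c
    unfolding \<phi>_def using that ne by (intro cSUP_least) auto
  have approx: "\<exists>y. \<bar>y\<bar> \<le> x \<and> c < f y" if "0 \<le> x" "c < \<phi> x" for x c
    using least[OF that(1), of c] that(2) by (meson not_le)
  have add: "\<phi> (x + y) = \<phi> x + \<phi> y" if xy: "0 \<le> x" "0 \<le> y" for x y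
  proof (rule antisym)
    show "\<phi> (x + y) \<le> \<phi> x + \<phi> y"
    proof (rule least)
      fix z assume "\<bar>z\<bar> \<le> x + y"
      then obtain z1 z2 where "z = z1 + z2" "\<bar>z1\<bar> \<le> x" "\<bar>z2\<bar> \<le> y"
        using Riesz_decomposition xy by metis
      then show "f z \<le> \<phi> x + \<phi> y" using upper by (simp add: add add_mono)
    qed (use xy in auto)
    have "\<phi> x \<le> \<phi> (x + y) - \<phi> y"
    proof (rule least[OF xy(1)])
      fix a assume a: "\<bar>a\<bar> \<le> x"
      have "\<phi> y \<le> \<phi> (x + y) - f a"
      proof (rule least[OF xy(2)])
        fix b assume b: "\<bar>b\<bar> \<le> y"
        have "\<bar>a + b\<bar> \<le> x + y"
          using a b by (metis abs_triangle_ineq add_mono order_trans)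
        from upper[OF this] show "f b \<le> \<phi> (x + y) - f a" by (simp add: add)
      qed
      then show "f a \<le> \<phi> (x + y) - \<phi> y" by simp
    qed
    then show "\<phi> x + \<phi> y \<le> \<phi> (x + y)" by simp
  qed
  have scale_le: "c * \<phi> x \<le> \<phi> (c *\<^sub>R x)" if "0 < c" "0 \<le> x" for c x
  proof -
    have "\<phi> x \<le> inverse c * \<phi> (c *\<^sub>R x)"
    proof (rule least[OF that(2)])
      fix y assume "\<bar>y\<bar> \<le> x"
      then have "\<bar>c *\<^sub>R y\<bar> \<le> c *\<^sub>R x" using that by (simp add: scaleR_abs scaleR_left_mono)
      from upper[OF this] that(1) show "f y \<le> inverse c * \<phi> (c *\<^sub>R x)"
        by (simp add: scale field_simps)
    qed
    then show ?thesis using that(1) by (simp add: field_simps)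
  qed
  have scl: "\<phi> (c *\<^sub>R x) = c * \<phi> x" if "0 < c" "0 \<le> x" for c x
    using scale_le[OF that] scale_le[of "inverse c" "c *\<^sub>R x"] that
    by (simp add: field_simps scaleR_nonneg_nonneg)
  obtain g where g: "positive_functional g" "\<And>x. 0 \<le> x \<Longrightarrow> g x = \<phi> x"
  proof (rule positive_functional_extension[OF add scl])
    show "0 \<le> \<phi> x" if "0 \<le> x" for x using upper[of 0 x] that by (simp add: zero)
    show "\<phi> x \<le> C * norm x" if "0 \<le> x" for x using least[OF that] le by blast
  qed (use that in auto)
  show ?thesis
  proof
    show "positive_functional g" by fact
    show "\<bar>f x\<bar> \<le> g \<bar>x\<bar>" for x
      using g(2)[of "\<bar>x\<bar>"] upper[of x "\<bar>x\<bar>"] upper[of "- x" "\<bar>x\<bar>"] by (simp add: neg)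
    show "\<exists>y. \<bar>y\<bar> \<le> x \<and> c < f y" if "0 \<le> x" "c < g x" for x c
      using that g(2) approx by simp
  qed
qed

section \<open>Near-minimisers in order intervals\<close>

text \<open>
  If \<open>0 \<le> w \<le> k *\<^sub>R c\<close> are real numbers, some multiple \<open>i *\<^sub>R c\<close> is within \<open>c\<close>
  of \<open>w\<close>, and the corresponding summand is at least \<open>d - c\<close>. For functions \<open>i\<close>
  would depend on the point; summing over all \<open>i\<close> avoids choosing it, and the term with
  \<open>w - k *\<^sub>R c\<close> carries the induction beyond the part of \<open>w\<close> reached so far.
\<close>

lemma grid_covers_interval:
  fixes d w c :: "'a::banach_lattice"
  assumes "0 \<le> c" "0 \<le> d" "0 \<le> w"
  shows "d \<le> c + pprt (w - real k *\<^sub>R c) + (\<Sum>i\<le>k. pprt (d - \<bar>w - real i *\<^sub>R c\<bar>))"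
proof (induction k)
  case 0
  have "d \<le> w + pprt (d - w)" by (simp add: pprt_def add_sup_distrib_left)
  then show ?case using assms by (simp add: add_increasing add.assoc)
next
  case (Suc k)
  define R where "R = (\<Sum>i\<le>k. pprt (d - \<bar>w - real i *\<^sub>R c\<bar>))"
  define r where "r = w - real (Suc k) *\<^sub>R c"
  define P where "P = pprt (d - \<bar>r\<bar>)"
  have R: "0 \<le> R" unfolding R_def by (simp add: sum_nonneg)
  have r: "w - real k *\<^sub>R c = r + c" by (simp add: r_def algebra_simps)
  \<comment> \<open>Two bounds for the same element, one from the induction hypothesis and one from the new grid
    point; their infimum is what the claim for \<open>Suc k\<close> needs.\<close>
  have 1: "d - R - P \<le> c + pprt (r + c)"
  proof -
    have "d - R \<le> c + pprt (r + c)"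
      using Suc by (simp add: R_def r diff_le_eq)
    then show ?thesis
      by (metis P_def diff_left_mono diff_zero order_trans zero_le_pprt)
  qed
  have 2: "d - R - P \<le> \<bar>r\<bar>"
  proof -
    have "d \<le> \<bar>r\<bar> + P" by (simp add: P_def pprt_def add_sup_distrib_left)
    then have "d - P \<le> \<bar>r\<bar>" by (simp add: diff_le_eq)
    moreover have "d - R - P \<le> d - P" using R by (simp add: algebra_simps)
    ultimately show ?thesis by (rule order_trans[rotated])
  qed
  have "inf (c + pprt (r + c)) \<bar>r\<bar> = inf (sup (r + (c + c)) c) (sup r (- r))"
    by (simp add: pprt_def abs_lattice add_sup_distrib_left ac_simps)
  also have "\<dots> = sup (inf (sup (r + (c + c)) c) r) (inf (sup (r + (c + c)) c) (- r))"
    by (rule distrib_lattice_ab_group)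
  also have "\<dots> = sup (sup (inf r (r + (c + c))) (inf r c)) (sup (inf (- r) (r + (c + c))) (inf (- r) c))"
    by (simp only: inf_commute[of "sup (r + (c + c)) c"] distrib_lattice_ab_group)
  also have "\<dots> \<le> c + pprt r"
  proof (intro le_supI)
    have "r \<le> c + pprt r" using assms by (simp add: add_increasing pprt_def)
    then show "inf r (r + (c + c)) \<le> c + pprt r" "inf r c \<le> c + pprt r"
      by (auto intro: le_infI1)
    have "c \<le> c + pprt r" by simp
    then show "inf (- r) c \<le> c + pprt r" by (auto intro: le_infI2)
    have "inf (- r) (r + (c + c)) + inf (- r) (r + (c + c)) \<le> (- r) + (r + (c + c))"
      by (intro add_mono) auto
    then have "2 *\<^sub>R inf (- r) (r + (c + c)) \<le> 2 *\<^sub>R c" by (simp add: scaleR_2)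
    then have "inf (- r) (r + (c + c)) \<le> c"
      by (simp add: scaleR_le_cancel_left_pos)
    then show "inf (- r) (r + (c + c)) \<le> c + pprt r"
      by (metis \<open>c \<le> c + pprt r\<close> order_trans)
  qed
  finally have "inf (c + pprt (r + c)) \<bar>r\<bar> \<le> c + pprt r" .
  then have "d - R - P \<le> c + pprt r"
    using 1 2 by (meson inf_greatest order_trans)
  then have "d \<le> c + pprt r + (R + P)" by (simp add: algebra_simps)
  then show ?case by (simp add: R_def r_def P_def)
qed

text \<open>
  The amount by which \<open>x \<mapsto> \<bar>x - t\<bar>\<close> lies below its chord at the midpoint: it is positive
  where \<open>t\<close> separates \<open>x\<close> from \<open>y\<close>. It follows from
  \<open>\<bar>a\<bar> + \<bar>b\<bar> = sup \<bar>a + b\<bar> \<bar>a - b\<bar>\<close>.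
\<close>

lemma midpoint_defect:
  fixes x y t :: "'a::banach_lattice"
  shows "(1/2) *\<^sub>R \<bar>x - t\<bar> + (1/2) *\<^sub>R \<bar>y - t\<bar> =
    \<bar>(1/2) *\<^sub>R (x + y) - t\<bar> + pprt ((1/2) *\<^sub>R \<bar>x - y\<bar> - \<bar>(1/2) *\<^sub>R (x + y) - t\<bar>)"
proof -
  have 1: "(1/2) *\<^sub>R (x - t) + (1/2) *\<^sub>R (y - t) = (1/2) *\<^sub>R (x + y) - t"
    by (simp add: algebra_simps flip: scaleR_add_left)
  have 2: "(1/2) *\<^sub>R (x - t) - (1/2) *\<^sub>R (y - t) = (1/2) *\<^sub>R (x - y)"
    by (simp add: algebra_simps)
  have "(1/2) *\<^sub>R \<bar>x - t\<bar> + (1/2) *\<^sub>R \<bar>y - t\<bar> = \<bar>(1/2) *\<^sub>R (x - t)\<bar> + \<bar>(1/2) *\<^sub>R (y - t)\<bar>"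
    by (simp only: scaleR_abs) simp
  also have "\<dots> = sup \<bar>(1/2) *\<^sub>R (x + y) - t\<bar> \<bar>(1/2) *\<^sub>R (x - y)\<bar>"
    by (simp only: abs_add_abs_eq_sup 1 2)
  also have "\<bar>(1/2) *\<^sub>R (x - y)\<bar> = (1/2) *\<^sub>R \<bar>x - y\<bar>"
    by (simp only: scaleR_abs) simp
  finally show ?thesis
    by (simp add: pprt_def add_sup_distrib_left sup_commute)
qed

text \<open>
  A substitute for the weak compactness of order intervals in \<open>L\<^sup>1(g)\<close>. The family \<open>C\<close> is
  a decreasing net of midpoint convex subsets of \<open>[-u, u]\<close>. Let \<open>\<Phi>\<close> be the sum of the convex
  functions \<open>x \<mapsto> g \<bar>x - t\<bar>\<close> over a fine grid of points \<open>t\<close> in \<open>[-u, u]\<close>.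
  The infima of \<open>\<Phi>\<close> on the sets \<open>C S\<close> increase to a limit, so from some \<open>S\<close> on the
  midpoint of two near-minimisers cannot do much better than they do. By \<open>midpoint_defect\<close> all
  grid points then have small defects, and by \<open>grid_covers_interval\<close> these control
  \<open>g \<bar>x - y\<bar>\<close>. With \<open>g\<close> as the integral, \<open>\<Phi>\<close> plays the role of a square norm, but
  it needs no multiplication.
\<close>

lemma near_minimiser:
  fixes C :: "'i set \<Rightarrow> 'a::banach_lattice set"
  assumes g: "positive_functional g" and u: "0 \<le> u" and \<delta>: "0 < \<delta>"
    and sub: "\<And>S x. finite S \<Longrightarrow> x \<in> C S \<Longrightarrow> \<bar>x\<bar> \<le> u"
    and mid: "\<And>S x y. finite S \<Longrightarrow> x \<in> C S \<Longrightarrow> y \<in> C S \<Longrightarrow> (1/2) *\<^sub>R (x + y) \<in> C S"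
    and anti: "\<And>S S'. finite S' \<Longrightarrow> S \<subseteq> S' \<Longrightarrow> C S' \<subseteq> C S"
    and ne: "\<And>S. finite S \<Longrightarrow> C S \<noteq> {}"
  obtains S x where "finite S" "x \<in> C S"
    "\<And>S'. finite S' \<Longrightarrow> S \<subseteq> S' \<Longrightarrow> \<exists>y\<in>C S'. g \<bar>x - y\<bar> < \<delta>"
proof -
  interpret bounded_linear g using g by (simp add: positive_functional_def)
  have g_mono: "g a \<le> g b" if "a \<le> b" for a b using positive_functional_mono[OF g that] .
  have g_nonneg: "0 \<le> g a" if "0 \<le> a" for a using g that by (simp add: positive_functional_def)
  obtain k :: nat where k: "8 * g u / \<delta> < real k" using reals_Archimedean2 by blast
  have k0: "0 < real k"
    using k g_nonneg[OF u] \<delta> by (metis divide_nonneg_pos mult_nonneg_nonneg order_le_less_trans zero_le_numeral)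
  define c where "c = (2 / real k) *\<^sub>R u"
  have c: "0 \<le> c" using u by (simp add: c_def scaleR_nonneg_nonneg)
  have kc: "real k *\<^sub>R c = u + u" using k0 by (simp add: c_def scaleR_2)
  have gc: "2 * g c < \<delta> / 2"
    using k k0 \<delta> by (simp add: c_def scale field_simps)
  \<comment> \<open>The grid points are \<open>i *\<^sub>R c - u\<close>; adding \<open>u\<close> moves the interval to \<open>[0, k *\<^sub>R c]\<close>.\<close>
  define \<Phi> where "\<Phi> x = (\<Sum>i\<le>k. g \<bar>x + u - real i *\<^sub>R c\<bar>)" for x
  define B where "B = (\<Sum>i\<le>k. g (u + \<bar>u - real i *\<^sub>R c\<bar>))"
  define m where "m S = (INF x\<in>C S. \<Phi> x)" for S
  define M where "M = (SUP S\<in>{S. finite S}. m S)"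
  define \<eta> where "\<eta> = \<delta> / 8"
  have \<eta>: "0 < \<eta>" using \<delta> by (simp add: \<eta>_def)
  have \<Phi>_nonneg: "0 \<le> \<Phi> x" for x by (simp add: \<Phi>_def sum_nonneg g_nonneg)
  have bdd: "bdd_below (\<Phi> ` C S)" for S
    using \<Phi>_nonneg by (intro bdd_belowI[of _ 0]) auto
  have \<Phi>_le: "\<Phi> x \<le> B" if "finite S" "x \<in> C S" for S x
    unfolding \<Phi>_def B_def
  proof (intro sum_mono g_mono)
    fix i
    have "\<bar>x + (u - real i *\<^sub>R c)\<bar> \<le> \<bar>x\<bar> + \<bar>u - real i *\<^sub>R c\<bar>" by (rule abs_triangle_ineq)
    also have "\<dots> \<le> u + \<bar>u - real i *\<^sub>R c\<bar>" using sub[OF that] by (rule add_right_mono)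
    finally show "\<bar>x + u - real i *\<^sub>R c\<bar> \<le> u + \<bar>u - real i *\<^sub>R c\<bar>" by (simp add: algebra_simps)
  qed
  have m_le: "m S \<le> B" if "finite S" for S
  proof -
    obtain x where x: "x \<in> C S" using ne \<open>finite S\<close> by blast
    then show ?thesis
      using cINF_lower[OF bdd x] \<Phi>_le[OF \<open>finite S\<close> x] by (simp add: m_def)
  qed
  have bddM: "bdd_above (m ` {S. finite S})" using m_le by (intro bdd_aboveI[of _ B]) auto
  have m_M: "m S \<le> M" if "finite S" for S
    unfolding M_def using that bddM by (intro cSUP_upper) auto
  have near: "\<exists>y\<in>C S. \<Phi> y < M + \<eta>" if "finite S" for S
  proof -
    have "(INF x\<in>C S. \<Phi> x) < M + \<eta>" using m_M[OF that] \<eta> by (simp add: m_def)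
    then show ?thesis using cINF_less_iff[OF ne[OF that] bdd] by blast
  qed
  have "M - \<eta> < (SUP S\<in>{S. finite S}. m S)" using \<eta> by (simp add: M_def)
  then obtain S where S: "finite S" "M - \<eta> < m S"
    using less_cSUP_iff[OF _ bddM] by (metis (mono_tags, lifting) empty_iff finite.emptyI mem_Collect_eq)
  obtain x where x: "x \<in> C S" "\<Phi> x < M + \<eta>" using near[OF S(1)] by blast
  have close: "g \<bar>x - y\<bar> < \<delta>" if y: "y \<in> C S" "\<Phi> y < M + \<eta>" for y
  proof -
    define z where "z = (1/2) *\<^sub>R (x + y)"
    define d where "d = (1/2) *\<^sub>R \<bar>x - y\<bar>"
    have z: "z \<in> C S" unfolding z_def using mid S x y by blast
    have zu: "z \<le> u" "- z \<le> u" using sub[OF S(1) z] by (simp_all add: abs_le_iff)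
    then have z0: "0 \<le> z + u" using add_right_mono[of "- z" u z] by (simp add: add.commute)
    have *: "(1/2) * g \<bar>x + u - t\<bar> + (1/2) * g \<bar>y + u - t\<bar> = g \<bar>z + u - t\<bar> + g (pprt (d - \<bar>z + u - t\<bar>))" for t
    proof -
      have "(1/2) *\<^sub>R (x + y) - (t - u) = z + u - t" by (simp add: z_def)
      then have "(1/2) *\<^sub>R \<bar>x + u - t\<bar> + (1/2) *\<^sub>R \<bar>y + u - t\<bar> =
          \<bar>z + u - t\<bar> + pprt (d - \<bar>z + u - t\<bar>)"
        using midpoint_defect[of x "t - u" y] by (simp add: d_def diff_diff_eq2)
      then have "g ((1/2) *\<^sub>R \<bar>x + u - t\<bar> + (1/2) *\<^sub>R \<bar>y + u - t\<bar>) =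
          g (\<bar>z + u - t\<bar> + pprt (d - \<bar>z + u - t\<bar>))" by simp
      then show ?thesis by (simp add: add scale)
    qed
    have "(\<Sum>i\<le>k. g (pprt (d - \<bar>z + u - real i *\<^sub>R c\<bar>))) = (1/2) * \<Phi> x + (1/2) * \<Phi> y - \<Phi> z"
      using * unfolding \<Phi>_def sum_distrib_left sum.distrib[symmetric] sum_subtractf[symmetric]
      by (intro sum.cong) (auto simp: algebra_simps)
    also have "\<dots> < (M + \<eta>) - (M - \<eta>)"
      using x y cINF_lower[OF bdd z] S(2) by (simp add: m_def)
    finally have gaps: "(\<Sum>i\<le>k. g (pprt (d - \<bar>z + u - real i *\<^sub>R c\<bar>))) < 2 * \<eta>" by simp
    have "z + u - real k *\<^sub>R c \<le> 0" using zu by (simp add: kc)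
    then have "pprt (z + u - real k *\<^sub>R c) = 0" by simp
    then have "d \<le> c + (\<Sum>i\<le>k. pprt (d - \<bar>z + u - real i *\<^sub>R c\<bar>))"
      using grid_covers_interval[OF c _ z0, of d k] by (simp add: d_def scaleR_nonneg_nonneg)
    then have "g d \<le> g (c + (\<Sum>i\<le>k. pprt (d - \<bar>z + u - real i *\<^sub>R c\<bar>)))" by (rule g_mono)
    then have "g d \<le> g c + (\<Sum>i\<le>k. g (pprt (d - \<bar>z + u - real i *\<^sub>R c\<bar>)))" by (simp only: add sum)
    then have "g d < g c + 2 * \<eta>" using gaps by simp
    moreover have "g \<bar>x - y\<bar> = 2 * g d" by (simp add: d_def scale)
    ultimately show ?thesis using gc by (simp add: \<eta>_def)
  qed
  show ?thesis
  proof
    show "finite S" "x \<in> C S" by fact+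
    show "\<exists>y\<in>C S'. g \<bar>x - y\<bar> < \<delta>" if "finite S'" "S \<subseteq> S'" for S'
      using near[OF that(1)] close anti[OF that] by blast
  qed
qed

section \<open>Selecting a nearly diagonal subsequence\<close>

text \<open>
  The half of Rosenthal's disjointness lemma that concerns the entries to the left of the diagonal.
  Among more than \<open>C / \<delta>\<close> columns every row has an entry of size at most \<open>\<delta>\<close>, so
  one of these columns is small on infinitely many of the rows still available; keep that column and
  those rows, and repeat with smaller \<open>\<delta>\<close>.
\<close>

lemma nearly_diagonal_subsequence:
  fixes a :: "nat \<Rightarrow> nat \<Rightarrow> real"
  assumes nonneg: "\<And>n i. 0 \<le> a n i" and rows: "\<And>n m. (\<Sum>i<m. a n i) \<le> C" and \<eta>: "0 < \<eta>"
  obtains s :: "nat \<Rightarrow> nat" where "strict_mono s" "\<And>k. (\<Sum>i<k. a (s k) (s i)) \<le> \<eta>"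
proof -
  have step: "\<exists>i N'. i \<in> N \<and> N' \<subseteq> N \<and> infinite N' \<and> (\<forall>n\<in>N'. i < n \<and> a n i \<le> \<delta>)"
    if N: "infinite N" and \<delta>: "0 < \<delta>" for N \<delta>
  proof -
    obtain L :: nat where L: "C / \<delta> < real L" using reals_Archimedean2 by blast
    obtain B where B: "B \<subseteq> N" "finite B" "card B = L"
      using infinite_arbitrarily_large[OF N, of L] by blast
    define b where "b = Max (insert 0 B)"
    have b: "i \<le> b" if "i \<in> B" for i using that B by (simp add: b_def)
    have "\<exists>i\<in>B. a n i \<le> \<delta>" for n
    proof (rule ccontr)
      assume "\<not> ?thesis"
      then have "(\<Sum>i\<in>B. \<delta>) \<le> (\<Sum>i\<in>B. a n i)" by (intro sum_mono) force
      also have "\<dots> \<le> (\<Sum>i<Suc b. a n i)"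
        using b nonneg by (intro sum_mono2) (auto simp: less_Suc_eq_le)
      also have "\<dots> \<le> C" by (rule rows)
      finally show False using L B \<delta> by (simp add: field_simps)
    qed
    then have "N - {..b} \<subseteq> (\<Union>i\<in>B. {n \<in> N. b < n \<and> a n i \<le> \<delta>})" by force
    moreover have "infinite (N - {..b})" using N by simp
    ultimately have "\<not> (\<forall>i\<in>B. finite {n \<in> N. b < n \<and> a n i \<le> \<delta>})"
      using B(2) by (meson finite_UN_I finite_subset)
    then obtain i where "i \<in> B" "infinite {n \<in> N. b < n \<and> a n i \<le> \<delta>}" by blast
    then show ?thesis
      using B b by (intro exI[of _ i] exI[of _ "{n \<in> N. b < n \<and> a n i \<le> \<delta>}"]) force
  qed
  define P where "P n p \<longleftrightarrow> infinite (snd p) \<and> (\<forall>m\<in>snd p. fst p < m \<and> a m (fst p) \<le> \<eta> * (1/2) ^ Suc n)"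
    for n and p :: "nat \<times> nat set"
  have "\<exists>f. \<forall>n. P n (f n) \<and> (fst (f (Suc n)) \<in> snd (f n) \<and> snd (f (Suc n)) \<subseteq> snd (f n))"
  proof (rule dependent_nat_choice)
    show "\<exists>p. P 0 p" using step[of UNIV "\<eta> * (1/2) ^ Suc 0"] \<eta> by (auto simp: P_def)
    show "\<exists>y. P (Suc n) y \<and> fst y \<in> snd x \<and> snd y \<subseteq> snd x" if "P n x" for x n
      using step[of "snd x" "\<eta> * (1/2) ^ Suc (Suc n)"] \<eta> that by (fastforce simp: P_def)
  qed
  then obtain f where P: "\<And>n. P n (f n)" and mem: "\<And>n. fst (f (Suc n)) \<in> snd (f n)"
    and sub: "\<And>n. snd (f (Suc n)) \<subseteq> snd (f n)" by blast
  define s where "s n = fst (f n)" for n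
  have dec: "snd (f n) \<subseteq> snd (f m)" if "m \<le> n" for m n
    using lift_Suc_antimono_le[of "\<lambda>n. snd (f n)"] sub that by blast
  have in_set: "s n \<in> snd (f m)" if "m < n" for m n
  proof -
    have "m \<le> n - 1" using that by simp
    from dec[OF this] show ?thesis using mem[of "n - 1"] that by (auto simp: s_def)
  qed
  show ?thesis
  proof
    show "strict_mono s" unfolding strict_mono_def using P in_set by (auto simp: P_def s_def)
    fix k
    have "(\<Sum>i<k. a (s k) (s i)) \<le> (\<Sum>i<k. \<eta> * (1/2) ^ Suc i)"
      using P in_set by (intro sum_mono) (auto simp: P_def s_def)
    also have "\<dots> = \<eta> * (1 - (1/2) ^ k)"
      by (induction k) (simp_all add: field_simps)
    also have "\<dots> \<le> \<eta>" using \<eta> by (simp add: mult_left_le)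
    finally show "(\<Sum>i<k. a (s k) (s i)) \<le> \<eta>" .
  qed
qed

section \<open>Operators that annihilate disjoint sequences in order intervals\<close>

lemma positive_functional_add:
  "positive_functional f \<Longrightarrow> positive_functional g \<Longrightarrow> positive_functional (\<lambda>x. f x + g x)"
  by (simp add: positive_functional_def bounded_linear_add)

lemma positive_functional_zero: "positive_functional (\<lambda>_. 0)"
  by (simp add: positive_functional_def bounded_linear_zero)

text \<open>
  The seminorm \<open>N\<close> stands for \<open>x \<mapsto> \<parallel>T x\<parallel>\<close> with an operator \<open>T\<close> that is small
  along order bounded disjoint sequences, and \<open>H\<close> for the functionals \<open>f \<circ> T\<close> with
  \<open>\<parallel>f\<parallel> \<le> 1\<close>.
\<close>

locale disjointly_small_seminorm =
  fixes N :: "'a::banach_lattice \<Rightarrow> real" and H :: "('a \<Rightarrow> real) set" and C :: real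
  assumes H_linear: "h \<in> H \<Longrightarrow> bounded_linear h"
    and H_le: "h \<in> H \<Longrightarrow> h x \<le> N x"
    and norming: "\<exists>h\<in>H. h x = N x"
    and N_bound: "N x \<le> C * norm x"
    and null: "disjoint_seq z \<Longrightarrow> (\<And>n. \<bar>z n\<bar> \<le> u) \<Longrightarrow> (\<lambda>n. N (z n)) \<longlonglongrightarrow> 0"
begin

lemma N_zero: "N 0 = 0"
proof -
  obtain h where h: "h \<in> H" "h 0 = N 0" using norming by blast
  then show ?thesis using H_linear by (simp add: bounded_linear.linear linear_0)
qed

lemma N_triangle: "N (x + y) \<le> N x + N y"
proof -
  obtain h where h: "h \<in> H" "h (x + y) = N (x + y)" using norming by blast
  then have "h (x + y) = h x + h y" using H_linear by (simp add: bounded_linear.linear linear_add)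
  then show ?thesis using h H_le[OF h(1), of x] H_le[OF h(1), of y] by simp
qed

lemma C_nonneg: "0 \<le> C * norm (x :: 'a)"
proof -
  obtain h where h: "h \<in> H" "h x = N x" using norming by blast
  have "h (- x) = - h x" using H_linear[OF h(1)] by (simp add: bounded_linear.linear linear_neg)
  then show ?thesis using H_le[OF h(1), of "- x"] N_bound[of "- x"] N_bound[of x] h by simp
qed

text \<open>
  On the positive cone this is the smallest monotone function whose value at \<open>\<bar>y\<bar>\<close> is at
  least \<open>N y\<close>.
\<close>

definition solid_sup :: "'a \<Rightarrow> real" where "solid_sup x = (SUP y\<in>{y. \<bar>y\<bar> \<le> x}. N y)"

lemma N_le_solid:
  assumes "\<bar>y\<bar> \<le> \<bar>x\<bar>" shows "N y \<le> C * norm x"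
proof (cases "norm x = 0")
  case True
  then show ?thesis using assms N_zero by simp
next
  case False
  then have "0 \<le> C" using C_nonneg[of x] by (simp add: zero_le_mult_iff)
  then show ?thesis
    using N_bound[of y] norm_mono_abs[OF assms] by (meson mult_left_mono order_trans)
qed

lemma solid_sup_upper: "\<bar>y\<bar> \<le> x \<Longrightarrow> N y \<le> solid_sup x"
  unfolding solid_sup_def
proof (rule cSUP_upper)
  show "bdd_above (N ` {y. \<bar>y\<bar> \<le> x})"
    using N_le_solid[of _ x] by (intro bdd_aboveI[of _ "C * norm x"]) (auto intro: order_trans[OF _ abs_ge_self])
qed simp

lemma solid_sup_least: "0 \<le> x \<Longrightarrow> (\<And>y. \<bar>y\<bar> \<le> x \<Longrightarrow> N y \<le> c) \<Longrightarrow> solid_sup x \<le> c"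
  unfolding solid_sup_def
proof (rule cSUP_least)
  assume "0 \<le> x"
  then have "0 \<in> {y. \<bar>y\<bar> \<le> x}" by simp
  then show "{y. \<bar>y\<bar> \<le> x} \<noteq> {}" by blast
qed simp

lemma solid_sup_nonneg: "0 \<le> x \<Longrightarrow> 0 \<le> solid_sup x"
  using solid_sup_upper[of 0 x] by (simp add: N_zero)

lemma solid_sup_mono: "0 \<le> x \<Longrightarrow> x \<le> y \<Longrightarrow> solid_sup x \<le> solid_sup y"
proof (rule solid_sup_least)
  fix z assume "x \<le> y" "\<bar>z\<bar> \<le> x"
  then show "N z \<le> solid_sup y" by (intro solid_sup_upper) (rule order_trans)
qed

lemma solid_sup_add: "0 \<le> x \<Longrightarrow> 0 \<le> y \<Longrightarrow> solid_sup (x + y) \<le> solid_sup x + solid_sup y"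
proof (rule solid_sup_least)
  fix z assume "\<bar>z\<bar> \<le> x + y" "0 \<le> x" "0 \<le> y"
  then obtain z1 z2 where "z = z1 + z2" "\<bar>z1\<bar> \<le> x" "\<bar>z2\<bar> \<le> y" by (metis Riesz_decomposition)
  then show "N z \<le> solid_sup x + solid_sup y"
    using N_triangle[of z1 z2] solid_sup_upper[of z1 x] solid_sup_upper[of z2 y] by simp
qed simp

lemma solid_sup_zero: "solid_sup 0 = 0"
proof (rule antisym)
  show "solid_sup 0 \<le> 0"
  proof (rule solid_sup_least)
    fix y :: 'a assume "\<bar>y\<bar> \<le> 0"
    then have "y = 0" by simp
    then show "N y \<le> 0" by (simp add: N_zero)
  qed simp
qed (simp add: solid_sup_nonneg)

lemma solid_sup_sum:
  assumes "\<And>i. i \<in> I \<Longrightarrow> 0 \<le> x i"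
  shows "solid_sup (\<Sum>i\<in>I. x i) \<le> (\<Sum>i\<in>I. solid_sup (x i))"
  using assms
proof (induction I rule: infinite_finite_induct)
  case (insert i I)
  have "solid_sup (\<Sum>i\<in>insert i I. x i) \<le> solid_sup (x i) + solid_sup (\<Sum>i\<in>I. x i)"
    using insert by (simp add: solid_sup_add sum_nonneg)
  then show ?case using insert by simp
qed (simp_all add: solid_sup_zero)

text \<open>
  The modulus of a functional that norms a suitable \<open>y\<close> in \<open>[-x, x]\<close> witnesses the
  size of \<open>solid_sup x\<close>. Unlike \<open>solid_sup\<close> it is additive.
\<close>

lemma solid_sup_attained:
  assumes "0 \<le> x" "c < solid_sup x"
  obtains g where "positive_functional g" "c < g x" "\<And>y. 0 \<le> y \<Longrightarrow> g y \<le> solid_sup y"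
    "\<And>y b. 0 \<le> y \<Longrightarrow> b < g y \<Longrightarrow> \<exists>z. \<bar>z\<bar> \<le> y \<and> b < N z"
proof -
  obtain y where y: "\<bar>y\<bar> \<le> x" "c < N y" using solid_sup_least[OF assms(1), of c] assms(2) by (meson not_le)
  obtain h where h: "h \<in> H" "h y = N y" using norming by blast
  obtain g where g: "positive_functional g" "\<And>x. \<bar>h x\<bar> \<le> g \<bar>x\<bar>"
    "\<And>x c. 0 \<le> x \<Longrightarrow> c < g x \<Longrightarrow> \<exists>y. \<bar>y\<bar> \<le> x \<and> c < h y"
    using modulus_exists[OF H_linear[OF h(1)]] by blast
  show ?thesis
  proof
    show "positive_functional g" by fact
    show *: "\<exists>z. \<bar>z\<bar> \<le> y \<and> b < N z" if "0 \<le> y" "b < g y" for y b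
      using g(3)[OF that] H_le[OF h(1)] by (meson less_le_trans)
    show "g y \<le> solid_sup y" if "0 \<le> y" for y
      using *[OF that, of "solid_sup y"] solid_sup_upper by (meson not_le)
    show "c < g x"
      using y h(2) g(2)[of y] positive_functional_mono[OF g(1) y(1)] by simp
  qed
qed

text \<open>
  If the increments \<open>d n\<close> were not small for the seminorm, take additive witnesses \<open>g n\<close>
  for their size. The rows \<open>g n (d i)\<close> have sums bounded by \<open>solid_sup u\<close>, so
  along a subsequence the earlier increments are almost invisible to the later witnesses. Then a
  large multiple of the earlier increments can be subtracted from each increment without making it
  small for its witness, and the positive parts that remain are disjoint, which contradicts the
  assumption on disjoint sequences.
\<close>

lemma increments_null:
  assumes d: "\<And>n. 0 \<le> d n" and u: "\<And>n. (\<Sum>i<n. d i) \<le> u"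
  shows "(\<lambda>n. solid_sup (d n)) \<longlonglongrightarrow> 0"
proof (rule ccontr)
  assume "\<not> ?thesis"
  then obtain e where e: "0 < e" "\<And>n0. \<exists>n\<ge>n0. e \<le> solid_sup (d n)"
    using solid_sup_nonneg[OF d] by (auto simp: LIMSEQ_iff not_less)
  have u0: "0 \<le> u" using u[of 0] by simp
  have "infinite {n. e / 2 < solid_sup (d n)}"
    unfolding infinite_nat_iff_unbounded_le using e(2) e(1) by (force intro: less_le_trans)
  then obtain r :: "nat \<Rightarrow> nat" where r: "strict_mono r" "\<And>n. e / 2 < solid_sup (d (r n))"
    using infinite_enumerate by (metis mem_Collect_eq)
  define f where "f n = d (r n)" for n
  have f0: "0 \<le> f n" for n by (simp add: f_def d)
  have fu: "(\<Sum>i<n. f i) \<le> u" for n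
  proof -
    have "(\<Sum>i<n. f i) = (\<Sum>i\<in>r ` {..<n}. d i)"
      using r(1) by (simp add: f_def sum.reindex strict_mono_imp_inj_on inj_on_subset)
    also have "\<dots> \<le> (\<Sum>i<r n. d i)"
      using r(1) d by (intro sum_mono2) (auto simp: strict_mono_less)
    finally show ?thesis using u order_trans by blast
  qed
  have f_le: "f n \<le> u" for n
    using fu[of "Suc n"] f0 sum_nonneg[of "{..<n}" f] by (simp add: add_increasing order_trans[rotated])
  have "\<forall>n. \<exists>g. positive_functional g \<and> e / 2 < g (f n) \<and> (\<forall>y\<ge>0. g y \<le> solid_sup y) \<and>
      (\<forall>y\<ge>0. \<forall>b<g y. \<exists>z. \<bar>z\<bar> \<le> y \<and> b < N z)"
    using solid_sup_attained[OF f0] r(2) unfolding f_def by (metis (no_types, lifting))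
  then obtain g where g: "\<And>n. positive_functional (g n)" "\<And>n. e / 2 < g n (f n)"
    "\<And>n y. 0 \<le> y \<Longrightarrow> g n y \<le> solid_sup y" "\<And>n y b. 0 \<le> y \<Longrightarrow> b < g n y \<Longrightarrow> \<exists>z. \<bar>z\<bar> \<le> y \<and> b < N z"
    by metis
  have gl: "linear (g n)" for n using g(1) by (simp add: positive_functional_def bounded_linear.linear)
  \<comment> \<open>Subtracting \<open>inverse A *\<^sub>R u\<close> costs at most \<open>solid_sup u / A\<close>, subtracting \<open>A\<close> times
    the earlier increments costs at most \<open>A * \<eta>\<close>; both are kept below \<open>e / 8\<close>.\<close>
  define A where "A = 8 * (solid_sup u + 1) / e"
  have A: "0 < A" using e(1) solid_sup_nonneg[OF u0] by (simp add: A_def)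
  have A2: "solid_sup u / A \<le> e / 8"
    using e(1) solid_sup_nonneg[OF u0] by (simp add: A_def field_simps)
  define \<eta> where "\<eta> = e / (8 * A)"
  have \<eta>: "0 < \<eta>" using A e(1) by (simp add: \<eta>_def)
  have rows: "(\<Sum>i<m. g n (f i)) \<le> solid_sup u" for n m
  proof -
    have "(\<Sum>i<m. g n (f i)) = g n (\<Sum>i<m. f i)" by (simp add: linear_sum[OF gl])
    also have "\<dots> \<le> solid_sup u" using positive_functional_mono[OF g(1) fu] g(3)[OF u0] order_trans by blast
    finally show ?thesis .
  qed
  have g_nonneg: "0 \<le> g n (f i)" for n i using g(1) f0 by (simp add: positive_functional_def)
  obtain s :: "nat \<Rightarrow> nat" where s: "strict_mono s" "\<And>k. (\<Sum>i<k. g (s k) (f (s i))) \<le> \<eta>"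
    by (rule nearly_diagonal_subsequence[of "\<lambda>n i. g n (f i)", OF g_nonneg rows \<eta>]) (rule that)
  define v where "v k = pprt (f (s k) - A *\<^sub>R (\<Sum>i<k. f (s i)) - inverse A *\<^sub>R u)" for k
  have v0: "0 \<le> v k" for k by (simp add: v_def)
  have sum0: "0 \<le> A *\<^sub>R (\<Sum>i<k. f (s i))" for k using A f0 by (simp add: sum_nonneg scaleR_nonneg_nonneg)
  have Au0: "0 \<le> inverse A *\<^sub>R u" using A u0 by (simp add: scaleR_nonneg_nonneg)
  have v_le: "v k \<le> f (s k)" for k
  proof -
    have "v k \<le> pprt (f (s k))"
      unfolding v_def using sum0[of k] Au0
      by (intro pprt_mono) (simp add: algebra_simps add_increasing2)
    then show ?thesis using f0 by simp
  qed
  have "\<exists>z. \<bar>z\<bar> \<le> v k \<and> e / 4 < N z" for k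
  proof (rule g(4)[OF v0, of _ "s k"])
    have "g (s k) (f (s k) - A *\<^sub>R (\<Sum>i<k. f (s i)) - inverse A *\<^sub>R u) =
        g (s k) (f (s k)) - A * (\<Sum>i<k. g (s k) (f (s i))) - g (s k) u / A"
      by (simp add: linear_diff[OF gl] linear_scale[OF gl] linear_sum[OF gl] divide_inverse mult.commute)
    moreover have "A * (\<Sum>i<k. g (s k) (f (s i))) \<le> A * \<eta>" using s(2) A by (simp add: mult_left_mono)
    moreover have "A * \<eta> = e / 8" using A by (simp add: \<eta>_def)
    moreover have "g (s k) u / A \<le> solid_sup u / A" using g(3)[OF u0] A by (simp add: divide_right_mono)
    ultimately have "e / 4 < g (s k) (f (s k) - A *\<^sub>R (\<Sum>i<k. f (s i)) - inverse A *\<^sub>R u)"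
      using g(2)[of "s k"] A2 by linarith
    also have "\<dots> \<le> g (s k) (v k)"
      unfolding v_def by (intro positive_functional_mono[OF g(1)]) (simp add: pprt_def)
    finally show "e / 4 < g (s k) (v k)" .
  qed
  then obtain z where z: "\<And>k. \<bar>z k\<bar> \<le> v k" "\<And>k. e / 4 < N (z k)" by metis
  have "disjoint_seq v"
  proof (rule disjoint_seqI)
    fix j k :: nat assume jk: "j < k"
    have "f (s j) \<le> (\<Sum>i<k. f (s i))"
      using jk f0 sum_mono2[of "{..<k}" "{j}" "\<lambda>i. f (s i)"] by simp
    then have "A *\<^sub>R f (s j) \<le> A *\<^sub>R (\<Sum>i<k. f (s i))" using A by (simp add: scaleR_left_mono)
    then have vk: "v k \<le> pprt (f (s k) - A *\<^sub>R f (s j))"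
      unfolding v_def using Au0 by (intro pprt_mono) (simp add: algebra_simps add_increasing add_increasing2)
    have "inverse A *\<^sub>R f (s k) \<le> inverse A *\<^sub>R u" using A f_le by (simp add: scaleR_left_mono)
    then have vj: "v j \<le> pprt (f (s j) - inverse A *\<^sub>R f (s k))"
      unfolding v_def using sum0[of j] by (intro pprt_mono) (simp add: algebra_simps add_increasing add_increasing2)
    have "inf (v k) (v j) = 0"
      by (rule disjoint_mono[OF disjoint_pprt_differences[OF A] v0 vk v0 vj])
    then show "inf \<bar>v j\<bar> \<bar>v k\<bar> = 0" using v0 by (simp add: inf_commute)
  qed
  then have "disjoint_seq z" by (rule disjoint_seq_dominated) (simp add: z(1) v0)
  moreover have "\<bar>z n\<bar> \<le> u" for n
    by (rule order_trans[OF z(1) order_trans[OF v_le f_le]])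
  ultimately have "(\<lambda>n. N (z n)) \<longlonglongrightarrow> 0" by (rule null)
  moreover have "\<forall>\<^sub>F n in sequentially. e / 4 \<le> N (z n)" using z(2) by (simp add: less_imp_le)
  ultimately have "e / 4 \<le> 0" by (intro tendsto_lowerbound) auto
  then show False using e(1) by simp
qed

lemma monotone_Cauchy:
  assumes mono: "\<And>n. x n \<le> x (Suc n)" and x: "\<And>n. 0 \<le> x n" "\<And>n. x n \<le> u" and e: "0 < e"
  obtains k where "\<And>m. k \<le> m \<Longrightarrow> solid_sup (x m - x k) \<le> e"
proof (rule ccontr)
  assume "\<not> thesis"
  with that have *: "\<exists>m\<ge>k. e < solid_sup (x m - x k)" for k by (meson not_le)
  have inc: "x i \<le> x j" if "i \<le> j" for i j using lift_Suc_mono_le[of x] mono that by blast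
  have "\<exists>r::nat \<Rightarrow> nat. \<forall>n. True \<and> (r n \<le> r (Suc n) \<and> e < solid_sup (x (r (Suc n)) - x (r n)))"
    by (rule dependent_nat_choice) (use * in auto)
  then obtain r where r: "\<And>n. r n \<le> r (Suc n)" "\<And>n. e < solid_sup (x (r (Suc n)) - x (r n))" by blast
  have "(\<lambda>n. solid_sup (x (r (Suc n)) - x (r n))) \<longlonglongrightarrow> 0"
  proof (rule increments_null)
    show "0 \<le> x (r (Suc n)) - x (r n)" for n using inc r(1) by simp
    show "(\<Sum>i<n. x (r (Suc i)) - x (r i)) \<le> u" for n
      using x(1)[of "r 0"] x(2)[of "r n"]
        sum_lessThan_telescope[of "\<lambda>n. x (r n)" n]
      by (simp add: diff_le_eq add_increasing2)
  qed
  moreover have "\<forall>\<^sub>F n in sequentially. e \<le> solid_sup (x (r (Suc n)) - x (r n))" using r(2) by (simp add: less_imp_le)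
  ultimately have "e \<le> 0" by (intro tendsto_lowerbound) auto
  then show False using e by simp
qed

text \<open>
  An \<open>\<epsilon>\<close>-\<open>\<delta>\<close> form of absolute continuity of \<open>N\<close> with respect to a single
  positive functional on \<open>[-u, u]\<close>. If no functional works, choose inductively positive elements
  \<open>w n \<le> u\<close> on which a functional \<open>\<phi> n\<close> is larger than \<open>e\<close> while all earlier
  functionals are smaller than \<open>(1/2) ^ n\<close>. The suprema of the tails of \<open>w\<close> exist
  approximately for the seminorm by \<open>monotone_Cauchy\<close>. Their finite infima form a decreasing
  sequence \<open>t n\<close>, which is again Cauchy for the seminorm; so some \<open>\<phi> p\<close> stays above
  \<open>e / 2\<close> on all later \<open>t n\<close>, although \<open>\<phi> p\<close> tends to zero on the tails.
\<close>

lemma controlling_functional: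
  assumes u: "0 \<le> u" and e: "0 < e"
  obtains g \<delta> where "positive_functional g" "0 < \<delta>"
    "\<And>z. \<bar>z\<bar> \<le> u \<Longrightarrow> g \<bar>z\<bar> < \<delta> \<Longrightarrow> N z \<le> e"
proof (rule ccontr)
  assume contra: "\<not> thesis"
  note result = that
  have bad: "\<exists>z. \<bar>z\<bar> \<le> u \<and> g \<bar>z\<bar> < \<delta> \<and> e < N z" if "positive_functional g" "0 < \<delta>" for g \<delta>
  proof (rule ccontr)
    assume "\<not> ?thesis"
    then have thesis using that by (intro result[of g \<delta>]) (auto simp: not_less)
    with contra show False ..
  qed
  have pick: "\<exists>w \<phi>. 0 \<le> w \<and> w \<le> u \<and> G w < \<delta> \<and> positive_functional \<phi> \<and> e < \<phi> w \<and> (\<forall>y\<ge>0. \<phi> y \<le> solid_sup y)"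
    if "positive_functional G" "0 < \<delta>" for G \<delta>
  proof -
    obtain z where z: "\<bar>z\<bar> \<le> u" "G \<bar>z\<bar> < \<delta>" "e < N z" using bad[of G \<delta>] \<open>positive_functional G\<close> \<open>0 < \<delta>\<close> by blast
    have "e < solid_sup \<bar>z\<bar>" using z(3) solid_sup_upper[of z "\<bar>z\<bar>"] by simp
    then obtain \<phi> where "positive_functional \<phi>" "e < \<phi> \<bar>z\<bar>" "\<And>y. 0 \<le> y \<Longrightarrow> \<phi> y \<le> solid_sup y"
      using solid_sup_attained[of "\<bar>z\<bar>" e] by (metis abs_ge_zero)
    then show ?thesis using z by (intro exI[of _ "\<bar>z\<bar>"] exI[of _ \<phi>]) simp
  qed
  \<comment> \<open>\<open>G\<close> is the sum of the functionals chosen so far.\<close>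
  define P where "P n p \<longleftrightarrow> (case p of (G, w, \<phi>) \<Rightarrow> positive_functional G \<and> 0 \<le> w \<and> w \<le> u \<and>
      G w < (1/2) ^ n \<and> positive_functional \<phi> \<and> e < \<phi> w \<and> (\<forall>y\<ge>0. \<phi> y \<le> solid_sup y))"
    for n :: nat and p :: "('a \<Rightarrow> real) \<times> 'a \<times> ('a \<Rightarrow> real)"
  have "\<exists>F. \<forall>n. P n (F n) \<and> fst (F (Suc n)) = (\<lambda>x. fst (F n) x + snd (snd (F n)) x)"
  proof (rule dependent_nat_choice)
    obtain w \<phi> where "0 \<le> w \<and> w \<le> u \<and> (0::real) < 1 \<and> positive_functional \<phi> \<and> e < \<phi> w \<and>
        (\<forall>y\<ge>0. \<phi> y \<le> solid_sup y)"
      using pick[OF positive_functional_zero, of 1] by auto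
    then have "P 0 (\<lambda>_. 0, w, \<phi>)" by (simp add: P_def positive_functional_zero)
    then show "\<exists>p. P 0 p" ..
    fix p n assume "P n p"
    then have "positive_functional (\<lambda>x. fst p x + snd (snd p) x)"
      by (auto simp: P_def intro: positive_functional_add)
    then show "\<exists>p'. P (Suc n) p' \<and> fst p' = (\<lambda>x. fst p x + snd (snd p) x)"
      using pick[of "\<lambda>x. fst p x + snd (snd p) x" "(1/2) ^ Suc n"] by (fastforce simp: P_def)
  qed
  then obtain F where F: "\<And>n. P n (F n)"
    and FS: "\<And>n. fst (F (Suc n)) = (\<lambda>x. fst (F n) x + snd (snd (F n)) x)" by blast
  define G where "G n = fst (F n)" for n
  define w where "w n = fst (snd (F n))" for n
  define \<phi> where "\<phi> n = snd (snd (F n))" for n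
  have G: "positive_functional (G n)" and w0: "0 \<le> w n" and wu: "w n \<le> u" and Gw: "G n (w n) < (1/2) ^ n"
    and \<phi>: "positive_functional (\<phi> n)" and \<phi>w: "e < \<phi> n (w n)" and \<phi>_le: "\<And>y. 0 \<le> y \<Longrightarrow> \<phi> n y \<le> solid_sup y" for n
    using F[of n] by (auto simp: P_def G_def w_def \<phi>_def split: prod.splits)
  have GS: "G (Suc n) x = G n x + \<phi> n x" for n x using FS by (simp add: G_def \<phi>_def)
  have \<phi>G: "\<phi> j x \<le> G n x" if "j < n" "0 \<le> x" for j n x
    using that
  proof (induction n)
    case (Suc n)
    have "0 \<le> G n x" "0 \<le> \<phi> n x" using G \<phi> Suc.prems by (auto simp: positive_functional_def)
    then show ?case using Suc by (cases "j = n") (auto simp: GS)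
  qed simp
  have small: "\<phi> j (w n) \<le> (1/2) ^ n" if "j < n" for j n
    using \<phi>G[OF that w0] Gw[of n] by (meson less_imp_le order_trans)
  have \<phi>lin: "linear (\<phi> n)" for n using \<phi> by (simp add: positive_functional_def bounded_linear.linear)

  \<comment> \<open>\<open>S n m\<close> is the supremum of \<open>w n, \<dots>, w (n + m)\<close>, \<open>T n\<close> an almost maximal one
    among them, and \<open>t n\<close> the infimum of \<open>T 0, \<dots>, T n\<close>.\<close>
  define S where "S n = rec_nat (w n) (\<lambda>m s. sup s (w (n + Suc m)))" for n
  have S0: "S n 0 = w n" and SS: "S n (Suc m) = sup (S n m) (w (n + Suc m))" for n m
    by (simp_all add: S_def)
  have S_upper: "w i \<le> S n m" if "n \<le> i" "i \<le> n + m" for n m i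
    using that
  proof (induction m)
    case (Suc m)
    then show ?case by (cases "i = n + Suc m") (auto simp: SS le_supI1)
  qed (simp add: S0)
  have S_least: "S n m \<le> b" if "\<And>i. n \<le> i \<Longrightarrow> i \<le> n + m \<Longrightarrow> w i \<le> b" for n m b
    using that by (induction m) (auto simp: S0 SS)
  have Su: "S n m \<le> u" for n m using S_least wu by blast
  have S_nonneg: "0 \<le> S n m" for n m using S_upper[of n n m] w0[of n] by (simp add: order_trans)
  have S_mono: "S n m \<le> S i m'" if "i \<le> n" "n + m \<le> i + m'" for n m i m'
    using that by (intro S_least S_upper) auto
  have S_small: "\<phi> j (S n m) \<le> 2 * (1/2) ^ n" if "j < n" for j n m
  proof -
    have "S n m \<le> (\<Sum>i\<le>m. w (n + i))"
    proof (induction m)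
      case (Suc m)
      have "0 \<le> (\<Sum>i\<le>m. w (n + i))" by (simp add: sum_nonneg w0)
      then show ?case using Suc w0[of "n + Suc m"] by (simp add: SS add_increasing add_increasing2)
    qed (simp add: S0)
    then have "\<phi> j (S n m) \<le> \<phi> j (\<Sum>i\<le>m. w (n + i))" by (rule positive_functional_mono[OF \<phi>])
    also have "\<dots> = (\<Sum>i\<le>m. \<phi> j (w (n + i)))" by (rule linear_sum[OF \<phi>lin])
    also have "\<dots> \<le> (\<Sum>i\<le>m. (1/2) ^ (n + i))" using that by (intro sum_mono small) simp
    also have "\<dots> = (1/2) ^ n * (2 - (1/2) ^ m)"
      by (induction m) (simp_all add: field_simps power_add)
    also have "\<dots> \<le> 2 * (1/2) ^ n" by (simp add: field_simps)
    finally show ?thesis .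
  qed
  have "\<forall>n. \<exists>k. \<forall>m\<ge>k. solid_sup (S n m - S n k) \<le> e / 8 * (1/2) ^ n"
  proof
    fix n
    have pos: "0 < e / 8 * (1/2) ^ n" using e by simp
    have inc: "S n m \<le> S n (Suc m)" for m by (simp add: SS)
    obtain k where "\<And>m. k \<le> m \<Longrightarrow> solid_sup (S n m - S n k) \<le> e / 8 * (1/2) ^ n"
      by (rule monotone_Cauchy[of "S n", OF inc S_nonneg Su pos]) (rule that)
    then show "\<exists>k. \<forall>m\<ge>k. solid_sup (S n m - S n k) \<le> e / 8 * (1/2) ^ n" by blast
  qed
  then obtain k where k: "\<And>n m. k n \<le> m \<Longrightarrow> solid_sup (S n m - S n (k n)) \<le> e / 8 * (1/2) ^ n" by metis
  define T where "T n = S n (k n)" for n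
  define t where "t = rec_nat (T 0) (\<lambda>n s. inf s (T (Suc n)))"
  have t0: "t 0 = T 0" and tS: "t (Suc n) = inf (t n) (T (Suc n))" for n by (simp_all add: t_def)
  have t_T: "t n \<le> T n" for n by (cases n) (simp_all add: t0 tS)
  have t_nonneg: "0 \<le> t n" for n by (induction n) (simp_all add: t0 tS T_def S_nonneg)
  have tu: "t n \<le> u" for n using t_T Su by (metis T_def order_trans)
  have gap: "x - t n \<le> (\<Sum>i\<le>n. pprt (x - T i))" for x n
  proof (induction n)
    case (Suc n)
    have "x - t (Suc n) = sup (x - t n) (x - T (Suc n))"
      by (simp add: tS add_sup_distrib_left)
    also have "\<dots> \<le> (\<Sum>i\<le>n. pprt (x - T i)) + pprt (x - T (Suc n))"
    proof (rule le_supI)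
      show "x - t n \<le> (\<Sum>i\<le>n. pprt (x - T i)) + pprt (x - T (Suc n))"
        using Suc by (rule order_trans) simp
      have "x - T (Suc n) \<le> pprt (x - T (Suc n))" by (simp add: pprt_def)
      then show "x - T (Suc n) \<le> (\<Sum>i\<le>n. pprt (x - T i)) + pprt (x - T (Suc n))"
        by (rule order_trans) (simp add: sum_nonneg)
    qed
    finally show ?case by simp
  qed (simp add: t0 pprt_def)
  have solid_sup_gap: "solid_sup (T n - t n) \<le> e / 4" for n
  proof -
    have each: "solid_sup (pprt (T n - T i)) \<le> e / 8 * (1/2) ^ i" if "i \<le> n" for i
    proof -
      define m where "m = max (k i) (n + k n - i)"
      have "T n \<le> S i m" unfolding T_def m_def using that by (intro S_mono) auto
      moreover have "T i \<le> S i m" unfolding T_def m_def by (intro S_mono) auto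
      ultimately have "pprt (T n - T i) \<le> S i m - T i" by (simp add: pprt_def diff_right_mono)
      then have "solid_sup (pprt (T n - T i)) \<le> solid_sup (S i m - T i)" by (intro solid_sup_mono) simp_all
      also have "\<dots> \<le> e / 8 * (1/2) ^ i" unfolding T_def by (rule k) (simp add: m_def)
      finally show ?thesis .
    qed
    have "solid_sup (T n - t n) \<le> solid_sup (\<Sum>i\<le>n. pprt (T n - T i))" using t_T gap by (intro solid_sup_mono) auto
    also have "\<dots> \<le> (\<Sum>i\<le>n. solid_sup (pprt (T n - T i)))" by (intro solid_sup_sum) simp
    also have "\<dots> \<le> (\<Sum>i\<le>n. e / 8 * (1/2) ^ i)" using each by (intro sum_mono) simp
    also have "\<dots> = e / 8 * (2 - (1/2) ^ n)" by (induction n) (simp_all add: field_simps)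
    also have "\<dots> \<le> e / 4" using e by (simp add: field_simps)
    finally show ?thesis .
  qed
  obtain p where p: "\<And>m. p \<le> m \<Longrightarrow> solid_sup ((u - t m) - (u - t p)) \<le> e / 4"
  proof (rule monotone_Cauchy[of "\<lambda>n. u - t n" u "e / 4"])
    show "u - t n \<le> u - t (Suc n)" for n by (simp add: tS)
  qed (use e t_nonneg tu in auto)
  have t_dec: "t m \<le> t p" if "p \<le> m" for m
    using lift_Suc_antimono_le[of t] that by (simp add: tS)
  have big: "e / 2 < \<phi> p (t m)" if "p \<le> m" for m
  proof -
    have "\<phi> p (T p) - \<phi> p (t p) \<le> solid_sup (T p - t p)"
      using \<phi>_le[of "T p - t p" p] t_T by (simp add: linear_diff[OF \<phi>lin])
    moreover have "\<phi> p (t p) - \<phi> p (t m) \<le> solid_sup (t p - t m)"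
      using \<phi>_le[of "t p - t m" p] t_dec[OF that] by (simp add: linear_diff[OF \<phi>lin])
    moreover have "solid_sup (t p - t m) \<le> e / 4" using p[OF that] by simp
    moreover have "\<phi> p (w p) \<le> \<phi> p (T p)"
      unfolding T_def by (intro positive_functional_mono[OF \<phi>] S_upper) auto
    ultimately show ?thesis using solid_sup_gap[of p] \<phi>w[of p] by linarith
  qed
  have "(\<lambda>n. 2 * (1/2) ^ n :: real) \<longlonglongrightarrow> 2 * 0" by (intro tendsto_intros) simp
  from order_tendstoD(2)[OF this, of "e / 2"]
  have "\<forall>\<^sub>F n in sequentially. 2 * (1/2) ^ n < e / 2" using e by simp
  then obtain M where M: "\<And>n. M \<le> n \<Longrightarrow> 2 * (1/2 :: real) ^ n < e / 2"
    by (auto simp: eventually_sequentially)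
  define m where "m = max M (Suc p)"
  have m: "p < m" "2 * (1/2 :: real) ^ m < e / 2" using M[of m] by (auto simp: m_def)
  have "\<phi> p (t m) \<le> \<phi> p (T m)" by (rule positive_functional_mono[OF \<phi> t_T])
  also have "\<dots> \<le> 2 * (1/2) ^ m" unfolding T_def by (rule S_small[OF m(1)])
  finally show False using big[of m] m by simp
qed

end

locale small_on_solid_hull = disjointly_small_seminorm N H C
  for N :: "'a::banach_lattice \<Rightarrow> real" and H C +
  fixes K :: "'a set"
  assumes bounded_K: "bounded K"
    and null_on_K: "disjoint_seq x \<Longrightarrow> (\<And>n. x n \<in> solid_hull K) \<Longrightarrow> (\<lambda>n. N (x n)) \<longlonglongrightarrow> 0"
begin

text \<open>
  If no \<open>u\<close> works, choose \<open>x n\<close> in the solid hull such that the part of \<open>\<bar>x n\<bar>\<close>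
  above \<open>4 ^ n\<close> times the sum \<open>U n\<close> of the earlier moduli is not small. Removing also
  \<open>(1/2) ^ n *\<^sub>R y\<close>, where \<open>y\<close> dominates all \<open>(1/2) ^ k *\<^sub>R \<bar>x k\<bar>\<close>, makes these
  parts disjoint and changes them by an amount that is negligible in norm.
\<close>

lemma uniform_truncation:
  assumes e: "0 < e"
  obtains u where "0 \<le> u" "\<And>x. x \<in> solid_hull K \<Longrightarrow> N (pprt (\<bar>x\<bar> - u)) \<le> e"
proof (rule ccontr)
  assume contra: "\<not> thesis"
  note result = that
  have pick: "\<exists>x. x \<in> solid_hull K \<and> e < N (pprt (\<bar>x\<bar> - u))" if "0 \<le> u" for u
  proof (rule ccontr)
    assume "\<not> ?thesis"
    then have thesis using that by (intro result[of u]) (auto simp: not_less)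
    with contra show False ..
  qed
  define P where "P n p \<longleftrightarrow> 0 \<le> fst p \<and> snd p \<in> solid_hull K \<and> e < N (pprt (\<bar>snd p\<bar> - 4 ^ n *\<^sub>R fst p))"
    for n :: nat and p :: "'a \<times> 'a"
  have "\<exists>F. \<forall>n. P n (F n) \<and> fst (F (Suc n)) = fst (F n) + \<bar>snd (F n)\<bar>"
  proof (rule dependent_nat_choice)
    obtain x where "x \<in> solid_hull K" "e < N (pprt (\<bar>x\<bar> - 0))" using pick[of 0] by auto
    then have "P 0 (0, x)" by (simp add: P_def)
    then show "\<exists>p. P 0 p" ..
    fix p n assume "P n p"
    then have U: "0 \<le> fst p + \<bar>snd p\<bar>" by (simp add: P_def)
    then obtain x where "x \<in> solid_hull K" "e < N (pprt (\<bar>x\<bar> - 4 ^ Suc n *\<^sub>R (fst p + \<bar>snd p\<bar>)))"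
      using pick[of "4 ^ Suc n *\<^sub>R (fst p + \<bar>snd p\<bar>)"] scaleR_nonneg_nonneg[OF _ U, of "4 ^ Suc n"] by auto
    with U have "P (Suc n) (fst p + \<bar>snd p\<bar>, x)" by (simp add: P_def)
    then show "\<exists>p'. P (Suc n) p' \<and> fst p' = fst p + \<bar>snd p\<bar>" by force
  qed
  then obtain F where F: "\<And>n. P n (F n)" "\<And>n. fst (F (Suc n)) = fst (F n) + \<bar>snd (F n)\<bar>" by blast
  define U where "U n = fst (F n)" for n
  define x where "x n = snd (F n)" for n
  have U0: "0 \<le> U n" and x: "x n \<in> solid_hull K" and big: "e < N (pprt (\<bar>x n\<bar> - 4 ^ n *\<^sub>R U n))" for n
    using F(1)[of n] by (auto simp: P_def U_def x_def)
  have U: "\<bar>x j\<bar> \<le> U n" if "j < n" for j n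
    using that
  proof (induction n)
    case (Suc n)
    then show ?case using U0[of n] F(2)[of n]
      by (cases "j = n") (auto simp: U_def x_def add_increasing add_increasing2)
  qed simp
  obtain B where B: "\<And>a. a \<in> K \<Longrightarrow> norm a \<le> B" using bounded_K by (auto simp: bounded_iff)
  have xB: "norm (x n) \<le> B" for n
  proof -
    obtain a where "a \<in> K" "\<bar>x n\<bar> \<le> \<bar>a\<bar>" using x[of n] by (auto simp: solid_hull_def)
    then show ?thesis using B[of a] norm_mono_abs[of "x n" a] by simp
  qed
  have summ: "summable (\<lambda>n. (1/2) ^ n *\<^sub>R \<bar>x n\<bar>)"
  proof (rule summable_comparison_test'[where g = "\<lambda>n. B * (1/2) ^ n" and N = 0])
    show "summable (\<lambda>n. B * (1/2) ^ n :: real)" by (intro summable_mult summable_geometric) simp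
    show "norm ((1/2) ^ n *\<^sub>R \<bar>x n\<bar>) \<le> B * (1/2) ^ n" for n
      using xB[of n] by (simp add: field_simps power_divide)
  qed
  define y where "y = (\<Sum>n. (1/2) ^ n *\<^sub>R \<bar>x n\<bar>)"
  have y_ge: "(1/2) ^ n *\<^sub>R \<bar>x n\<bar> \<le> y" for n
    unfolding y_def by (rule summand_le_suminf[OF summ]) (simp add: scaleR_nonneg_nonneg)
  have y0: "0 \<le> y" using y_ge[of 0] by (simp add: order_trans[OF abs_ge_zero])
  define v where "v n = pprt (\<bar>x n\<bar> - 4 ^ n *\<^sub>R U n - (1/2) ^ n *\<^sub>R y)" for n
  have v0: "0 \<le> v n" for n by (simp add: v_def)
  have U0': "0 \<le> 4 ^ n *\<^sub>R U n" for n using U0 by (simp add: scaleR_nonneg_nonneg)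
  have y0': "0 \<le> (1/2 :: real) ^ n *\<^sub>R y" for n using y0 by (simp add: scaleR_nonneg_nonneg)
  have v_le: "v n \<le> \<bar>x n\<bar>" for n
  proof -
    have "\<bar>x n\<bar> - 4 ^ n *\<^sub>R U n - (1/2) ^ n *\<^sub>R y \<le> \<bar>x n\<bar>"
      using diff_mono[OF diff_mono[OF order_refl U0'] y0', of "\<bar>x n\<bar>" n n] by simp
    then have "v n \<le> pprt \<bar>x n\<bar>" unfolding v_def by (rule pprt_mono)
    then show ?thesis by simp
  qed
  have "disjoint_seq v"
  proof (rule disjoint_seqI)
    fix j k :: nat assume jk: "j < k"
    have "4 ^ k *\<^sub>R \<bar>x j\<bar> \<le> 4 ^ k *\<^sub>R U k" using U[OF jk] by (simp add: scaleR_left_mono)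
    then have "\<bar>x k\<bar> - 4 ^ k *\<^sub>R U k - (1/2) ^ k *\<^sub>R y \<le> \<bar>x k\<bar> - 4 ^ k *\<^sub>R \<bar>x j\<bar>"
      using diff_mono[OF diff_left_mono y0'] by fastforce
    then have vk: "v k \<le> pprt (\<bar>x k\<bar> - 4 ^ k *\<^sub>R \<bar>x j\<bar>)" unfolding v_def by (rule pprt_mono)
    have "inverse (4 ^ k) \<le> (1/2 :: real) ^ (j + k)"
    proof -
      have "inverse (4 ^ k) = ((1/2) ^ (k + k) :: real)"
        by (simp add: power_add power_divide inverse_eq_divide flip: power_mult_distrib)
      also have "\<dots> \<le> (1/2) ^ (j + k)" using jk by (intro power_decreasing) auto
      finally show ?thesis .
    qed
    then have "inverse (4 ^ k) *\<^sub>R \<bar>x k\<bar> \<le> (1/2) ^ (j + k) *\<^sub>R \<bar>x k\<bar>" by (simp add: scaleR_right_mono)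
    also have "\<dots> \<le> (1/2) ^ j *\<^sub>R y"
      using scaleR_left_mono[OF y_ge[of k], of "(1/2) ^ j"] by (simp add: power_add)
    finally have "\<bar>x j\<bar> - 4 ^ j *\<^sub>R U j - (1/2) ^ j *\<^sub>R y \<le> \<bar>x j\<bar> - inverse (4 ^ k) *\<^sub>R \<bar>x k\<bar>"
      using U0'[of j] by (intro diff_mono) simp_all
    then have vj: "v j \<le> pprt (\<bar>x j\<bar> - inverse (4 ^ k) *\<^sub>R \<bar>x k\<bar>)" unfolding v_def by (rule pprt_mono)
    have "inf (v k) (v j) = 0"
      by (rule disjoint_mono[OF disjoint_pprt_differences[of "4 ^ k"] v0 vk v0 vj]) simp
    then show "inf \<bar>v j\<bar> \<bar>v k\<bar> = 0" using v0 by (simp add: inf_commute)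
  qed
  moreover have "v n \<in> solid_hull K" for n
    using x[of n] v_le[of n] v0[of n] by (auto simp: solid_hull_def intro: order_trans)
  ultimately have "(\<lambda>n. N (v n)) \<longlonglongrightarrow> 0" by (rule null_on_K)
  moreover have "(\<lambda>n. C * ((1/2) ^ n * norm y)) \<longlonglongrightarrow> C * (0 * norm y)" by (intro tendsto_intros) simp
  ultimately have "(\<lambda>n. N (v n) + C * ((1/2) ^ n * norm y)) \<longlonglongrightarrow> 0 + C * (0 * norm y)" by (rule tendsto_add)
  moreover have "e \<le> N (v n) + C * ((1/2) ^ n * norm y)" for n
  proof -
    define a where "a = \<bar>x n\<bar> - 4 ^ n *\<^sub>R U n"
    have "\<bar>pprt a - v n\<bar> \<le> \<bar>(1/2) ^ n *\<^sub>R y\<bar>"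
      using pprt_diff_le[of a "a - (1/2) ^ n *\<^sub>R y"] by (simp add: v_def a_def)
    then have "N (pprt a - v n) \<le> C * ((1/2) ^ n * norm y)" using N_le_solid by fastforce
    then show ?thesis using big[of n] N_triangle[of "v n" "pprt a - v n"] by (simp add: a_def)
  qed
  ultimately have "e \<le> 0" by (intro tendsto_lowerbound[of _ _ _ e]) auto
  then show False using e by simp
qed

end

section \<open>The Hahn--Banach theorem in a normed structure\<close>

locale vector_structure =
  fixes Y :: "'u normed_structure"
  assumes vs: "real_vector_space Y"
begin

abbreviation "V \<equiv> points Y"
abbreviation "neg x \<equiv> vscale Y (- 1) x"

lemma zero_in [simp]: "vzero Y \<in> V"
  by (rule vs[unfolded real_vector_space_def, THEN conjunct1, rule_format])

lemma add_in [simp]: "x \<in> V \<Longrightarrow> y \<in> V \<Longrightarrow> vadd Y x y \<in> V"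
  by (rule vs[unfolded real_vector_space_def, THEN conjunct2, THEN conjunct1, rule_format])

lemma scale_in [simp]: "x \<in> V \<Longrightarrow> vscale Y a x \<in> V"
  by (rule vs[unfolded real_vector_space_def, THEN conjunct2, THEN conjunct2, THEN conjunct1, rule_format])

lemma assoc: "x \<in> V \<Longrightarrow> y \<in> V \<Longrightarrow> z \<in> V \<Longrightarrow> vadd Y (vadd Y x y) z = vadd Y x (vadd Y y z)"
  by (rule vs[unfolded real_vector_space_def, THEN conjunct2, THEN conjunct2, THEN conjunct2, THEN conjunct1, rule_format])

lemma commute: "x \<in> V \<Longrightarrow> y \<in> V \<Longrightarrow> vadd Y x y = vadd Y y x"
  by (rule vs[unfolded real_vector_space_def, THEN conjunct2, THEN conjunct2, THEN conjunct2, THEN conjunct2, THEN conjunct1, rule_format])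

lemma add_zero: "x \<in> V \<Longrightarrow> vadd Y (vzero Y) x = x"
  by (rule vs[unfolded real_vector_space_def, THEN conjunct2, THEN conjunct2, THEN conjunct2, THEN conjunct2, THEN conjunct2, THEN conjunct1, rule_format])

lemma inverse_ex: "x \<in> V \<Longrightarrow> \<exists>y\<in>V. vadd Y x y = vzero Y"
  by (rule vs[unfolded real_vector_space_def, THEN conjunct2, THEN conjunct2, THEN conjunct2, THEN conjunct2, THEN conjunct2, THEN conjunct2, THEN conjunct1, rule_format])

lemma scale_add: "x \<in> V \<Longrightarrow> y \<in> V \<Longrightarrow> vscale Y a (vadd Y x y) = vadd Y (vscale Y a x) (vscale Y a y)"
  by (rule vs[unfolded real_vector_space_def, THEN conjunct2, THEN conjunct2, THEN conjunct2, THEN conjunct2, THEN conjunct2, THEN conjunct2, THEN conjunct2, THEN conjunct1, rule_format])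

lemma add_scale: "x \<in> V \<Longrightarrow> vscale Y (a + b) x = vadd Y (vscale Y a x) (vscale Y b x)"
  by (rule vs[unfolded real_vector_space_def, THEN conjunct2, THEN conjunct2, THEN conjunct2, THEN conjunct2, THEN conjunct2, THEN conjunct2, THEN conjunct2, THEN conjunct2, THEN conjunct1, rule_format])

lemma scale_scale: "x \<in> V \<Longrightarrow> vscale Y a (vscale Y b x) = vscale Y (a * b) x"
  by (rule vs[unfolded real_vector_space_def, THEN conjunct2, THEN conjunct2, THEN conjunct2, THEN conjunct2, THEN conjunct2, THEN conjunct2, THEN conjunct2, THEN conjunct2, THEN conjunct2, THEN conjunct1, rule_format])

lemma scale_one: "x \<in> V \<Longrightarrow> vscale Y 1 x = x"
  by (rule vs[unfolded real_vector_space_def, THEN conjunct2, THEN conjunct2, THEN conjunct2, THEN conjunct2, THEN conjunct2, THEN conjunct2, THEN conjunct2, THEN conjunct2, THEN conjunct2, THEN conjunct2, rule_format])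

lemma left_commute:
  "x \<in> V \<Longrightarrow> y \<in> V \<Longrightarrow> z \<in> V \<Longrightarrow> vadd Y x (vadd Y y z) = vadd Y y (vadd Y x z)"
  by (metis assoc commute)

lemma scale_zero_left: "x \<in> V \<Longrightarrow> vscale Y 0 x = vzero Y"
proof -
  assume x: "x \<in> V"
  let ?w = "vscale Y 0 x"
  have w: "?w \<in> V" using x by simp
  have ww: "vadd Y ?w ?w = ?w" using add_scale[OF x, of 0 0] by simp
  obtain y where y: "y \<in> V" "vadd Y ?w y = vzero Y" using inverse_ex[OF w] by blast
  have "vzero Y = vadd Y (vadd Y ?w ?w) y" by (simp only: ww y)
  also have "\<dots> = vadd Y ?w (vzero Y)" using w y by (simp only: assoc)
  also have "\<dots> = ?w" using w commute[OF w zero_in] add_zero[OF w] by simp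
  finally show ?thesis by simp
qed

lemma add_neg: "x \<in> V \<Longrightarrow> vadd Y x (neg x) = vzero Y"
  using add_scale[of x 1 "- 1"] by (simp add: scale_one scale_zero_left)

lemma add_zero_right: "x \<in> V \<Longrightarrow> vadd Y x (vzero Y) = x"
  using add_zero commute by simp

definition sublinear :: "('u \<Rightarrow> real) \<Rightarrow> bool" where
  "sublinear p \<longleftrightarrow> (\<forall>x\<in>V. \<forall>y\<in>V. p (vadd Y x y) \<le> p x + p y) \<and>
     (\<forall>t>0. \<forall>x\<in>V. p (vscale Y t x) = t * p x) \<and> p (vzero Y) = 0"

lemma sublinear_neg:
  assumes "sublinear p" "x \<in> V"
  shows "0 \<le> p x + p (neg x)"
  using assms add_neg[of x] by (metis scale_in sublinear_def)

text \<open>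
  The sublinear functional \<open>x \<mapsto> inf {p (x + t z) - t p z | t \<ge> 0}\<close>: the largest one below
  \<open>p\<close> that takes at \<open>- z\<close> a value of at most \<open>- p z\<close>.
\<close>

lemma sublinear_tilt:
  assumes p: "sublinear p" and z: "z \<in> V"
  obtains r where "sublinear r" "\<And>x. x \<in> V \<Longrightarrow> r x \<le> p x" "r (neg z) \<le> - p z"
proof
  define r where "r x = (INF t\<in>{0..}. p (vadd Y x (vscale Y t z)) - t * p z)" for x
  have padd: "p (vadd Y x y) \<le> p x + p y" if "x \<in> V" "y \<in> V" for x y
    using p that by (simp add: sublinear_def)
  have pscale: "p (vscale Y t x) = t * p x" if "x \<in> V" "0 \<le> t" for x t
    using p that by (cases "t = 0") (simp_all add: sublinear_def scale_zero_left)
  have bdd: "bdd_below ((\<lambda>t. p (vadd Y x (vscale Y t z)) - t * p z) ` {0..})" if x: "x \<in> V" for x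
  proof (rule bdd_belowI2)
    fix t :: real assume t: "t \<in> {0..}"
    have "vscale Y t z = vadd Y (vadd Y x (vscale Y t z)) (neg x)"
      using x z by (simp add: assoc commute left_commute add_neg add_zero)
        (metis add_neg add_zero add_zero_right assoc commute left_commute scale_in)
    then have "t * p z \<le> p (vadd Y x (vscale Y t z)) + p (neg x)"
      using padd[of "vadd Y x (vscale Y t z)" "neg x"] pscale[OF z] t x z by simp
    then show "- p (neg x) \<le> p (vadd Y x (vscale Y t z)) - t * p z" by simp
  qed
  have lower: "r x \<le> p (vadd Y x (vscale Y t z)) - t * p z" if "x \<in> V" "0 \<le> t" for x t
    unfolding r_def using that by (intro cINF_lower bdd) auto
  have greatest: "c \<le> r x" if "\<And>t. 0 \<le> t \<Longrightarrow> c \<le> p (vadd Y x (vscale Y t z)) - t * p z" for c x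
    unfolding r_def using that by (intro cINF_greatest) auto
  show r_le: "r x \<le> p x" if "x \<in> V" for x
    using lower[OF that, of 0] that z by (simp add: scale_zero_left add_zero_right)
  show "r (neg z) \<le> - p z"
    using lower[of "neg z" 1] z p commute[of "neg z" z]
    by (simp add: scale_one add_neg sublinear_def)
  have r_add: "r (vadd Y x y) \<le> r x + r y" if x: "x \<in> V" and y: "y \<in> V" for x y
  proof -
    have "r (vadd Y x y) - r y \<le> r x"
    proof (rule greatest)
      fix s :: real assume s: "0 \<le> s"
      have "r (vadd Y x y) - (p (vadd Y x (vscale Y s z)) - s * p z) \<le> r y"
      proof (rule greatest)
        fix t :: real assume t: "0 \<le> t"
        have eq: "vadd Y (vadd Y x y) (vscale Y (s + t) z) =
            vadd Y (vadd Y x (vscale Y s z)) (vadd Y y (vscale Y t z))"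
          using x y z by (simp add: add_scale assoc left_commute)
        have "r (vadd Y x y) \<le> p (vadd Y (vadd Y x y) (vscale Y (s + t) z)) - (s + t) * p z"
          using s t x y by (intro lower) auto
        also have "\<dots> \<le> p (vadd Y x (vscale Y s z)) + p (vadd Y y (vscale Y t z)) - (s + t) * p z"
          unfolding eq using x y z by (simp add: padd)
        finally show "r (vadd Y x y) - (p (vadd Y x (vscale Y s z)) - s * p z)
            \<le> p (vadd Y y (vscale Y t z)) - t * p z" by (simp add: algebra_simps)
      qed
      then show "r (vadd Y x y) - r y \<le> p (vadd Y x (vscale Y s z)) - s * p z" by simp
    qed
    then show ?thesis by simp
  qed
  have scale_le: "c * r x \<le> r (vscale Y c x)" if c: "0 < c" and x: "x \<in> V" for c x
  proof (rule greatest)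
    fix t :: real assume t: "0 \<le> t"
    have "vadd Y (vscale Y c x) (vscale Y t z) = vscale Y c (vadd Y x (vscale Y (t / c) z))"
      using c x z by (simp add: scale_add scale_scale)
    then have "p (vadd Y (vscale Y c x) (vscale Y t z)) = c * p (vadd Y x (vscale Y (t / c) z))"
      using c x z by (simp add: pscale)
    moreover have "c * r x \<le> c * (p (vadd Y x (vscale Y (t / c) z)) - t / c * p z)"
      using c t x by (intro mult_left_mono lower) auto
    ultimately show "c * r x \<le> p (vadd Y (vscale Y c x) (vscale Y t z)) - t * p z"
      using c by (simp add: right_diff_distrib)
  qed
  have r_scale: "r (vscale Y c x) = c * r x" if c: "0 < c" and x: "x \<in> V" for c x
    using scale_le[OF c x] scale_le[of "inverse c" "vscale Y c x"] c x
    by (simp add: scale_scale scale_one field_simps)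
  have "0 \<le> r (vzero Y)"
    by (rule greatest) (use z pscale in \<open>simp add: add_zero\<close>)
  then have "r (vzero Y) = 0" using r_le[of "vzero Y"] p by (simp add: sublinear_def)
  then show "sublinear r" using r_add r_scale by (simp add: sublinear_def)
qed

text \<open>
  By Zorn's lemma: the pointwise infimum of a chain of sublinear functionals below \<open>p\<close> is finite,
  being bounded below by \<open>- p (- x)\<close>, and sublinear. Values off the carrier are set to \<open>0\<close> so
  that the order is antisymmetric.
\<close>

lemma minimal_sublinear:
  assumes p: "sublinear p"
  obtains q where "sublinear q" "\<And>x. x \<in> V \<Longrightarrow> q x \<le> p x"
    "\<And>r x. sublinear r \<Longrightarrow> (\<And>x. x \<in> V \<Longrightarrow> r x \<le> q x) \<Longrightarrow> x \<in> V \<Longrightarrow> r x = q x"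
proof -
  define Q where "Q = {q. sublinear q \<and> (\<forall>x\<in>V. q x \<le> p x) \<and> (\<forall>x. x \<notin> V \<longrightarrow> q x = 0)}"
  define P where "P q q' \<longleftrightarrow> (\<forall>x. q' x \<le> q x)" for q q' :: "'u \<Rightarrow> real"
  have "\<exists>m\<in>Q. \<forall>a\<in>Q. P m a \<longrightarrow> a = m"
  proof (rule predicate_Zorn)
    show "partial_order_on Q (relation_of P Q)"
      by (intro partial_order_on_relation_ofI)
        (auto simp: P_def intro: order_trans antisym intro!: ext)
    fix C assume "C \<in> Chains (relation_of P Q)"
    then have CQ: "C \<subseteq> Q" and chain: "\<And>a b. a \<in> C \<Longrightarrow> b \<in> C \<Longrightarrow> P a b \<or> P b a"
      by (auto simp: Chains_def relation_of_def)
    show "\<exists>u\<in>Q. \<forall>a\<in>C. P a u"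
    proof (cases "C = {}")
      case True
      have "sublinear (\<lambda>x. if x \<in> V then p x else 0)" using p by (simp add: sublinear_def)
      then have "(\<lambda>x. if x \<in> V then p x else 0) \<in> Q" by (simp add: Q_def)
      then show ?thesis using True by blast
    next
      case False
      define u where "u x = (INF q\<in>C. q x)" for x
      have Qsub: "sublinear a" and Qle: "x \<in> V \<Longrightarrow> a x \<le> p x" and Qoff: "x \<notin> V \<Longrightarrow> a x = 0"
        if "a \<in> C" for a x using that CQ by (auto simp: Q_def)
      have bdd: "bdd_below ((\<lambda>q. q x) ` C)" for x
      proof (cases "x \<in> V")
        case True
        show ?thesis
        proof (rule bdd_belowI2)
          fix a assume a: "a \<in> C"
          show "- p (neg x) \<le> a x"
            using sublinear_neg[OF Qsub[OF a] True] Qle[OF a, of "neg x"] True by simp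
        qed
      next
        case False
        show ?thesis
        proof (rule bdd_belowI2[of _ 0])
          fix a assume "a \<in> C"
          then show "0 \<le> a x" using Qoff[of a x] False by simp
        qed
      qed
      have lower: "u x \<le> a x" if "a \<in> C" for a x
        unfolding u_def using that by (intro cINF_lower bdd) auto
      have greatest: "c \<le> u x" if "\<And>a. a \<in> C \<Longrightarrow> c \<le> a x" for c x
        unfolding u_def using that False by (intro cINF_greatest) auto
      have u_add: "u (vadd Y x y) \<le> u x + u y" if x: "x \<in> V" and y: "y \<in> V" for x y
      proof -
        have "u (vadd Y x y) - u y \<le> u x"
        proof (rule greatest)
          fix a assume a: "a \<in> C"
          have "u (vadd Y x y) - a x \<le> u y"
          proof (rule greatest)
            fix b assume b: "b \<in> C"
            obtain c where c: "c \<in> C" "c x \<le> a x" "c y \<le> b y"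
              using chain[OF a b] a b by (auto simp: P_def)
            have "c (vadd Y x y) \<le> c x + c y" using Qsub[OF c(1)] x y by (simp add: sublinear_def)
            then show "u (vadd Y x y) - a x \<le> b y" using lower[OF c(1), of "vadd Y x y"] c by simp
          qed
          then show "u (vadd Y x y) - u y \<le> a x" by simp
        qed
        then show ?thesis by simp
      qed
      have u_scale_le: "c * u x \<le> u (vscale Y c x)" if c: "0 < c" and x: "x \<in> V" for c x
      proof (rule greatest)
        fix a assume a: "a \<in> C"
        then show "c * u x \<le> a (vscale Y c x)"
          using Qsub[OF a] c x lower[OF a, of x] by (simp add: sublinear_def)
      qed
      have u_scale: "u (vscale Y c x) = c * u x" if c: "0 < c" and x: "x \<in> V" for c x
        using u_scale_le[OF c x] u_scale_le[of "inverse c" "vscale Y c x"] c x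
        by (simp add: scale_scale scale_one field_simps)
      have const: "u x = c" if "\<And>a. a \<in> C \<Longrightarrow> a x = c" for x c
      proof (rule antisym)
        obtain a where "a \<in> C" using False by blast
        then show "u x \<le> c" using lower[of a x] that[of a] by simp
        show "c \<le> u x" using that by (intro greatest) simp
      qed
      have "u (vzero Y) = 0" using Qsub by (intro const) (simp add: sublinear_def)
      then have "sublinear u" using u_add u_scale by (simp add: sublinear_def)
      moreover have "\<forall>x\<in>V. u x \<le> p x" using False lower Qle by (meson ex_in_conv order_trans)
      moreover have "\<forall>x. x \<notin> V \<longrightarrow> u x = 0" using const Qoff by blast
      ultimately have "u \<in> Q" by (simp add: Q_def)
      then show ?thesis using lower by (auto simp: P_def)
    qed
  qed
  then obtain q where q: "q \<in> Q" and min: "\<And>a. a \<in> Q \<Longrightarrow> P q a \<Longrightarrow> a = q" by blast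
  show ?thesis
  proof
    show "sublinear q" "\<And>x. x \<in> V \<Longrightarrow> q x \<le> p x" using q by (auto simp: Q_def)
    fix r x assume r: "sublinear r" "\<And>x. x \<in> V \<Longrightarrow> r x \<le> q x" and x: "x \<in> V"
    define r' where "r' x = (if x \<in> V then r x else 0)" for x
    have "r' \<in> Q" using r q by (force simp: Q_def r'_def sublinear_def intro: order_trans)
    moreover have "P q r'" using r q by (auto simp: P_def r'_def Q_def)
    ultimately have "r' = q" by (rule min)
    then have "r' x = q x" by simp
    then show "r x = q x" using x by (simp add: r'_def)
  qed
qed

text \<open>
  A minimal sublinear functional equals each of its tilts, hence is odd, hence linear. Tilting
  \<open>p\<close> at \<open>a\<close> before minimising forces the value at \<open>a\<close>.
\<close>

lemma dominated_functional:
  assumes p: "sublinear p" and a: "a \<in> V"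
  obtains f where "\<And>x y. x \<in> V \<Longrightarrow> y \<in> V \<Longrightarrow> f (vadd Y x y) = f x + f y"
    "\<And>c x. x \<in> V \<Longrightarrow> f (vscale Y c x) = c * f x" "\<And>x. x \<in> V \<Longrightarrow> f x \<le> p x" "f a = p a"
proof -
  obtain r where r: "sublinear r" "\<And>x. x \<in> V \<Longrightarrow> r x \<le> p x" "r (neg a) \<le> - p a"
    using sublinear_tilt[OF p a] by blast
  obtain q where q: "sublinear q" "\<And>x. x \<in> V \<Longrightarrow> q x \<le> r x"
    and min: "\<And>r x. sublinear r \<Longrightarrow> (\<And>x. x \<in> V \<Longrightarrow> r x \<le> q x) \<Longrightarrow> x \<in> V \<Longrightarrow> r x = q x"
    using minimal_sublinear[OF r(1)] by blast
  have neg: "q (neg z) = - q z" if z: "z \<in> V" for z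
  proof -
    obtain s where s: "sublinear s" "\<And>x. x \<in> V \<Longrightarrow> s x \<le> q x" "s (neg z) \<le> - q z"
      using sublinear_tilt[OF q(1) z] by blast
    have "s (neg z) = q (neg z)" using z by (intro min s) auto
    then show ?thesis using s(3) sublinear_neg[OF q(1) z] by simp
  qed
  have le: "q (vadd Y x y) \<le> q x + q y" if "x \<in> V" "y \<in> V" for x y
    using q(1) that by (simp add: sublinear_def)
  show ?thesis
  proof
    fix x y assume x: "x \<in> V" and y: "y \<in> V"
    have "x = vadd Y (vadd Y x y) (neg y)" using x y by (simp add: assoc add_neg add_zero_right)
    then have "q x \<le> q (vadd Y x y) + q (neg y)" using le[of "vadd Y x y" "neg y"] x y by simp
    then show "q (vadd Y x y) = q x + q y" using le[OF x y] neg[OF y] by simp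
  next
    fix c :: real and x assume x: "x \<in> V"
    have pos: "q (vscale Y c x) = c * q x" if "0 < c" for c
      using q(1) x that by (simp add: sublinear_def)
    consider "c = 0" | "0 < c" | "c < 0" by linarith
    then show "q (vscale Y c x) = c * q x"
    proof cases
      case 1
      then show ?thesis using q(1) x by (simp add: scale_zero_left sublinear_def)
    next
      case 2
      then show ?thesis by (rule pos)
    next
      case 3
      have "vscale Y c x = neg (vscale Y (- c) x)" using x by (simp add: scale_scale)
      then show ?thesis using neg[of "vscale Y (- c) x"] pos[of "- c"] 3 x by simp
    qed
  next
    show "q x \<le> p x" if "x \<in> V" for x using q(2)[OF that] r(2)[OF that] by simp
    have "q (neg a) \<le> r (neg a)" using a q(2) by simp
    then have "p a \<le> q a" using r(3) neg[OF a] by simp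
    moreover have "q a \<le> p a" using q(2)[OF a] r(2)[OF a] by simp
    ultimately show "q a = p a" by simp
  qed
qed

end

locale normed_space_structure = vector_structure Y for Y :: "'u normed_structure" +
  assumes bs: "banach_space Y"
begin

lemma norm_zero_iff: "x \<in> V \<Longrightarrow> vnorm Y x = 0 \<longleftrightarrow> x = vzero Y"
  by (rule bs[unfolded banach_space_def, THEN conjunct2, THEN conjunct1, rule_format])

lemma norm_scale: "x \<in> V \<Longrightarrow> vnorm Y (vscale Y a x) = \<bar>a\<bar> * vnorm Y x"
  by (rule bs[unfolded banach_space_def, THEN conjunct2, THEN conjunct2, THEN conjunct1, rule_format])

lemma norm_triangle: "x \<in> V \<Longrightarrow> y \<in> V \<Longrightarrow> vnorm Y (vadd Y x y) \<le> vnorm Y x + vnorm Y y"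
  by (rule bs[unfolded banach_space_def, THEN conjunct2, THEN conjunct2, THEN conjunct2, THEN conjunct1, rule_format])

lemma complete: "(\<And>n::nat. s n \<in> V) \<Longrightarrow> (\<And>e. 0 < e \<Longrightarrow> \<exists>N. \<forall>m\<ge>N. \<forall>n\<ge>N. vdist Y (s m) (s n) < e) \<Longrightarrow>
        \<exists>l\<in>V. (\<lambda>n. vdist Y (s n) l) \<longlonglongrightarrow> 0"
  by (rule bs[unfolded banach_space_def, THEN conjunct2, THEN conjunct2, THEN conjunct2, THEN conjunct2, rule_format])

lemma norm_nonneg: "x \<in> V \<Longrightarrow> 0 \<le> vnorm Y x"
  using norm_triangle[of x "neg x"] norm_zero_iff[of "vzero Y"] by (simp add: norm_scale add_neg)

definition unit_functionals :: "('u \<Rightarrow> real) set" where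
  "unit_functionals = {f \<in> dual_space Y. \<forall>x\<in>V. \<bar>f x\<bar> \<le> vnorm Y x}"

lemma norming_functional:
  assumes a: "a \<in> V"
  obtains f where "f \<in> unit_functionals" "f a = vnorm Y a"
proof -
  have "sublinear (vnorm Y)"
    using norm_triangle norm_scale norm_zero_iff[of "vzero Y"] by (simp add: sublinear_def)
  then obtain f where f: "\<And>x y. x \<in> V \<Longrightarrow> y \<in> V \<Longrightarrow> f (vadd Y x y) = f x + f y"
    "\<And>c x. x \<in> V \<Longrightarrow> f (vscale Y c x) = c * f x" "\<And>x. x \<in> V \<Longrightarrow> f x \<le> vnorm Y x" "f a = vnorm Y a"
    using dominated_functional a by blast
  have "\<bar>f x\<bar> \<le> vnorm Y x" if "x \<in> V" for x
    using f(3)[OF that] f(3)[of "neg x"] f(2)[OF that] norm_scale[OF that] that by (simp add: abs_le_iff)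
  then have "f \<in> unit_functionals"
    using f by (auto simp: unit_functionals_def dual_space_def intro!: exI[of _ 1])
  then show ?thesis using f(4) that by blast
qed

lemma dual_spaceE:
  assumes "f \<in> dual_space Y"
  obtains c where "0 < c" "(\<lambda>x. f x / c) \<in> unit_functionals" "(\<lambda>x. f x / c) \<in> dual_space Y"
proof -
  have "\<exists>C. \<forall>x\<in>V. \<bar>f x\<bar> \<le> C * vnorm Y x" using assms by (simp add: dual_space_def)
  then obtain C where C: "\<And>x. x \<in> V \<Longrightarrow> \<bar>f x\<bar> \<le> C * vnorm Y x" by blast
  define c where "c = \<bar>C\<bar> + 1"
  have c: "0 < c" by (simp add: c_def)
  have "\<bar>f x / c\<bar> \<le> vnorm Y x" if "x \<in> V" for x
  proof -
    have "C * vnorm Y x \<le> c * vnorm Y x" using norm_nonneg[OF that] by (intro mult_right_mono) (auto simp: c_def)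
    then show ?thesis using C[OF that] c by (simp add: abs_divide field_simps)
  qed
  moreover from this have "(\<lambda>x. f x / c) \<in> dual_space Y"
    using assms by (auto simp: dual_space_def add_divide_distrib intro!: exI[of _ 1])
  ultimately show ?thesis using c that by (simp add: unit_functionals_def)
qed

section \<open>A criterion for relative weak compactness\<close>

text \<open>
  The weak topology is the one induced by the evaluation map into the product of copies of the real
  line indexed by the dual space, which contains the bidual. This makes Tychonoff's theorem
  applicable.
\<close>

lemma weak_topology_pullback:
  "weak_topology Y = pullback_topology V (\<lambda>x. restrict (\<lambda>f. f x) (dual_space Y))
     (product_topology (\<lambda>_. euclideanreal) (dual_space Y))" (is "_ = pullback_topology V ?ev ?P")
proof (rule topology_eq[THEN iffD2], intro allI iffI)
  fix S
  have topw: "topspace (weak_topology Y) = V"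
  proof -
    have "(\<lambda>_. 0) \<in> dual_space Y" by (auto simp: dual_space_def intro!: exI[of _ 0])
    then have "V \<in> {{x \<in> V. f x \<in> U} | f U. f \<in> dual_space Y \<and> open U}"
      by (intro CollectI exI[of _ "\<lambda>_. 0"] exI[of _ UNIV]) auto
    then show ?thesis by (auto simp: weak_topology_def)
  qed
  have gen: "openin (pullback_topology V ?ev ?P) {x \<in> V. f x \<in> U}" if "f \<in> dual_space Y" "open U" for f U
  proof -
    have "openin ?P {G \<in> topspace ?P. G f \<in> U}"
      using that by (intro openin_continuous_map_preimage[OF continuous_map_product_projection]) auto
    moreover have "{x \<in> V. f x \<in> U} = ?ev -` {G \<in> topspace ?P. G f \<in> U} \<inter> V" using that by auto
    ultimately show ?thesis unfolding openin_pullback_topology by blast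
  qed
  {
    assume "openin (weak_topology Y) S"
    then have "generate_topology_on {{x \<in> V. f x \<in> U} | f U. f \<in> dual_space Y \<and> open U} S"
      by (simp add: weak_topology_def openin_topology_generated_by_iff)
    then show "openin (pullback_topology V ?ev ?P) S"
    proof induction
      case (Basis S)
      then show ?case using gen by blast
    qed auto
  next
    assume "openin (pullback_topology V ?ev ?P) S"
    then obtain U where U: "openin ?P U" "S = ?ev -` U \<inter> V" by (auto simp: openin_pullback_topology)
    have coord: "continuous_map (weak_topology Y) euclideanreal f" if "f \<in> dual_space Y" for f
      unfolding continuous_map_def topw
    proof (intro conjI allI impI)
      fix U :: "real set" assume "openin euclideanreal U"
      then show "openin (weak_topology Y) {x \<in> V. f x \<in> U}"
        unfolding weak_topology_def using that by (intro topology_generated_by_Basis) auto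
    qed simp
    have "continuous_map (weak_topology Y) ?P ?ev"
      by (auto simp: continuous_map_componentwise coord)
    then have "openin (weak_topology Y) {x \<in> topspace (weak_topology Y). ?ev x \<in> U}"
      using U(1) by (rule openin_continuous_map_preimage)
    moreover have "{x \<in> topspace (weak_topology Y). ?ev x \<in> U} = S" using U(2) topw by auto
    ultimately show "openin (weak_topology Y) S" by simp
  }
qed

text \<open>
  A bounded set is relatively weakly compact if its weak* limits in the bidual are given by points of
  the space: its weak closure is then homeomorphic to a closed subset of a product of compact
  intervals.
\<close>

lemma relatively_weakly_compactI:
  assumes A: "A \<subseteq> V" and M: "\<And>a. a \<in> A \<Longrightarrow> vnorm Y a \<le> M"
    and limits: "\<And>F. (\<And>S \<delta>. finite S \<Longrightarrow> S \<subseteq> dual_space Y \<Longrightarrow> 0 < \<delta> \<Longrightarrow>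
        \<exists>a\<in>A. \<forall>f\<in>S. \<bar>f a - F f\<bar> < \<delta>) \<Longrightarrow> \<exists>x\<in>V. \<forall>f\<in>dual_space Y. F f = f x"
  shows "relatively_weakly_compact Y A"
proof -
  define D where "D = dual_space Y"
  define ev where "ev x = restrict (\<lambda>f. f x) D" for x
  define P where "P = product_topology (\<lambda>_::'u \<Rightarrow> real. euclideanreal) D"
  have weak: "weak_topology Y = pullback_topology V ev P"
    unfolding weak_topology_pullback ev_def P_def D_def ..
  have topP: "topspace P = PiE D (\<lambda>_. UNIV)" by (simp add: P_def)
  have ev_top: "ev x \<in> topspace P" for x by (simp add: topP ev_def)
  have closure_iff: "x \<in> weak_topology Y closure_of A \<longleftrightarrow> ev x \<in> P closure_of (ev ` A)" if "x \<in> V" for x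
    unfolding in_closure_of weak openin_pullback_topology topspace_pullback_topology
    using that A ev_top by blast
  have bound: "\<exists>b. \<forall>a\<in>A. \<bar>f a\<bar> \<le> b" if "f \<in> D" for f
  proof -
    obtain c where c: "0 < c" "(\<lambda>x. f x / c) \<in> unit_functionals"
      using dual_spaceE[of f] \<open>f \<in> D\<close> unfolding D_def by blast
    have "\<bar>f a\<bar> \<le> c * M" if "a \<in> A" for a
    proof -
      have "\<bar>f a / c\<bar> \<le> vnorm Y a" using c(2) that A by (auto simp: unit_functionals_def)
      also have "\<dots> \<le> M" using M that .
      finally show ?thesis using c(1) by (simp add: field_simps)
    qed
    then show ?thesis by blast
  qed
  then obtain b where b: "\<And>f a. f \<in> D \<Longrightarrow> a \<in> A \<Longrightarrow> \<bar>f a\<bar> \<le> b f" by metis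
  define Z where "Z = P closure_of (ev ` A)"
  define R where "R = PiE D (\<lambda>f. {- b f .. b f})"
  have "compactin P R" unfolding P_def R_def by (subst compactin_PiE) auto
  moreover have "ev ` A \<subseteq> R" using b by (auto simp: ev_def R_def abs_le_iff minus_le_iff)
  moreover have "closedin P R" unfolding P_def R_def by (subst closedin_product_topology) auto
  ultimately have Z: "compactin P Z"
    unfolding Z_def by (meson closed_compactin closedin_closure_of closure_of_minimal)
  have Z_ev: "\<exists>x\<in>weak_topology Y closure_of A. F = ev x" if F: "F \<in> Z" for F
  proof -
    have approx: "\<exists>a\<in>A. \<forall>f\<in>S. \<bar>f a - F f\<bar> < \<delta>" if S: "finite S" "S \<subseteq> D" and \<delta>: "0 < \<delta>" for S \<delta>
    proof -
      define W where "W = (\<Inter>f\<in>S. {G \<in> topspace P. G f \<in> ball (F f) \<delta>}) \<inter> topspace P"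
      have "openin P W"
        unfolding W_def
      proof (rule openin_INT[OF S(1)])
        fix f assume "f \<in> S"
        then show "openin P {G \<in> topspace P. G f \<in> ball (F f) \<delta>}"
          unfolding P_def using S(2)
          by (intro openin_continuous_map_preimage[OF continuous_map_product_projection]) auto
      qed
      moreover have "F \<in> W" using F \<delta> closure_of_subset_topspace[of P "ev ` A"] by (auto simp: W_def Z_def)
      ultimately obtain a where "a \<in> A" "ev a \<in> W" using F by (auto simp: Z_def in_closure_of)
      have "\<bar>f a - F f\<bar> < \<delta>" if "f \<in> S" for f
      proof -
        have "f \<in> D" using S(2) that by blast
        then show ?thesis using \<open>ev a \<in> W\<close> that by (auto simp: W_def ev_def dist_real_def abs_minus_commute)
      qed
      then show ?thesis using \<open>a \<in> A\<close> by blast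
    qed
    have "\<exists>x\<in>V. \<forall>f\<in>dual_space Y. F f = f x"
      by (rule limits, rule approx) (simp_all add: D_def)
    then obtain x where x: "x \<in> V" "\<forall>f\<in>D. F f = f x" unfolding D_def by blast
    have "F \<in> PiE D (\<lambda>_. UNIV)"
      using F closure_of_subset_topspace[of P "ev ` A"] by (auto simp: Z_def topP)
    then have "F = ev x" using x(2) by (auto simp: ev_def PiE_def extensional_def fun_eq_iff)
    then show ?thesis using F x(1) closure_iff by (auto simp: Z_def)
  qed
  have W_V: "weak_topology Y closure_of A \<subseteq> V"
    using closure_of_subset_topspace[of "weak_topology Y" A] by (auto simp: weak topspace_pullback_topology)
  have "compactin (weak_topology Y) (weak_topology Y closure_of A)"
    unfolding compactin_def
  proof (intro conjI allI impI)
    show "weak_topology Y closure_of A \<subseteq> topspace (weak_topology Y)" by (rule closure_of_subset_topspace)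
    fix \<U> assume \<U>: "(\<forall>u\<in>\<U>. openin (weak_topology Y) u) \<and> weak_topology Y closure_of A \<subseteq> \<Union> \<U>"
    have "\<exists>G. openin P G \<and> (\<forall>x. x \<in> u \<longleftrightarrow> ev x \<in> G \<and> x \<in> V)" if "u \<in> \<U>" for u
    proof -
      have "openin (pullback_topology V ev P) u" using \<U> that by (simp add: weak)
      then show ?thesis unfolding openin_pullback_topology by auto
    qed
    then obtain U where U: "\<And>u. u \<in> \<U> \<Longrightarrow> openin P (U u)"
      "\<And>u x. u \<in> \<U> \<Longrightarrow> x \<in> u \<longleftrightarrow> ev x \<in> U u \<and> x \<in> V"
      by metis
    have "Z \<subseteq> \<Union> (U ` \<U>)"
    proof
      fix F assume "F \<in> Z"
      then obtain x where x: "x \<in> weak_topology Y closure_of A" "F = ev x" using Z_ev by blast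
      then obtain u where "u \<in> \<U>" "x \<in> u" using \<U> by blast
      then show "F \<in> \<Union> (U ` \<U>)" using U(2)[of u x] x(2) by blast
    qed
    moreover have "\<forall>G\<in>U ` \<U>. openin P G" using U(1) by blast
    ultimately obtain \<F> where \<F>: "finite \<F>" "\<F> \<subseteq> U ` \<U>" "Z \<subseteq> \<Union> \<F>"
      using Z unfolding compactin_def by blast
    then obtain \<G> where \<G>: "finite \<G>" "\<G> \<subseteq> \<U>" "\<F> = U ` \<G>"
      using finite_subset_image[OF \<F>(1,2)] by blast
    have "weak_topology Y closure_of A \<subseteq> \<Union> \<G>"
    proof
      fix x assume x: "x \<in> weak_topology Y closure_of A"
      then have "x \<in> V" using W_V by blast
      then have "ev x \<in> Z" using x closure_iff by (simp add: Z_def)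
      then obtain u where "u \<in> \<G>" "ev x \<in> U u" using \<F>(3) \<G>(3) by blast
      then show "x \<in> \<Union> \<G>" using U(2)[of u x] \<G>(2) \<open>x \<in> V\<close> by blast
    qed
    then show "\<exists>\<F>. finite \<F> \<and> \<F> \<subseteq> \<U> \<and> weak_topology Y closure_of A \<subseteq> \<Union> \<F>" using \<G> by blast
  qed
  then show ?thesis using A by (simp add: relatively_weakly_compact_def)
qed

end

section \<open>From disjoint weak compactness to weakly compact images\<close>

text \<open>
  For the modulus \<open>g\<close> of a functional, the values \<open>g \<bar>x n\<bar>\<close> have sums bounded by
  \<open>g u\<close>.
\<close>

lemma order_bounded_disjoint_weakly_null:
  fixes x :: "nat \<Rightarrow> 'a::banach_lattice"
  assumes x: "disjoint_seq x" and u: "\<And>n. \<bar>x n\<bar> \<le> u"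
  shows "weakly_null x"
  unfolding weakly_null_def
proof
  fix f :: "'a \<Rightarrow>\<^sub>L real"
  obtain g where g: "positive_functional g" "\<And>x. \<bar>blinfun_apply f x\<bar> \<le> g \<bar>x\<bar>"
    by (rule modulus_exists[OF blinfun.bounded_linear_right[of f]]) (rule that)
  have lin: "linear g" using g(1) by (simp add: positive_functional_def bounded_linear.linear)
  have abs: "disjoint_seq (\<lambda>n. \<bar>x n\<bar>)" using x by (simp add: disjoint_seq_def)
  have "summable (\<lambda>n. g \<bar>x n\<bar>)"
  proof (rule summableI_nonneg_bounded)
    show "0 \<le> g \<bar>x n\<bar>" for n using g(1) by (simp add: positive_functional_def)
    fix n
    have "(\<Sum>i<n. g \<bar>x i\<bar>) = g (\<Sum>i<n. \<bar>x i\<bar>)" by (simp add: linear_sum[OF lin])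
    also have "\<dots> \<le> g u"
      using u by (intro positive_functional_mono[OF g(1)] disjoint_sum_le[OF abs]) auto
    finally show "(\<Sum>i<n. g \<bar>x i\<bar>) \<le> g u" .
  qed
  then have "(\<lambda>n. g \<bar>x n\<bar>) \<longlonglongrightarrow> 0" by (rule summable_LIMSEQ_zero)
  moreover have "\<forall>\<^sub>F n in sequentially. norm (blinfun_apply f (x n)) \<le> g \<bar>x n\<bar>"
    using g(2) by simp
  ultimately show "(\<lambda>n. blinfun_apply f (x n)) \<longlonglongrightarrow> 0"
    by (rule Lim_null_comparison[rotated])
qed

locale bounded_operator_into = normed_space_structure Y for Y :: "'u normed_structure" +
  fixes T :: "'a::banach_lattice \<Rightarrow> 'u"
  assumes bo: "bounded_operator T Y"
begin

lemma T_in [simp]: "T x \<in> V"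
  and T_add: "T (x + y) = vadd Y (T x) (T y)"
  and T_scale: "T (c *\<^sub>R x) = vscale Y c (T x)"
  using bo by (auto simp: bounded_operator_def)

lemma T_diff: "T (x - y) = vadd Y (T x) (neg (T y))"
  using T_add[of x "(- 1) *\<^sub>R y"] T_scale[of "- 1" y] by simp

lemma vdist_T: "vdist Y (T x) (T y) = vnorm Y (T (x - y))"
  by (simp add: vdist_def T_diff)

lemma operator_bound:
  obtains C where "\<And>x. vnorm Y (T x) \<le> C * norm x"
  using bo by (auto simp: bounded_operator_def)

lemma functional_o_T:
  assumes "f \<in> unit_functionals"
  shows "bounded_linear (\<lambda>x. f (T x))"
proof -
  obtain C where C: "\<And>x. vnorm Y (T x) \<le> C * norm x" using operator_bound by blast
  have f: "f (vadd Y x y) = f x + f y" if "x \<in> V" "y \<in> V" for x y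
    using assms that by (auto simp: unit_functionals_def dual_space_def)
  have f': "f (vscale Y c x) = c * f x" "\<bar>f x\<bar> \<le> vnorm Y x" if "x \<in> V" for x c
    using assms that by (auto simp: unit_functionals_def dual_space_def)
  show ?thesis
  proof (rule bounded_linear_intro[where K = C])
    show "norm (f (T x)) \<le> norm x * C" for x
      using f'(2)[of "T x"] C[of x] by (simp add: mult.commute)
  qed (auto simp: T_add T_scale f f')
qed

end

text \<open>
  Let \<open>F\<close> be a weak* limit of points of \<open>T ` K\<close>. Truncating the elements of \<open>K\<close> to
  \<open>[-u, u]\<close> shows that for every finite set \<open>S\<close> of functionals of norm at most \<open>1\<close> the
  convex set \<open>A S\<close> of those \<open>x\<close> in \<open>[-u, u]\<close> for which \<open>T x\<close> agrees with
  \<open>F\<close> on \<open>S\<close> up to \<open>3 * \<epsilon>\<close> is nonempty. A near-minimiser \<open>x\<close> from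
  \<open>near_minimiser\<close> is close, for the controlling functional and hence for \<open>N\<close>, to points
  that satisfy the condition for any one further functional \<open>f\<close>. So \<open>T x\<close> agrees with
  \<open>F\<close> up to \<open>4 * \<epsilon>\<close> on all \<open>f\<close> at once, and \<open>F\<close> is a norm limit of
  points of the space.
\<close>

lemma disjointly_weakly_compact_imp_almost_DP_image:
  fixes K :: "'a::banach_lattice set" and X :: "'u normed_structure"
  assumes K: "bounded K" "disjointly_weakly_compact K"
    and X: "banach_space X" and T: "almost_Dunford_Pettis_operator T X"
  shows "relatively_weakly_compact X (T ` K)"
proof -
  interpret bounded_operator_into X T
    by unfold_locales (use X T in \<open>auto simp: banach_space_def almost_Dunford_Pettis_operator_def\<close>)
  obtain C where C: "\<And>x. vnorm X (T x) \<le> C * norm x" using operator_bound by blast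
  have DP: "(\<lambda>n. vnorm X (T (z n))) \<longlonglongrightarrow> 0" if "disjoint_seq z" "weakly_null z" for z
    using T that by (simp add: almost_Dunford_Pettis_operator_def)
  define N where "N x = vnorm X (T x)" for x
  define H where "H = (\<lambda>f x. f (T x)) ` unit_functionals"
  interpret small_on_solid_hull N H C K
  proof (intro small_on_solid_hull.intro disjointly_small_seminorm.intro small_on_solid_hull_axioms.intro)
    show "bounded_linear h" if "h \<in> H" for h using that functional_o_T by (auto simp: H_def)
    show "h x \<le> N x" if "h \<in> H" for h x
      using that by (auto simp: H_def N_def unit_functionals_def abs_le_iff)
    show "\<exists>h\<in>H. h x = N x" for x
      using norming_functional[of "T x"] by (auto simp: H_def N_def)
    show "N x \<le> C * norm x" for x using C by (simp add: N_def)
    show "(\<lambda>n. N (z n)) \<longlonglongrightarrow> 0" if "disjoint_seq z" "\<And>n. \<bar>z n\<bar> \<le> u" for z u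
      using DP order_bounded_disjoint_weakly_null[of z u] that by (simp add: N_def)
    show "bounded K" by fact
    show "(\<lambda>n. N (z n)) \<longlonglongrightarrow> 0" if "disjoint_seq z" "\<And>n. z n \<in> solid_hull K" for z
      using DP[of z] K(2) that by (auto simp: N_def disjointly_weakly_compact_def)
  qed
  obtain B where B: "\<And>a. a \<in> K \<Longrightarrow> norm a \<le> B" using K(1) by (auto simp: bounded_iff)
  show ?thesis
  proof (rule relatively_weakly_compactI)
    show "T ` K \<subseteq> V" by auto
    show "vnorm X a \<le> \<bar>C\<bar> * B" if "a \<in> T ` K" for a
    proof -
      obtain x where x: "x \<in> K" "a = T x" using \<open>a \<in> T ` K\<close> by blast
      have "C * norm x \<le> \<bar>C\<bar> * B" using B[OF x(1)] by (intro mult_mono) auto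
      then show ?thesis using C[of x] x(2) by simp
    qed
    fix F
    assume F: "\<exists>a\<in>T ` K. \<forall>f\<in>S. \<bar>f a - F f\<bar> < \<delta>" if "finite S" "S \<subseteq> dual_space X" "0 < \<delta>"
      for S :: "('u \<Rightarrow> real) set" and \<delta>
    have approx: "\<exists>x. \<forall>f\<in>unit_functionals. \<bar>f (T x) - F f\<bar> \<le> e" if e: "0 < e" for e
    proof -
      define \<epsilon> where "\<epsilon> = e / 4"
      have \<epsilon>: "0 < \<epsilon>" using e by (simp add: \<epsilon>_def)
      obtain u where u: "0 \<le> u" "\<And>x. x \<in> solid_hull K \<Longrightarrow> N (pprt (\<bar>x\<bar> - u)) \<le> \<epsilon>"
        using uniform_truncation[OF \<epsilon>] by blast
      obtain g \<delta> where g: "positive_functional g" "0 < \<delta>"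
        "\<And>z. \<bar>z\<bar> \<le> u + u \<Longrightarrow> g \<bar>z\<bar> < \<delta> \<Longrightarrow> N z \<le> \<epsilon>"
        using controlling_functional[of "u + u" \<epsilon>] u(1) \<epsilon> by (metis add_nonneg_nonneg)
      define A where "A S = {x. \<bar>x\<bar> \<le> u \<and> (\<forall>f\<in>S \<inter> unit_functionals. \<bar>f (T x) - F f\<bar> \<le> 3 * \<epsilon>)}" for S
      have f_le: "\<bar>f (T x)\<bar> \<le> N x" if "f \<in> unit_functionals" for f x
        using that by (simp add: unit_functionals_def N_def)
      have ne: "A S \<noteq> {}" if S: "finite S" for S
      proof -
        obtain z where z: "z \<in> K" "\<forall>f\<in>S \<inter> unit_functionals. \<bar>f (T z) - F f\<bar> < \<epsilon>"
          using F[of "S \<inter> unit_functionals" \<epsilon>] S \<epsilon> by (auto simp: unit_functionals_def)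
        define p m where "p = pprt z" and "m = - nprt z"
        have pm: "0 \<le> p" "0 \<le> m" "z = p - m" using prts[of z] by (simp_all add: p_def m_def)
        have "p \<le> \<bar>z\<bar>" "m \<le> \<bar>z\<bar>" by (simp_all add: p_def m_def abs_prts)
        then have sol: "p \<in> solid_hull K" "m \<in> solid_hull K"
          using z(1) pm by (auto simp: solid_hull_def)
        \<comment> \<open>The truncation of \<open>z\<close> is formed from its positive and negative parts separately, since
          \<open>uniform_truncation\<close> bounds \<open>N\<close> only at the positive remainders.\<close>
        define x where "x = inf p u - inf m u"
        have zx: "z = x + pprt (\<bar>p\<bar> - u) - pprt (\<bar>m\<bar> - u)"
          using pm by (simp add: x_def pprt_minus del: diff_inf_eq_sup neg_inf_eq_sup)
        have "inf p u \<le> u" "0 \<le> inf p u" "inf m u \<le> u" "0 \<le> inf m u" using pm u(1) by auto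
        then have "inf p u - inf m u \<le> u" "inf m u - inf p u \<le> u"
          by (simp_all only: diff_le_eq add_increasing2)
        then have "\<bar>x\<bar> \<le> u" unfolding x_def by (intro abs_leI) (simp_all only: minus_diff_eq)
        moreover have "\<bar>f (T x) - F f\<bar> \<le> 3 * \<epsilon>" if f: "f \<in> S \<inter> unit_functionals" for f
        proof -
          interpret f: bounded_linear "\<lambda>x. f (T x)" using functional_o_T f by simp
          have "f (T z) = f (T x) + f (T (pprt (\<bar>p\<bar> - u))) - f (T (pprt (\<bar>m\<bar> - u)))"
            by (subst zx) (simp only: f.add f.diff)
          moreover have "\<bar>f (T (pprt (\<bar>p\<bar> - u)))\<bar> \<le> \<epsilon>" "\<bar>f (T (pprt (\<bar>m\<bar> - u)))\<bar> \<le> \<epsilon>"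
            using f_le[of f] f u(2) sol by (meson IntD2 order_trans)+
          moreover have "\<bar>f (T z) - F f\<bar> < \<epsilon>" using z(2) f by blast
          ultimately show ?thesis by linarith
        qed
        ultimately show ?thesis by (auto simp: A_def)
      qed
      obtain S x where x: "finite S" "x \<in> A S"
        "\<And>S'. finite S' \<Longrightarrow> S \<subseteq> S' \<Longrightarrow> \<exists>y\<in>A S'. g \<bar>x - y\<bar> < \<delta>"
      proof (rule near_minimiser[OF g(1) u(1) g(2), of A])
        show "\<bar>x\<bar> \<le> u" if "x \<in> A S" for S x using that by (simp add: A_def)
        show "A S' \<subseteq> A S" if "S \<subseteq> S'" for S S' using that by (auto simp: A_def)
        show "(1/2) *\<^sub>R (x + y) \<in> A S" if x: "x \<in> A S" and y: "y \<in> A S" for S x y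
        proof -
          have "\<bar>x + y\<bar> \<le> u + u"
            using x y by (auto simp: A_def intro: order_trans[OF abs_triangle_ineq add_mono])
          then have "(1/2) *\<^sub>R \<bar>x + y\<bar> \<le> (1/2 :: real) *\<^sub>R (u + u)" by (intro scaleR_left_mono) auto
          then have "\<bar>(1/2) *\<^sub>R (x + y)\<bar> \<le> u"
            by (simp add: scaleR_abs scaleR_half_double del: scaleR_add_right)
          moreover have "\<bar>f (T ((1/2) *\<^sub>R (x + y))) - F f\<bar> \<le> 3 * \<epsilon>" if f: "f \<in> S \<inter> unit_functionals" for f
          proof -
            interpret f: bounded_linear "\<lambda>x. f (T x)" using functional_o_T f by simp
            have "f (T ((1/2) *\<^sub>R (x + y))) = (1/2) * (f (T x) + f (T y))"
              by (simp only: f.scale f.add real_scaleR_def)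
            moreover have "\<bar>f (T x) - F f\<bar> \<le> 3 * \<epsilon>" "\<bar>f (T y) - F f\<bar> \<le> 3 * \<epsilon>"
              using x y f by (auto simp: A_def)
            ultimately show ?thesis by (simp add: abs_le_iff field_simps)
          qed
          ultimately show ?thesis by (simp add: A_def)
        qed
      qed (use ne in auto)
      have "\<bar>f (T x) - F f\<bar> \<le> e" if f: "f \<in> unit_functionals" for f
      proof -
        interpret f: bounded_linear "\<lambda>x. f (T x)" using functional_o_T f by simp
        obtain y where y: "y \<in> A (insert f S)" "g \<bar>x - y\<bar> < \<delta>" using x(3)[of "insert f S"] x(1) by auto
        have "\<bar>x - y\<bar> \<le> u + u"
          using x(2) y(1) by (auto simp: A_def intro: order_trans[OF abs_triangle_ineq4 add_mono])
        then have "N (x - y) \<le> \<epsilon>" using g(3) y(2) by blast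
        then have "\<bar>f (T x) - f (T y)\<bar> \<le> \<epsilon>" using f_le[OF f, of "x - y"] by (simp add: f.diff)
        moreover have "\<bar>f (T y) - F f\<bar> \<le> 3 * \<epsilon>" using y(1) f by (simp add: A_def)
        ultimately show ?thesis unfolding \<epsilon>_def by linarith
      qed
      then show ?thesis by blast
    qed
    have "\<forall>n. \<exists>x. \<forall>f\<in>unit_functionals. \<bar>f (T x) - F f\<bar> \<le> inverse (real (Suc n))"
      using approx by simp
    then obtain x where x: "\<And>n f. f \<in> unit_functionals \<Longrightarrow> \<bar>f (T (x n)) - F f\<bar> \<le> inverse (real (Suc n))"
      by metis
    have dist: "vdist X (T (x m)) (T (x n)) \<le> inverse (real (Suc m)) + inverse (real (Suc n))" for m n
    proof -
      obtain f where f: "f \<in> unit_functionals" "f (T (x m - x n)) = vnorm X (T (x m - x n))"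
        using norming_functional[of "T (x m - x n)"] by auto
      interpret f: bounded_linear "\<lambda>x. f (T x)" using functional_o_T f by simp
      show ?thesis
        using x[OF f(1), of m] x[OF f(1), of n] f(2) by (simp add: vdist_T f.diff)
    qed
    have "\<exists>l\<in>V. (\<lambda>n. vdist X (T (x n)) l) \<longlonglongrightarrow> 0"
    proof (rule complete)
      fix e :: real assume "0 < e"
      then obtain M where M: "inverse (real (Suc M)) < e / 2" using reals_Archimedean[of "e / 2"] by auto
      have "vdist X (T (x m)) (T (x n)) < e" if "M \<le> m" "M \<le> n" for m n
      proof -
        have "inverse (real (Suc m)) \<le> inverse (real (Suc M))" "inverse (real (Suc n)) \<le> inverse (real (Suc M))"
          using that by (simp_all add: field_simps)
        then show ?thesis using dist[of m n] M by linarith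
      qed
      then show "\<exists>N. \<forall>m\<ge>N. \<forall>n\<ge>N. vdist X (T (x m)) (T (x n)) < e" by blast
    qed simp
    then obtain l where l: "l \<in> V" "(\<lambda>n. vdist X (T (x n)) l) \<longlonglongrightarrow> 0" by blast
    have unit: "F f = f l" if f: "f \<in> unit_functionals" for f
    proof -
      have "\<bar>f (T (x n)) - f l\<bar> \<le> vdist X (T (x n)) l" for n
      proof -
        have "f (vadd X (T (x n)) (neg l)) = f (T (x n)) - f l"
          using f l(1) by (simp add: unit_functionals_def dual_space_def)
        moreover have "\<bar>f (vadd X (T (x n)) (neg l))\<bar> \<le> vdist X (T (x n)) l"
          using f l(1) by (simp add: unit_functionals_def vdist_def)
        ultimately show ?thesis by simp
      qed
      then have "(\<lambda>n. f (T (x n)) - f l) \<longlonglongrightarrow> 0"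
        using l(2) by (intro Lim_null_comparison[OF _ l(2)]) auto
      then have "(\<lambda>n. f (T (x n))) \<longlonglongrightarrow> f l" by (rule LIM_zero_cancel)
      moreover have "(\<lambda>n. f (T (x n)) - F f) \<longlonglongrightarrow> 0"
        using x[OF f] by (intro Lim_null_comparison[OF _ LIMSEQ_inverse_real_of_nat]) auto
      then have "(\<lambda>n. f (T (x n))) \<longlonglongrightarrow> F f" by (rule LIM_zero_cancel)
      ultimately show ?thesis using LIMSEQ_unique by blast
    qed
    have "F f = f l" if f: "f \<in> dual_space X" for f
    proof -
      obtain c where c: "0 < c" "(\<lambda>x. f x / c) \<in> unit_functionals" "(\<lambda>x. f x / c) \<in> dual_space X"
        using dual_spaceE[OF f] by blast
      define f' where "f' x = f x / c" for x
      have f': "f' \<in> dual_space X" using c(3) by (simp add: f'_def[abs_def])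
      have "\<bar>F f - c * F f'\<bar> \<le> e" if e: "0 < e" for e
      proof -
        define d where "d = e / (1 + c)"
        have "(1 + c) * d = e" using c(1) by (simp add: d_def)
        then have "d + c * d = e" by (simp add: distrib_right)
        moreover have "0 < d" using e c(1) by (simp add: d_def)
        ultimately have d: "0 < d" "d + c * d = e" by blast+
        obtain a where a: "\<bar>f a - F f\<bar> < d" "\<bar>f' a - F f'\<bar> < d"
          using F[of "{f, f'}" d] f f' d by auto
        have "f a = c * f' a" using c(1) by (simp add: f'_def)
        moreover have "c * \<bar>f' a - F f'\<bar> \<le> c * d" using a(2) c(1) by simp
        then have "\<bar>c * f' a - c * F f'\<bar> \<le> c * d" using c(1) by (simp add: abs_mult flip: right_diff_distrib)
        ultimately show ?thesis using a(1) d(2) by simp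
      qed
      then have "F f = c * F f'" using field_le_epsilon[of "\<bar>F f - c * F f'\<bar>" 0] by simp
      also have "\<dots> = c * f' l" using unit[OF c(2)] by (simp add: f'_def[abs_def])
      finally show ?thesis using c(1) by (simp add: f'_def)
    qed
    then show "\<exists>x\<in>V. \<forall>f\<in>dual_space X. F f = f x" using l(1) by blast
  qed
qed

section \<open>Uniform boundedness\<close>

text \<open>
  The uniform boundedness principle, by Baire's theorem: one of the closed sets \<open>F k\<close> contains a
  ball.
\<close>

lemma uniformly_bounded_seminorms:
  fixes p :: "nat \<Rightarrow> 'a::banach \<Rightarrow> real"
  assumes cont: "\<And>N. continuous_on UNIV (p N)"
    and add: "\<And>N x y. p N (x + y) \<le> p N x + p N y"
    and scale: "\<And>N c x. p N (c *\<^sub>R x) = \<bar>c\<bar> * p N x"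
    and ptwise: "\<And>x. \<exists>M. \<forall>N. p N x \<le> M"
  obtains C where "\<And>N x. p N x \<le> C * norm x"
proof -
  define F where "F k = {x. \<forall>N. p N x \<le> real k}" for k :: nat
  have closed: "closed (F k)" for k
  proof -
    have "F k = (\<Inter>N. {x. p N x \<le> real k})" by (auto simp: F_def)
    moreover have "closed {x. p N x \<le> real k}" for N
      using cont by (intro closed_Collect_le continuous_on_const) auto
    ultimately show ?thesis by auto
  qed
  have cover: "(\<Union>k. F k) = UNIV"
  proof -
    have "\<exists>k. x \<in> F k" for x
    proof -
      obtain M where M: "\<And>N. p N x \<le> M" using ptwise by blast
      obtain k :: nat where "M \<le> real k" using real_arch_simple by blast
      then show ?thesis using M by (auto simp: F_def intro: order_trans)
    qed
    then show ?thesis by blast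
  qed
  have "\<exists>k. interior (F k) \<noteq> {}"
  proof (rule ccontr)
    assume neg: "\<not> ?thesis"
    have "euclidean interior_of \<Union> (range F) = {}"
    proof (rule Baire_category_alt)
      show "completely_metrizable_space (euclidean :: 'a topology) \<or>
          locally_compact_space (euclidean :: 'a topology) \<and> regular_space (euclidean :: 'a topology)"
        by (simp add: completely_metrizable_space_euclidean)
      show "closedin euclidean T \<and> euclidean interior_of T = {}" if "T \<in> range F" for T
        using that neg closed by auto
    qed simp
    then show False using cover by simp
  qed
  then obtain k x0 where "x0 \<in> interior (F k)" by blast
  then obtain r where r: "0 < r" "ball x0 r \<subseteq> F k" by (meson mem_interior)
  have small: "p N y \<le> 2 * real k" if "norm y < r" for N y
  proof -
    have "p N (x0 + y) \<le> real k" "p N x0 \<le> real k"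
      using r that by (auto simp: F_def dist_norm subset_iff)
    moreover have "p N y \<le> p N (x0 + y) + p N x0"
      using add[of N "x0 + y" "(-1) *\<^sub>R x0"] scale[of N "-1" x0] by simp
    ultimately show ?thesis by simp
  qed
  show ?thesis
  proof
    fix N x
    show "p N x \<le> (4 * real k / r) * norm x"
    proof (cases "x = 0")
      case True
      then show ?thesis using scale[of N 0 0] by simp
    next
      case False
      define c where "c = r / (2 * norm x)"
      have c: "0 < c" using r(1) False by (simp add: c_def)
      have "norm (c *\<^sub>R x) < r" using r(1) False by (simp add: c_def)
      then have "c * p N x \<le> 2 * real k" using small[of "c *\<^sub>R x" N] scale[of N c x] c by simp
      then show ?thesis using c False r(1) by (simp add: c_def field_simps)
    qed
  qed
qed

section \<open>The space of absolutely summable sequences\<close>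

text \<open>
  A gliding hump: otherwise, along a subsequence, most of the mass of \<open>c (k (Suc i))\<close> lies
  between \<open>m i\<close> and \<open>m (Suc i)\<close>, and the sequence \<open>s\<close> that copies the signs of
  these humps is a bounded functional which does not tend to zero.
\<close>

lemma Schur:
  fixes c :: "nat \<Rightarrow> nat \<Rightarrow> real"
  assumes summ: "\<And>k. summable (\<lambda>n. \<bar>c k n\<bar>)"
    and weak: "\<And>s. (\<And>n. \<bar>s n\<bar> \<le> 1) \<Longrightarrow> (\<lambda>k. \<Sum>n. s n * c k n) \<longlonglongrightarrow> 0"
  shows "(\<lambda>k. \<Sum>n. \<bar>c k n\<bar>) \<longlonglongrightarrow> 0"
proof (rule ccontr)
  assume neg: "\<not> ?thesis"
  have nonneg: "0 \<le> (\<Sum>n. \<bar>c k n\<bar>)" for k using summ by (simp add: suminf_nonneg)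
  obtain e where e: "0 < e" "\<And>k0. \<exists>k\<ge>k0. e \<le> (\<Sum>n. \<bar>c k n\<bar>)"
    using neg nonneg by (auto simp: LIMSEQ_iff not_less)
  have coord: "(\<lambda>k. c k n) \<longlonglongrightarrow> 0" for n
  proof -
    have "(\<Sum>i. (if i = n then 1 else 0) * c k i) = c k n" for k
      by (subst suminf_finite[of "{n}"]) auto
    then show ?thesis using weak[of "\<lambda>i. if i = n then 1 else 0"] by simp
  qed
  have heads: "\<forall>\<^sub>F k in sequentially. (\<Sum>n<m. \<bar>c k n\<bar>) < e / 8" for m
  proof -
    have "(\<lambda>k. \<Sum>n<m. \<bar>c k n\<bar>) \<longlonglongrightarrow> (\<Sum>n<m. \<bar>0\<bar>)"
      by (intro tendsto_sum tendsto_rabs coord)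
    from order_tendstoD(2)[OF this, of "e / 8"] show ?thesis using e(1) by simp
  qed
  have tails: "\<exists>m'>m. (\<Sum>n. \<bar>c k (n + m')\<bar>) < e / 8" for k m
  proof -
    have "(\<lambda>m'. \<Sum>n. \<bar>c k (n + m')\<bar>) \<longlonglongrightarrow> 0"
      using suminf_exist_split2[OF summ] by simp
    from order_tendstoD(2)[OF this, of "e / 8"]
    have "\<forall>\<^sub>F m' in sequentially. (\<Sum>n. \<bar>c k (n + m')\<bar>) < e / 8" using e(1) by simp
    then obtain M where "\<And>m'. M \<le> m' \<Longrightarrow> (\<Sum>n. \<bar>c k (n + m')\<bar>) < e / 8"
      by (auto simp: eventually_sequentially)
    then show ?thesis by (intro exI[of _ "max M (Suc m)"]) auto
  qed
  define Q where "Q p p' \<longleftrightarrow> fst p < fst p' \<and> snd p < snd p' \<and> e \<le> (\<Sum>n. \<bar>c (fst p') n\<bar>) \<and>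
      (\<Sum>n<snd p. \<bar>c (fst p') n\<bar>) < e / 8 \<and> (\<Sum>n. \<bar>c (fst p') (n + snd p')\<bar>) < e / 8"
    for p p' :: "nat \<times> nat"
  have "\<exists>f. \<forall>i::nat. True \<and> Q (f i) (f (Suc i))"
  proof (rule dependent_nat_choice)
    fix p :: "nat \<times> nat"
    obtain K where K: "\<And>k. K \<le> k \<Longrightarrow> (\<Sum>n<snd p. \<bar>c k n\<bar>) < e / 8"
      using heads[of "snd p"] by (auto simp: eventually_sequentially)
    obtain k where k: "max K (Suc (fst p)) \<le> k" "e \<le> (\<Sum>n. \<bar>c k n\<bar>)" using e(2) by blast
    obtain m' where "snd p < m'" "(\<Sum>n. \<bar>c k (n + m')\<bar>) < e / 8" using tails by blast
    then have "Q p (k, m')" using k K[of k] by (simp add: Q_def)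
    then show "\<exists>p'. True \<and> Q p p'" by blast
  qed simp
  then obtain f where f: "\<And>i. Q (f i) (f (Suc i))" by blast
  define k where "k i = fst (f i)" for i
  define m where "m i = snd (f i)" for i
  have Q: "k i < k (Suc i)" "m i < m (Suc i)" "e \<le> (\<Sum>n. \<bar>c (k (Suc i)) n\<bar>)"
    "(\<Sum>n<m i. \<bar>c (k (Suc i)) n\<bar>) < e / 8" "(\<Sum>n. \<bar>c (k (Suc i)) (n + m (Suc i))\<bar>) < e / 8" for i
    using f[of i] by (simp_all add: Q_def k_def m_def)
  have m_mono: "strict_mono m" and k_mono: "strict_mono k" using Q by (simp_all add: strict_mono_Suc_iff)
  define s where "s n = sgn (c (k (LEAST i. n < m i)) n)" for n
  have s1: "\<bar>s n\<bar> \<le> 1" for n by (simp add: s_def abs_sgn_eq)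
  have block: "s n = sgn (c (k (Suc i)) n)" if "m i \<le> n" "n < m (Suc i)" for i n
  proof -
    have "(LEAST i. n < m i) = Suc i"
    proof (rule Least_equality)
      fix i' assume "n < m i'"
      then have "m i < m i'" using that by simp
      then show "Suc i \<le> i'" using m_mono by (simp add: strict_mono_less)
    qed (use that in simp)
    then show ?thesis by (simp add: s_def)
  qed
  have big: "e / 2 \<le> (\<Sum>n. s n * c (k (Suc i)) n)" for i
  proof -
    define a where "a n = c (k (Suc i)) n" for n
    have a: "summable (\<lambda>n. \<bar>a n\<bar>)" using summ by (simp add: a_def)
    have sa_le: "\<bar>s n * a n\<bar> \<le> \<bar>a n\<bar>" for n using s1[of n] by (simp add: abs_mult mult_left_le_one_le)
    have sa: "summable (\<lambda>n. s n * a n)"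
      using sa_le by (intro summable_comparison_test[OF _ a]) auto
    define d where "d n = \<bar>a n\<bar> - s n * a n" for n
    have d: "summable d" unfolding d_def using a sa by (rule summable_diff)
    have d_le: "d n \<le> 2 * \<bar>a n\<bar>" for n using sa_le[of n] by (simp add: d_def abs_le_iff)
    have d_zero: "d n = 0" if "m i \<le> n" "n < m (Suc i)" for n
      using block[OF that] by (simp add: d_def a_def abs_sgn mult.commute)
    have "(\<Sum>n. d n) = (\<Sum>n. d (n + m (Suc i))) + (\<Sum>n<m (Suc i). d n)"
      by (rule suminf_split_initial_segment[OF d])
    moreover have "(\<Sum>n<m (Suc i). d n) = (\<Sum>n<m i. d n)"
      using Q(2)[of i] d_zero by (intro sum.mono_neutral_right) auto
    moreover have "(\<Sum>n<m i. d n) \<le> (\<Sum>n<m i. 2 * \<bar>a n\<bar>)" by (intro sum_mono d_le)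
    moreover have "(\<Sum>n<m i. 2 * \<bar>a n\<bar>) = 2 * (\<Sum>n<m i. \<bar>a n\<bar>)" by (simp add: sum_distrib_left)
    moreover have "(\<Sum>n. d (n + m (Suc i))) \<le> (\<Sum>n. 2 * \<bar>a (n + m (Suc i))\<bar>)"
      using d a d_le by (intro suminf_le summable_mult) (auto simp: summable_iff_shift intro: summable_ignore_initial_segment)
    moreover have "(\<Sum>n. 2 * \<bar>a (n + m (Suc i))\<bar>) = 2 * (\<Sum>n. \<bar>a (n + m (Suc i))\<bar>)"
      using a by (intro suminf_mult summable_ignore_initial_segment)
    moreover have "(\<Sum>n. d n) = (\<Sum>n. \<bar>a n\<bar>) - (\<Sum>n. s n * a n)"
      unfolding d_def using a sa by (rule suminf_diff[symmetric])
    ultimately show ?thesis using Q(3,4,5)[of i] by (simp add: a_def)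
  qed
  have "(\<lambda>i. \<Sum>n. s n * c (k (Suc i)) n) \<longlonglongrightarrow> 0"
    using LIMSEQ_subseq_LIMSEQ[OF weak[OF s1], of "\<lambda>i. k (Suc i)"] k_mono
    by (simp add: o_def strict_mono_Suc_iff)
  then have "e / 2 \<le> 0" using big by (intro tendsto_lowerbound) auto
  then show False using e(1) by simp
qed

text \<open>
  The Banach space of absolutely summable sequences, with points encoded by \<open>j\<close>. The operations
  decode with the inverse, so \<open>j\<close> is meant to be injective.
\<close>

definition ell1 :: "((nat \<Rightarrow> real) \<Rightarrow> 'u) \<Rightarrow> 'u normed_structure" where
  "ell1 j = \<lparr>points = j ` {c. summable (\<lambda>n. \<bar>c n\<bar>)}, vzero = j (\<lambda>_. 0),
     vadd = (\<lambda>a b. j (\<lambda>n. inv j a n + inv j b n)), vscale = (\<lambda>r a. j (\<lambda>n. r * inv j a n)),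
     vnorm = (\<lambda>a. \<Sum>n. \<bar>inv j a n\<bar>)\<rparr>"

lemma summable_abs_add:
  fixes a b :: "nat \<Rightarrow> real"
  assumes "summable (\<lambda>n. \<bar>a n\<bar>)" "summable (\<lambda>n. \<bar>b n\<bar>)"
  shows "summable (\<lambda>n. \<bar>a n + b n\<bar>)"
  by (rule summable_comparison_test[OF _ summable_add[OF assms]]) (auto intro: abs_triangle_ineq)

lemma summable_abs_scale:
  fixes a :: "nat \<Rightarrow> real"
  assumes "summable (\<lambda>n. \<bar>a n\<bar>)"
  shows "summable (\<lambda>n. \<bar>r * a n\<bar>)"
  using summable_mult[OF assms, of "\<bar>r\<bar>"] by (simp add: abs_mult)

lemma banach_space_ell1:
  fixes j :: "(nat \<Rightarrow> real) \<Rightarrow> 'u"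
  assumes j: "inj j"
  shows "banach_space (ell1 j)"
proof -
  note simps = ell1_def inv_f_f[OF j] inj_eq[OF j]
  have "real_vector_space (ell1 j)"
    unfolding real_vector_space_def
  proof (intro conjI ballI allI)
    fix x assume "x \<in> points (ell1 j)"
    then obtain c where c: "x = j c" "summable (\<lambda>n. \<bar>c n\<bar>)" by (auto simp: simps)
    show "\<exists>y\<in>points (ell1 j). vadd (ell1 j) x y = vzero (ell1 j)"
      using c by (intro bexI[of _ "j (\<lambda>n. - c n)"]) (auto simp: simps)
  qed (auto simp: simps algebra_simps intro!: imageI summable_abs_add summable_abs_scale)
  moreover have "vnorm (ell1 j) x = 0 \<longleftrightarrow> x = vzero (ell1 j)" if "x \<in> points (ell1 j)" for x
    using that by (auto simp: simps suminf_eq_zero_iff fun_eq_iff)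
  moreover have "vnorm (ell1 j) (vscale (ell1 j) a x) = \<bar>a\<bar> * vnorm (ell1 j) x"
    if "x \<in> points (ell1 j)" for a x
    using that by (auto simp: simps abs_mult suminf_mult)
  moreover have "vnorm (ell1 j) (vadd (ell1 j) x y) \<le> vnorm (ell1 j) x + vnorm (ell1 j) y"
    if xy: "x \<in> points (ell1 j)" "y \<in> points (ell1 j)" for x y
  proof -
    obtain a b where "x = j a" "summable (\<lambda>n. \<bar>a n\<bar>)" "y = j b" "summable (\<lambda>n. \<bar>b n\<bar>)"
      using xy by (auto simp: simps)
    then show ?thesis
      by (simp add: simps suminf_add) (intro suminf_le summable_abs_add summable_add abs_triangle_ineq)
  qed
  moreover have "\<exists>l\<in>points (ell1 j). (\<lambda>n. vdist (ell1 j) (s n) l) \<longlonglongrightarrow> 0"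
    if s: "\<forall>n. s n \<in> points (ell1 j)"
      and C: "\<forall>e>0. \<exists>N. \<forall>m\<ge>N. \<forall>n\<ge>N. vdist (ell1 j) (s m) (s n) < e" for s
  proof -
    have "\<forall>n. \<exists>c. s n = j c \<and> summable (\<lambda>i. \<bar>c i\<bar>)" using s by (auto simp: simps)
    then obtain t where t: "\<And>n. s n = j (t n)" "\<And>n. summable (\<lambda>i. \<bar>t n i\<bar>)" by metis
    have diff_summable: "summable (\<lambda>i. \<bar>a i - b i\<bar>)" if "summable (\<lambda>i. \<bar>a i\<bar>)" "summable (\<lambda>i. \<bar>b i\<bar>)"
      for a b :: "nat \<Rightarrow> real"
      using summable_abs_add[of a "\<lambda>i. - b i"] that by simp
    have vd: "vdist (ell1 j) (j a) (j b) = (\<Sum>i. \<bar>a i - b i\<bar>)" for a b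
      by (simp add: vdist_def simps)
    have C': "\<exists>N. \<forall>m\<ge>N. \<forall>n\<ge>N. (\<Sum>i. \<bar>t m i - t n i\<bar>) < e" if "0 < e" for e
      using C that by (simp add: t(1) vd)
    have coord_le: "\<bar>t m i - t n i\<bar> \<le> (\<Sum>i. \<bar>t m i - t n i\<bar>)" for m n i
      using sum_le_suminf[OF diff_summable[OF t(2) t(2)], of "{i}" m n] by simp
    have "Cauchy (\<lambda>n. t n i)" for i
      unfolding Cauchy_def dist_real_def
    proof (intro allI impI)
      fix e :: real assume "0 < e"
      from C'[OF this] show "\<exists>M. \<forall>m\<ge>M. \<forall>n\<ge>M. \<bar>t m i - t n i\<bar> < e"
        using coord_le by (meson le_less_trans)
    qed
    then have "\<forall>i. \<exists>l. (\<lambda>n. t n i) \<longlonglongrightarrow> l" using Cauchy_convergent convergent_def by blast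
    then obtain L where L: "\<And>i. (\<lambda>n. t n i) \<longlonglongrightarrow> L i" by metis
    have lim: "\<exists>N. \<forall>m\<ge>N. summable (\<lambda>i. \<bar>t m i - L i\<bar>) \<and> (\<Sum>i. \<bar>t m i - L i\<bar>) \<le> e" if e: "0 < e" for e
    proof -
      obtain N where N: "\<And>m n. N \<le> m \<Longrightarrow> N \<le> n \<Longrightarrow> (\<Sum>i. \<bar>t m i - t n i\<bar>) < e" using C'[OF e] by blast
      have "summable (\<lambda>i. \<bar>t m i - L i\<bar>) \<and> (\<Sum>i. \<bar>t m i - L i\<bar>) \<le> e" if m: "N \<le> m" for m
      proof -
        have partial: "(\<Sum>i<M. \<bar>t m i - L i\<bar>) \<le> e" for M
        proof (rule tendsto_upperbound)
          show "(\<lambda>n. \<Sum>i<M. \<bar>t m i - t n i\<bar>) \<longlonglongrightarrow> (\<Sum>i<M. \<bar>t m i - L i\<bar>)"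
            by (intro tendsto_intros L)
          show "\<forall>\<^sub>F n in sequentially. (\<Sum>i<M. \<bar>t m i - t n i\<bar>) \<le> e"
            using eventually_ge_at_top[of N]
          proof eventually_elim
            case (elim n)
            have "(\<Sum>i<M. \<bar>t m i - t n i\<bar>) \<le> (\<Sum>i. \<bar>t m i - t n i\<bar>)"
              by (intro sum_le_suminf diff_summable t) auto
            then show ?case using N[OF m elim] by simp
          qed
        qed simp
        have "summable (\<lambda>i. \<bar>t m i - L i\<bar>)"
          using partial by (intro summableI_nonneg_bounded) auto
        then show ?thesis using partial by (intro conjI suminf_le_const)
      qed
      then show ?thesis by blast
    qed
    obtain M where M: "summable (\<lambda>i. \<bar>t M i - L i\<bar>)" using lim[of 1] by auto
    have "summable (\<lambda>i. \<bar>t M i - (t M i - L i)\<bar>)" using t(2) M by (rule diff_summable)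
    then have "j L \<in> points (ell1 j)" by (simp add: simps)
    moreover have "(\<lambda>n. vdist (ell1 j) (s n) (j L)) \<longlonglongrightarrow> 0"
    proof (rule LIMSEQ_I)
      fix e :: real assume e: "0 < e"
      obtain N where N: "\<And>m. N \<le> m \<Longrightarrow> summable (\<lambda>i. \<bar>t m i - L i\<bar>) \<and> (\<Sum>i. \<bar>t m i - L i\<bar>) \<le> e / 2"
        using lim[of "e / 2"] e by auto
      have "norm (vdist (ell1 j) (s n) (j L) - 0) < e" if "N \<le> n" for n
        using N[OF that] e suminf_nonneg[of "\<lambda>i. \<bar>t n i - L i\<bar>"] by (simp add: t(1) vd)
      then show "\<exists>N. \<forall>n\<ge>N. norm (vdist (ell1 j) (s n) (j L) - 0) < e" by blast
    qed
    ultimately show ?thesis by blast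
  qed
  ultimately show ?thesis unfolding banach_space_def by blast
qed

section \<open>RDP-sets are V*-sets\<close>

lemma compactin_sequence_cluster_point:
  fixes y :: "nat \<Rightarrow> 'b"
  assumes W: "compactin X W" and y: "\<And>k. y k \<in> W"
  obtains w where "w \<in> W" "\<And>U. openin X U \<Longrightarrow> w \<in> U \<Longrightarrow> infinite {k. y k \<in> U}"
proof (rule ccontr)
  assume neg: "\<not> thesis"
  have "\<exists>U. openin X U \<and> w \<in> U \<and> finite {k. y k \<in> U}" if "w \<in> W" for w
    using neg \<open>w \<in> W\<close> \<open>\<And>w. w \<in> W \<Longrightarrow> (\<And>U. openin X U \<Longrightarrow> w \<in> U \<Longrightarrow> infinite {k. y k \<in> U}) \<Longrightarrow> thesis\<close>
    by blast
  then obtain U where U: "\<And>w. w \<in> W \<Longrightarrow> openin X (U w) \<and> w \<in> U w \<and> finite {k. y k \<in> U w}" by metis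
  have "\<forall>V\<in>U ` W. openin X V" "W \<subseteq> \<Union> (U ` W)" using U by blast+
  then obtain F where F: "finite F" "F \<subseteq> U ` W" "W \<subseteq> \<Union> F"
    using W unfolding compactin_def by blast
  have "UNIV \<subseteq> (\<Union>V\<in>F. {k. y k \<in> V})" using y F(3) by blast
  moreover have "finite (\<Union>V\<in>F. {k. y k \<in> V})" using F(1,2) U by auto
  ultimately show False using infinite_UNIV_nat finite_subset by blast
qed

lemma openin_weak_topology_functional:
  "f \<in> dual_space Y \<Longrightarrow> open U \<Longrightarrow> openin (weak_topology Y) {x \<in> points Y. f x \<in> U}"
  unfolding weak_topology_def by (intro topology_generated_by_Basis) auto

text \<open>
  Let \<open>b\<close> be a weak cluster point of the sequence \<open>a\<close>. Some subsequence converges to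
  \<open>b\<close> in every coordinate, so \<open>b\<close> is its only weak cluster point, and by compactness it
  converges weakly. By \<open>Schur\<close> it converges in norm, while \<open>b\<close> has small coordinates far
  out.
\<close>

lemma weakly_compact_ell1_tails:
  fixes j :: "(nat \<Rightarrow> real) \<Rightarrow> 'u"
  assumes j: "inj j" and W: "relatively_weakly_compact (ell1 j) A"
    and a: "\<And>k. j (a k) \<in> A" and r: "\<And>k. k \<le> r k" and e: "0 < e"
  shows "\<exists>k. \<bar>a k (r k)\<bar> \<le> e"
proof (rule ccontr)
  assume "\<not> ?thesis"
  then have big: "e < \<bar>a k (r k)\<bar>" for k by (meson not_le)
  let ?Y = "ell1 j"
  note simps = ell1_def inv_f_f[OF j] inj_eq[OF j]
  define C where "C = weak_topology ?Y closure_of A"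
  have C: "compactin (weak_topology ?Y) C" "A \<subseteq> points ?Y"
    using W by (simp_all add: relatively_weakly_compact_def C_def)
  have topw: "topspace (weak_topology ?Y) \<subseteq> points ?Y"
    by (auto simp: weak_topology_def)
  have point: "\<exists>c. w = j c \<and> summable (\<lambda>n. \<bar>c n\<bar>)" if "w \<in> C" for w
    using that closure_of_subset_topspace[of "weak_topology ?Y" A] topw by (auto simp: C_def simps)
  have a_sum: "summable (\<lambda>n. \<bar>a k n\<bar>)" for k using a[of k] C(2) by (auto simp: simps)
  have pts: "points ?Y \<subseteq> topspace (weak_topology ?Y)"
  proof
    fix x assume x: "x \<in> points ?Y"
    have "(\<lambda>_. 0) \<in> dual_space ?Y" by (auto simp: dual_space_def intro!: exI[of _ 0])
    from openin_weak_topology_functional[OF this, of UNIV] show "x \<in> topspace (weak_topology ?Y)"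
      using x openin_subset by fastforce
  qed
  have aC: "j (a k) \<in> C" for k
    using a[of k] C(2) pts closure_of_subset[of A "weak_topology ?Y"] by (auto simp: C_def)
  define \<phi> where "\<phi> s x = (\<Sum>n. s n * inv j x n)" for s :: "nat \<Rightarrow> real" and x
  have \<phi>_j: "\<phi> s (j c) = (\<Sum>n. s n * c n)" for s c by (simp add: \<phi>_def inv_f_f[OF j])
  have mult_summable: "summable (\<lambda>n. s n * c n)"
    if s: "\<And>n. \<bar>s n\<bar> \<le> 1" and c: "summable (\<lambda>n. \<bar>c n\<bar>)" for s c :: "nat \<Rightarrow> real"
  proof (rule summable_comparison_test[OF _ c])
    show "\<exists>N. \<forall>n\<ge>N. norm (s n * c n) \<le> \<bar>c n\<bar>"
      using s by (auto simp: abs_mult intro!: mult_left_le_one_le)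
  qed
  have \<phi>_dual: "\<phi> s \<in> dual_space ?Y" if s: "\<And>n. \<bar>s n\<bar> \<le> 1" for s
  proof -
    have "\<bar>\<Sum>n. s n * c n\<bar> \<le> 1 * (\<Sum>n. \<bar>c n\<bar>)" if c: "summable (\<lambda>n. \<bar>c n\<bar>)" for c
    proof -
      have le: "\<bar>s n * c n\<bar> \<le> \<bar>c n\<bar>" for n using s[of n] by (simp add: abs_mult mult_left_le_one_le)
      have "summable (\<lambda>n. \<bar>s n * c n\<bar>)"
        using le by (intro summable_comparison_test[OF _ c]) auto
      then have "\<bar>\<Sum>n. s n * c n\<bar> \<le> (\<Sum>n. \<bar>s n * c n\<bar>)" by (rule summable_rabs)
      also have "\<dots> \<le> (\<Sum>n. \<bar>c n\<bar>)"
        using le \<open>summable (\<lambda>n. \<bar>s n * c n\<bar>)\<close> c by (intro suminf_le)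
      finally show ?thesis by simp
    qed
    moreover have "(\<Sum>n. s n * (b n + c n)) = (\<Sum>n. s n * b n) + (\<Sum>n. s n * c n)"
      if "summable (\<lambda>n. \<bar>b n\<bar>)" "summable (\<lambda>n. \<bar>c n\<bar>)" for b c
      using that s by (simp add: distrib_left suminf_add mult_summable)
    moreover have "(\<Sum>n. s n * (t * c n)) = t * (\<Sum>n. s n * c n)"
      if "summable (\<lambda>n. \<bar>c n\<bar>)" for t c
      using that s by (simp add: mult.left_commute[of _ t] suminf_mult mult_summable)
    ultimately show ?thesis
      unfolding dual_space_def by (auto simp: simps \<phi>_j intro!: exI[of _ 1])
  qed
  \<comment> \<open>The coordinate functionals.\<close>
  define \<pi> where "\<pi> n = \<phi> (\<lambda>i. if i = n then 1 else 0)" for n :: nat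
  have \<pi>_dual: "\<pi> n \<in> dual_space ?Y" for n unfolding \<pi>_def by (rule \<phi>_dual) simp
  have \<pi>_j: "\<pi> n (j c) = c n" for n c
    unfolding \<pi>_def \<phi>_j by (subst suminf_finite[of "{n}"]) auto
  have nbhd: "openin (weak_topology ?Y) {x \<in> points ?Y. f x \<in> ball t d}" if "f \<in> dual_space ?Y" for f t d
    using that by (rule openin_weak_topology_functional) simp

  obtain w where w: "w \<in> C" "\<And>U. openin (weak_topology ?Y) U \<Longrightarrow> w \<in> U \<Longrightarrow> infinite {k. j (a k) \<in> U}"
    by (rule compactin_sequence_cluster_point[of _ _ "\<lambda>k. j (a k)", OF C(1) aC]) (rule that)
  obtain b where b: "w = j b" "summable (\<lambda>n. \<bar>b n\<bar>)" using point[OF w(1)] by blast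
  have w_pt: "w \<in> points ?Y" using b by (simp add: simps)
  have step: "\<exists>k>k0. \<forall>n<i. \<bar>a k n - b n\<bar> < inverse (real (Suc i))" for k0 i
  proof -
    define d where "d = inverse (real (Suc i))"
    have d: "0 < d" by (simp add: d_def)
    define U where "U = (\<Inter>n\<in>{..<i}. {x \<in> points ?Y. \<pi> n x \<in> ball (b n) d}) \<inter> topspace (weak_topology ?Y)"
    have "openin (weak_topology ?Y) U"
      unfolding U_def by (intro openin_INT nbhd \<pi>_dual) simp
    moreover have "w \<in> U" using w_pt pts d by (auto simp: U_def b(1) \<pi>_j)
    ultimately have "infinite {k. j (a k) \<in> U}" by (rule w(2))
    then obtain k where k: "k0 < k" "j (a k) \<in> U" by (meson infinite_nat_iff_unbounded mem_Collect_eq)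
    have "\<bar>a k n - b n\<bar> < d" if "n < i" for n
      using k(2) that by (auto simp: U_def \<pi>_j dist_real_def abs_minus_commute)
    then show ?thesis using k(1) unfolding d_def by blast
  qed
  have "\<exists>f. \<forall>i. (\<forall>n<i. \<bar>a (f i) n - b n\<bar> < inverse (real (Suc i))) \<and> f i < f (Suc i)"
  proof (rule dependent_nat_choice)
    fix m i
    show "\<exists>k. (\<forall>n<Suc i. \<bar>a k n - b n\<bar> < inverse (real (Suc (Suc i)))) \<and> m < k"
      using step[of m "Suc i"] by blast
  qed simp
  then obtain k where k: "\<And>i n. n < i \<Longrightarrow> \<bar>a (k i) n - b n\<bar> < inverse (real (Suc i))" "\<And>i. k i < k (Suc i)"
    by blast
  have k_mono: "strict_mono k" using k(2) by (simp add: strict_mono_Suc_iff)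
  have coord: "(\<lambda>i. a (k i) n) \<longlonglongrightarrow> b n" for n
  proof -
    have "\<forall>\<^sub>F i in sequentially. norm (a (k i) n - b n) \<le> inverse (real (Suc i))"
      using eventually_gt_at_top[of n] by eventually_elim (use k(1) in \<open>auto intro: less_imp_le\<close>)
    then have "(\<lambda>i. a (k i) n - b n) \<longlonglongrightarrow> 0"
      by (rule Lim_null_comparison[OF _ LIMSEQ_inverse_real_of_nat])
    then show ?thesis by (rule LIM_zero_cancel)
  qed
  have weak: "(\<lambda>i. \<phi> s (j (a (k i)))) \<longlonglongrightarrow> \<phi> s w" if s: "\<And>n. \<bar>s n\<bar> \<le> 1" for s
  proof (rule ccontr)
    assume "\<not> ?thesis"
    then obtain d where d: "0 < d" "\<And>i0. \<exists>i\<ge>i0. d \<le> \<bar>\<phi> s (j (a (k i))) - \<phi> s w\<bar>"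
      by (auto simp: LIMSEQ_iff not_less)
    have inf: "infinite {i. d \<le> \<bar>\<phi> s (j (a (k i))) - \<phi> s w\<bar>}"
      unfolding infinite_nat_iff_unbounded_le using d(2) by simp
    obtain q :: "nat \<Rightarrow> nat" where q: "strict_mono q" "\<And>l. d \<le> \<bar>\<phi> s (j (a (k (q l)))) - \<phi> s w\<bar>"
      using infinite_enumerate[OF inf] by auto
    obtain v where v: "v \<in> C"
      "\<And>U. openin (weak_topology ?Y) U \<Longrightarrow> v \<in> U \<Longrightarrow> infinite {l. j (a (k (q l))) \<in> U}"
      by (rule compactin_sequence_cluster_point[of _ _ "\<lambda>l. j (a (k (q l)))", OF C(1) aC]) (rule that)
    obtain c where c: "v = j c" "summable (\<lambda>n. \<bar>c n\<bar>)" using point[OF v(1)] by blast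
    have v_pt: "v \<in> points ?Y" using c by (simp add: simps)
    have hit: "\<exists>l\<ge>l0. \<bar>f (j (a (k (q l)))) - f v\<bar> < \<delta>" if f: "f \<in> dual_space ?Y" and \<delta>: "0 < \<delta>" for f \<delta> l0
    proof -
      have "infinite {l. j (a (k (q l))) \<in> {x \<in> points ?Y. f x \<in> ball (f v) \<delta>}}"
        using v_pt \<delta> by (intro v(2) nbhd f) auto
      then obtain l where "l0 \<le> l" "l \<in> {l. j (a (k (q l))) \<in> {x \<in> points ?Y. f x \<in> ball (f v) \<delta>}}"
        unfolding infinite_nat_iff_unbounded_le by blast
      then show ?thesis by (auto simp: dist_real_def abs_minus_commute)
    qed
    have "c n = b n" for n
    proof (rule ccontr)
      assume ne: "c n \<noteq> b n"
      define \<delta> where "\<delta> = \<bar>c n - b n\<bar> / 2"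
      have \<delta>: "0 < \<delta>" using ne by (simp add: \<delta>_def)
      have conv: "(\<lambda>l. a (k (q l)) n) \<longlonglongrightarrow> b n"
        using LIMSEQ_subseq_LIMSEQ[OF coord q(1)] by (simp add: o_def)
      obtain l0 where l0: "\<And>l. l0 \<le> l \<Longrightarrow> \<bar>a (k (q l)) n - b n\<bar> < \<delta>"
        using LIMSEQ_D[OF conv \<delta>] by auto
      obtain l where l: "l0 \<le> l" "\<bar>a (k (q l)) n - c n\<bar> < \<delta>"
        using hit[OF \<pi>_dual \<delta>, of l0 n] by (auto simp: \<pi>_j c(1))
      then have "\<bar>c n - b n\<bar> < \<delta> + \<delta>" using l0[OF l(1)] by linarith
      then show False by (simp add: \<delta>_def)
    qed
    then have "c = b" by (rule ext)
    then have "v = w" by (simp add: c(1) b(1))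
    then show False using hit[OF \<phi>_dual[of s, OF s] d(1), of 0] q(2) by (meson not_le)
  qed
  define D where "D i n = a (k i) n - b n" for i n
  have D: "summable (\<lambda>n. \<bar>D i n\<bar>)" for i
    unfolding D_def using summable_abs_add[of "a (k i)" "\<lambda>n. - b n"] a_sum b(2) by simp
  have lim: "(\<lambda>i. \<Sum>n. \<bar>D i n\<bar>) \<longlonglongrightarrow> 0"
  proof (rule Schur[OF D])
    fix s :: "nat \<Rightarrow> real" assume s: "\<And>n. \<bar>s n\<bar> \<le> 1"
    have "(\<Sum>n. s n * D i n) = \<phi> s (j (a (k i))) - \<phi> s w" for i
      using mult_summable[OF s a_sum] mult_summable[OF s b(2)]
      by (simp add: D_def b(1) \<phi>_j right_diff_distrib suminf_diff)
    then show "(\<lambda>i. \<Sum>n. s n * D i n) \<longlonglongrightarrow> 0" using LIM_zero[OF weak[of s, OF s]] by simp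
  qed
  have "(\<lambda>n. \<bar>b n\<bar>) \<longlonglongrightarrow> 0" using b(2) by (rule summable_LIMSEQ_zero)
  then obtain n0 where n0: "\<And>n. n0 \<le> n \<Longrightarrow> \<bar>b n\<bar> < e / 2"
    using e LIMSEQ_D[of "\<lambda>n. \<bar>b n\<bar>" 0 "e / 2"] by auto
  obtain i0 where i0: "\<And>i. i0 \<le> i \<Longrightarrow> (\<Sum>n. \<bar>D i n\<bar>) < e / 2"
    using e order_tendstoD(2)[OF lim, of "e / 2"] by (auto simp: eventually_sequentially)
  define i where "i = max n0 i0"
  have "n0 \<le> r (k i)"
    using strict_mono_imp_increasing[OF k_mono, of i] r[of "k i"] by (simp add: i_def)
  then have "\<bar>b (r (k i))\<bar> < e / 2" by (rule n0)
  moreover have "\<bar>D i (r (k i))\<bar> \<le> (\<Sum>n. \<bar>D i n\<bar>)"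
    using sum_le_suminf[OF D, of "{r (k i)}" i] by simp
  moreover have "(\<Sum>n. \<bar>D i n\<bar>) < e / 2" by (rule i0) (simp add: i_def)
  ultimately show False using big[of "k i"] by (simp add: D_def)
qed

lemma absolutely_summable_functionals_bounded:
  fixes x' :: "nat \<Rightarrow> ('a::banach \<Rightarrow>\<^sub>L real)"
  assumes summ: "\<And>x. summable (\<lambda>n. \<bar>blinfun_apply (x' n) x\<bar>)"
  obtains C where "\<And>x. (\<Sum>n. \<bar>blinfun_apply (x' n) x\<bar>) \<le> C * norm x"
proof -
  define p where "p N x = (\<Sum>n<N. \<bar>blinfun_apply (x' n) x\<bar>)" for N x
  obtain C where C: "\<And>N x. p N x \<le> C * norm x"
  proof (rule uniformly_bounded_seminorms[of p])
    show "continuous_on UNIV (p N)" for N unfolding p_def by (intro continuous_intros)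
    show "p N (x + y) \<le> p N x + p N y" for N x y
      unfolding p_def sum.distrib[symmetric] by (intro sum_mono) (simp add: blinfun.add_right abs_triangle_ineq)
    show "p N (c *\<^sub>R x) = \<bar>c\<bar> * p N x" for N c x
      by (simp add: p_def blinfun.scaleR_right abs_mult sum_distrib_left)
    show "\<exists>M. \<forall>N. p N x \<le> M" for x
      unfolding p_def using sum_le_suminf[OF summ[of x]] by (metis abs_ge_zero finite_lessThan)
  qed blast
  show ?thesis
    using that suminf_le_const[OF summ] C unfolding p_def by blast
qed

text \<open>
  The operator \<open>x \<mapsto> (x' n x)\<close> has its values in the space of absolutely summable sequences.
  Scalar multiples of a nonzero vector \<open>v\<close> encode these as sequences of points of the domain,
  so that the operator is among those over which an RDP-set quantifies.
\<close>

lemma RDP_imp_V_star: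
  fixes K :: "'a::banach set"
  assumes RDP: "RDP_set TYPE((nat \<Rightarrow> 'a) + 'u) K"
  shows "V_star_set K"
  unfolding V_star_set_def
proof (intro allI impI)
  fix x' :: "nat \<Rightarrow> ('a \<Rightarrow>\<^sub>L real)" assume wuC: "weakly_unconditionally_Cauchy x'"
  have summ: "summable (\<lambda>n. \<bar>blinfun_apply (x' n) x\<bar>)" for x
  proof -
    have "bounded_linear (\<lambda>f :: 'a \<Rightarrow>\<^sub>L real. blinfun_apply f x)" by (rule blinfun.bounded_linear_left)
    then show ?thesis
      using wuC[unfolded weakly_unconditionally_Cauchy_def, rule_format, of "Blinfun (\<lambda>f. blinfun_apply f x)"]
      by (simp add: bounded_linear_Blinfun_apply)
  qed
  obtain C where C: "\<And>x. (\<Sum>n. \<bar>blinfun_apply (x' n) x\<bar>) \<le> C * norm x"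
    using absolutely_summable_functionals_bounded[OF summ] by blast
  have "\<exists>N. \<forall>n\<ge>N. \<forall>x\<in>K. \<bar>blinfun_apply (x' n) x\<bar> \<le> e" if e: "0 < e" for e
  proof (rule ccontr)
    assume "\<not> ?thesis"
    then have "\<forall>k. \<exists>n x. k \<le> n \<and> x \<in> K \<and> e < \<bar>blinfun_apply (x' n) x\<bar>" by (meson not_le)
    then obtain r x where x: "\<And>k. k \<le> r k" "\<And>k. x k \<in> K" "\<And>k. e < \<bar>blinfun_apply (x' (r k)) (x k)\<bar>"
      by metis
    have "x 0 \<noteq> 0" using x(3)[of 0] e by auto
    define v where "v = x 0"
    have v: "v \<noteq> 0" unfolding v_def by fact
    define j :: "(nat \<Rightarrow> real) \<Rightarrow> (nat \<Rightarrow> 'a) + 'u" where "j c = Inl (\<lambda>n. c n *\<^sub>R v)" for c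
    have j: "inj j" using v by (auto simp: inj_def j_def fun_eq_iff)
    note simps = ell1_def inv_f_f[OF j] inj_eq[OF j]
    define T where "T x = j (\<lambda>n. blinfun_apply (x' n) x)" for x
    have "bounded_operator T (ell1 j)"
      unfolding bounded_operator_def
      using summ C by (auto simp: T_def simps blinfun.add_right blinfun.scaleR_right)
    moreover have "(\<lambda>k. vnorm (ell1 j) (T (z k))) \<longlonglongrightarrow> 0" if z: "weakly_null z" for z
    proof -
      have "(\<lambda>k. \<Sum>n. \<bar>blinfun_apply (x' n) (z k)\<bar>) \<longlonglongrightarrow> 0"
      proof (rule Schur[OF summ])
        fix s :: "nat \<Rightarrow> real" assume s: "\<And>n. \<bar>s n\<bar> \<le> 1"
        have le: "\<bar>s n * blinfun_apply (x' n) y\<bar> \<le> \<bar>blinfun_apply (x' n) y\<bar>" for n y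
          using s[of n] by (simp add: abs_mult mult_left_le_one_le)
        have summ_s: "summable (\<lambda>n. \<bar>s n * blinfun_apply (x' n) y\<bar>)" for y
          using le by (intro summable_comparison_test[OF _ summ[of y]]) auto
        then have summ_s': "summable (\<lambda>n. s n * blinfun_apply (x' n) y)" for y by (rule summable_rabs_cancel)
        have "bounded_linear (\<lambda>y. \<Sum>n. s n * blinfun_apply (x' n) y)"
        proof (rule bounded_linear_intro[where K = C])
          show "(\<Sum>n. s n * blinfun_apply (x' n) (y + z)) =
              (\<Sum>n. s n * blinfun_apply (x' n) y) + (\<Sum>n. s n * blinfun_apply (x' n) z)" for y z
            by (simp add: blinfun.add_right distrib_left suminf_add summ_s')
          show "(\<Sum>n. s n * blinfun_apply (x' n) (t *\<^sub>R y)) = t *\<^sub>R (\<Sum>n. s n * blinfun_apply (x' n) y)" for t y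
            by (simp add: blinfun.scaleR_right mult.left_commute[of _ t] suminf_mult summ_s')
          fix y
          have "\<bar>\<Sum>n. s n * blinfun_apply (x' n) y\<bar> \<le> (\<Sum>n. \<bar>s n * blinfun_apply (x' n) y\<bar>)"
            by (rule summable_rabs[OF summ_s])
          also have "\<dots> \<le> (\<Sum>n. \<bar>blinfun_apply (x' n) y\<bar>)" by (rule suminf_le[OF le summ_s summ])
          also have "\<dots> \<le> C * norm y" by (rule C)
          finally show "norm (\<Sum>n. s n * blinfun_apply (x' n) y) \<le> norm y * C" by (simp add: mult.commute)
        qed
        then show "(\<lambda>k. \<Sum>n. s n * blinfun_apply (x' n) (z k)) \<longlonglongrightarrow> 0"
          using z[unfolded weakly_null_def, rule_format, of "Blinfun (\<lambda>y. \<Sum>n. s n * blinfun_apply (x' n) y)"]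
          by (simp add: bounded_linear_Blinfun_apply)
      qed
      then show ?thesis by (simp add: T_def simps)
    qed
    ultimately have "Dunford_Pettis_operator T (ell1 j)" by (simp add: Dunford_Pettis_operator_def)
    then have W: "relatively_weakly_compact (ell1 j) (T ` K)"
      using RDP banach_space_ell1[OF j] unfolding RDP_set_def by blast
    have "\<exists>k. \<bar>blinfun_apply (x' (r k)) (x k)\<bar> \<le> e"
      using weakly_compact_ell1_tails[OF j W, of "\<lambda>k n. blinfun_apply (x' n) (x k)" r e] x(1,2) e
      by (simp add: T_def)
    then show False using x(3) by (meson not_le)
  qed
  note small = this
  show "(\<lambda>n. SUP x\<in>K. ennreal \<bar>blinfun_apply (x' n) x\<bar>) \<longlonglongrightarrow> 0"
  proof (rule order_tendstoI)
    fix b :: ennreal assume "0 < b"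
    then obtain c where c: "0 < c" "c < b" using dense by blast
    have "c < top" using less_le_trans[OF c(2) top_greatest] .
    then obtain t where t: "0 \<le> t" "c = ennreal t" by (cases c) auto
    then have "0 < t" using c(1) by (simp add: ennreal_less_zero_iff)
    then obtain N where N: "\<And>n x. N \<le> n \<Longrightarrow> x \<in> K \<Longrightarrow> \<bar>blinfun_apply (x' n) x\<bar> \<le> t" using small by blast
    show "\<forall>\<^sub>F n in sequentially. (SUP x\<in>K. ennreal \<bar>blinfun_apply (x' n) x\<bar>) < b"
      using eventually_ge_at_top[of N]
    proof eventually_elim
      case (elim n)
      have "(SUP x\<in>K. ennreal \<bar>blinfun_apply (x' n) x\<bar>) \<le> ennreal t"
        using N[OF elim] by (intro SUP_least ennreal_leI)
      then show ?case using c(2) t(2) by simp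
    qed
  qed simp
qed

section \<open>V*-sets are disjointly weakly compact\<close>

text \<open>
  The component of \<open>g\<close> in the band generated by \<open>z\<close>, on the positive cone given by
  \<open>h x = sup {g (inf x (t z)) | t \<ge> 0}\<close>. It vanishes on elements disjoint from \<open>z\<close> and
  keeps the value at \<open>z\<close>.
\<close>

lemma restricted_functional:
  fixes g :: "'a::banach_lattice \<Rightarrow> real"
  assumes g: "positive_functional g" and z: "0 \<le> z"
  obtains h where "positive_functional h"
    "\<And>x t. 0 \<le> x \<Longrightarrow> 0 \<le> t \<Longrightarrow> g (inf x (t *\<^sub>R z)) \<le> h x"
    "\<And>x c. 0 \<le> x \<Longrightarrow> c < h x \<Longrightarrow> \<exists>t\<ge>0. c < g (inf x (t *\<^sub>R z))"
proof -
  interpret bounded_linear g using g by (simp add: positive_functional_def)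
  define \<phi> where "\<phi> x = (SUP t\<in>{0..}. g (inf x (t *\<^sub>R z)))" for x
  have tz: "0 \<le> t *\<^sub>R z" if "0 \<le> t" for t using z that by (simp add: scaleR_nonneg_nonneg)
  have bdd: "bdd_above ((\<lambda>t. g (inf x (t *\<^sub>R z))) ` {0..})" for x
    using positive_functional_mono[OF g inf_le1] by (intro bdd_aboveI2[of _ _ "g x"])
  have upper: "g (inf x (t *\<^sub>R z)) \<le> \<phi> x" if "0 \<le> t" for x t
    unfolding \<phi>_def using that by (intro cSUP_upper bdd) simp
  have least: "\<phi> x \<le> c" if "\<And>t. 0 \<le> t \<Longrightarrow> g (inf x (t *\<^sub>R z)) \<le> c" for x c
    unfolding \<phi>_def using that by (intro cSUP_least) auto
  have \<phi>_add: "\<phi> (x + y) = \<phi> x + \<phi> y" if xy: "0 \<le> x" "0 \<le> y" for x y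
  proof (rule antisym)
    show "\<phi> (x + y) \<le> \<phi> x + \<phi> y"
    proof (rule least)
      fix t :: real assume t: "0 \<le> t"
      have "inf (x + y) (t *\<^sub>R z) \<le> inf x (t *\<^sub>R z) + inf y (t *\<^sub>R z)"
        using inf_le_sum_inf[OF tz[OF t] xy] by (simp add: inf_commute)
      then have "g (inf (x + y) (t *\<^sub>R z)) \<le> g (inf x (t *\<^sub>R z) + inf y (t *\<^sub>R z))"
        by (rule positive_functional_mono[OF g])
      then show "g (inf (x + y) (t *\<^sub>R z)) \<le> \<phi> x + \<phi> y"
        using upper[OF t, of x] upper[OF t, of y] by (simp add: add)
    qed
    have "\<phi> x \<le> \<phi> (x + y) - \<phi> y"
    proof (rule least)
      fix s :: real assume s: "0 \<le> s"
      have "\<phi> y \<le> \<phi> (x + y) - g (inf x (s *\<^sub>R z))"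
      proof (rule least)
        fix t :: real assume t: "0 \<le> t"
        have "inf x (s *\<^sub>R z) + inf y (t *\<^sub>R z) \<le> inf (x + y) ((s + t) *\<^sub>R z)"
          by (simp add: scaleR_add_left add_mono)
        then have "g (inf x (s *\<^sub>R z) + inf y (t *\<^sub>R z)) \<le> g (inf (x + y) ((s + t) *\<^sub>R z))"
          by (rule positive_functional_mono[OF g])
        also have "\<dots> \<le> \<phi> (x + y)" using s t by (intro upper) simp
        finally show "g (inf y (t *\<^sub>R z)) \<le> \<phi> (x + y) - g (inf x (s *\<^sub>R z))" by (simp add: add)
      qed
      then show "g (inf x (s *\<^sub>R z)) \<le> \<phi> (x + y) - \<phi> y" by simp
    qed
    then show "\<phi> x + \<phi> y \<le> \<phi> (x + y)" by simp
  qed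
  have scale_le: "c * \<phi> x \<le> \<phi> (c *\<^sub>R x)" if c: "0 < c" for c x
  proof -
    have "\<phi> x \<le> inverse c * \<phi> (c *\<^sub>R x)"
    proof (rule least)
      fix t :: real assume t: "0 \<le> t"
      have "c * g (inf x (t *\<^sub>R z)) = g (c *\<^sub>R inf x (t *\<^sub>R z))" by (simp add: scale)
      also have "c *\<^sub>R inf x (t *\<^sub>R z) = inf (c *\<^sub>R x) ((c * t) *\<^sub>R z)" using c by (simp add: scaleR_inf)
      also have "g \<dots> \<le> \<phi> (c *\<^sub>R x)" using c t by (intro upper) simp
      finally show "g (inf x (t *\<^sub>R z)) \<le> inverse c * \<phi> (c *\<^sub>R x)" using c by (simp add: field_simps)
    qed
    then show ?thesis using c by (simp add: field_simps)
  qed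
  have \<phi>_scale: "\<phi> (c *\<^sub>R x) = c * \<phi> x" if "0 < c" for c x
    using scale_le[OF that, of x] scale_le[of "inverse c" "c *\<^sub>R x"] that by (simp add: field_simps)
  obtain C where C: "\<And>x. norm (g x) \<le> norm x * C" using bounded by blast
  obtain h where h: "positive_functional h" "\<And>x. 0 \<le> x \<Longrightarrow> h x = \<phi> x"
  proof (rule positive_functional_extension[of \<phi> C])
    show "0 \<le> \<phi> x" if "0 \<le> x" for x using upper[of 0 x] that by (simp add: inf_absorb2 zero)
    show "\<phi> x \<le> C * norm x" if "0 \<le> x" for x
    proof (rule least)
      fix t :: real assume "0 \<le> t"
      have "g (inf x (t *\<^sub>R z)) \<le> g x" by (rule positive_functional_mono[OF g inf_le1])
      also have "\<dots> \<le> C * norm x" using C[of x] by (simp add: mult.commute)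
      finally show "g (inf x (t *\<^sub>R z)) \<le> C * norm x" .
    qed
  qed (auto simp: \<phi>_add \<phi>_scale)
  show ?thesis
  proof
    show "positive_functional h" by fact
    show "g (inf x (t *\<^sub>R z)) \<le> h x" if "0 \<le> x" "0 \<le> t" for x t
      using upper[OF that(2)] h(2)[OF that(1)] by simp
    show "\<exists>t\<ge>0. c < g (inf x (t *\<^sub>R z))" if "0 \<le> x" "c < h x" for x c
      using least[of x c] that h(2) by (metis not_le)
  qed
qed

text \<open>
  Let \<open>g\<close> be the modulus of a functional that is not small along \<open>x\<close>, and
  \<open>\<bar>x n\<bar> \<le> \<bar>y n\<bar>\<close> with \<open>y n\<close> in \<open>K\<close>. Shrinking \<open>\<bar>x n\<bar>\<close> to an element
  \<open>z n\<close> below the positive or below the negative part of \<open>y n\<close> loses at most half of the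
  value of \<open>g\<close>. The restriction \<open>h n\<close> of \<open>g\<close> to the band of \<open>z n\<close> annihilates the
  other part of \<open>y n\<close>, so that it is large at \<open>y n\<close> itself.
\<close>

lemma V_star_imp_disjointly_weakly_compact:
  fixes K :: "'a::banach_lattice set"
  assumes V: "V_star_set K"
  shows "disjointly_weakly_compact K"
  unfolding disjointly_weakly_compact_def
proof (intro allI impI, elim conjE)
  fix x :: "nat \<Rightarrow> 'a" assume xK: "\<forall>n. x n \<in> solid_hull K" and disj: "disjoint_seq x"
  show "weakly_null x"
    unfolding weakly_null_def
  proof (rule allI, rule ccontr)
    fix f :: "'a \<Rightarrow>\<^sub>L real"
    assume "\<not> (\<lambda>n. blinfun_apply f (x n)) \<longlonglongrightarrow> 0"
    then obtain e where e: "0 < e" "\<And>n0. \<exists>n\<ge>n0. e \<le> \<bar>blinfun_apply f (x n)\<bar>"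
      by (auto simp: LIMSEQ_iff not_less)
    obtain g where g: "positive_functional g" "\<And>x. \<bar>blinfun_apply f x\<bar> \<le> g \<bar>x\<bar>"
      by (rule modulus_exists[OF blinfun.bounded_linear_right[of f]]) (rule that)
    interpret g: bounded_linear g using g(1) by (simp add: positive_functional_def)
    have "\<exists>y z. y \<in> K \<and> 0 \<le> z \<and> z \<le> \<bar>x n\<bar> \<and> (z \<le> pprt y \<or> z \<le> - nprt y) \<and> g \<bar>x n\<bar> \<le> 2 * g z" for n
    proof -
      obtain y where y: "y \<in> K" "\<bar>x n\<bar> \<le> \<bar>y\<bar>" using xK by (auto simp: solid_hull_def)
      have "\<bar>x n\<bar> = inf \<bar>x n\<bar> (pprt y + - nprt y)" using y(2) by (simp add: inf_absorb1 abs_prts)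
      also have "\<dots> \<le> inf \<bar>x n\<bar> (pprt y) + inf \<bar>x n\<bar> (- nprt y)" by (intro inf_le_sum_inf) auto
      finally have "g \<bar>x n\<bar> \<le> g (inf \<bar>x n\<bar> (pprt y) + inf \<bar>x n\<bar> (- nprt y))"
        by (rule positive_functional_mono[OF g(1)])
      then have "g \<bar>x n\<bar> \<le> g (inf \<bar>x n\<bar> (pprt y)) + g (inf \<bar>x n\<bar> (- nprt y))" by (simp only: g.add)
      then have "g \<bar>x n\<bar> \<le> 2 * g (inf \<bar>x n\<bar> (pprt y)) \<or> g \<bar>x n\<bar> \<le> 2 * g (inf \<bar>x n\<bar> (- nprt y))"
        by linarith
      moreover have "0 \<le> inf \<bar>x n\<bar> (pprt y)" "0 \<le> inf \<bar>x n\<bar> (- nprt y)" by simp_all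
      ultimately show ?thesis using y(1) by (meson inf_le1 inf_le2)
    qed
    then obtain y z where y: "\<And>n. y n \<in> K" and z: "\<And>n. 0 \<le> z n" "\<And>n. z n \<le> \<bar>x n\<bar>"
      "\<And>n. z n \<le> pprt (y n) \<or> z n \<le> - nprt (y n)" "\<And>n. g \<bar>x n\<bar> \<le> 2 * g (z n)" by metis
    have z_disj: "disjoint_seq z" using disj by (rule disjoint_seq_dominated) (simp add: z)
    have "\<forall>n. \<exists>h. positive_functional h \<and>
        (\<forall>x\<ge>0. \<forall>t\<ge>0. g (inf x (t *\<^sub>R z n)) \<le> h x) \<and>
        (\<forall>x\<ge>0. \<forall>c<h x. \<exists>t\<ge>0. c < g (inf x (t *\<^sub>R z n)))"
    proof
      fix n
      obtain h where "positive_functional h"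
        "\<And>x t. 0 \<le> x \<Longrightarrow> 0 \<le> t \<Longrightarrow> g (inf x (t *\<^sub>R z n)) \<le> h x"
        "\<And>x c. 0 \<le> x \<Longrightarrow> c < h x \<Longrightarrow> \<exists>t\<ge>0. c < g (inf x (t *\<^sub>R z n))"
        using restricted_functional[OF g(1) z(1)[of n]] by metis
      then show "\<exists>h. positive_functional h \<and>
          (\<forall>x\<ge>0. \<forall>t\<ge>0. g (inf x (t *\<^sub>R z n)) \<le> h x) \<and>
          (\<forall>x\<ge>0. \<forall>c<h x. \<exists>t\<ge>0. c < g (inf x (t *\<^sub>R z n)))"
        by (intro exI[of _ h]) simp
    qed
    then obtain h where h: "\<And>n. positive_functional (h n)"
      "\<And>n x t. 0 \<le> x \<Longrightarrow> 0 \<le> t \<Longrightarrow> g (inf x (t *\<^sub>R z n)) \<le> h n x"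
      "\<And>n x c. 0 \<le> x \<Longrightarrow> c < h n x \<Longrightarrow> \<exists>t\<ge>0. c < g (inf x (t *\<^sub>R z n))"
      by metis
    have h_bl: "bounded_linear (h n)" for n using h(1) by (simp add: positive_functional_def)
    have h_lin: "linear (h n)" for n using h_bl by (rule bounded_linear.linear)

    \<comment> \<open>The bands generated by the \<open>z n\<close> are disjoint, so their shares of \<open>g\<close> add up to at most \<open>g\<close>.\<close>
    have shares: "(\<Sum>i<n. h i v) \<le> g v" if v: "0 \<le> v" for n v
    proof (rule field_le_epsilon)
      fix d :: real assume d: "0 < d"
      define \<eta> where "\<eta> = d / (real n + 1)"
      have \<eta>: "0 < \<eta>" using d by (simp add: \<eta>_def)
      have "\<exists>t\<ge>0. h i v - \<eta> < g (inf v (t *\<^sub>R z i))" for i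
        using v \<eta> by (intro h(3)) simp_all
      then obtain t where t: "\<And>i. 0 \<le> t i" "\<And>i. h i v - \<eta> < g (inf v (t i *\<^sub>R z i))" by metis
      define w where "w i = inf v (t i *\<^sub>R z i)" for i
      have w0: "0 \<le> w i" for i using v t(1) z(1) by (simp add: w_def scaleR_nonneg_nonneg)
      have "disjoint_seq w"
      proof (rule disjoint_seqI)
        fix i k :: nat assume "i < k"
        then have "inf (z i) (z k) = 0"
          using z_disj z(1) unfolding disjoint_seq_def by (metis abs_of_nonneg less_irrefl inf_commute)
        then have "inf (t i *\<^sub>R z i) (t k *\<^sub>R z k) = 0"
          using inf_scaleR_eq_0[of "z k" "z i" "t i"] inf_scaleR_eq_0[of "t i *\<^sub>R z i" "z k" "t k"] z(1) t(1)
          by (simp add: inf_commute scaleR_nonneg_nonneg)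
        then show "inf \<bar>w i\<bar> \<bar>w k\<bar> = 0"
          using w0 by (simp add: disjoint_mono[of "t i *\<^sub>R z i" "t k *\<^sub>R z k"] w_def)
      qed
      then have sum_le: "(\<Sum>i<n. w i) \<le> v" using w0 by (rule disjoint_sum_le) (simp add: w_def)
      have "(\<Sum>i<n. h i v) \<le> (\<Sum>i<n. g (w i) + \<eta>)"
        using t(2) by (intro sum_mono) (simp add: w_def diff_less_eq less_imp_le)
      also have "\<dots> = g (\<Sum>i<n. w i) + real n * \<eta>" by (simp add: sum.distrib g.sum)
      also have "\<dots> \<le> g v + d"
      proof (rule add_mono)
        show "g (\<Sum>i<n. w i) \<le> g v" by (rule positive_functional_mono[OF g(1) sum_le])
        show "real n * \<eta> \<le> d" using d by (simp add: \<eta>_def field_simps)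
      qed
      finally show "(\<Sum>i<n. h i v) \<le> g v + d" .
    qed
    define x' where "x' n = Blinfun (h n)" for n
    have x': "blinfun_apply (x' n) = h n" for n by (simp add: x'_def bounded_linear_Blinfun_apply h_bl)
    obtain C where C: "\<And>x. norm (g x) \<le> norm x * C" "0 \<le> C" using g.nonneg_bounded by blast
    have "weakly_unconditionally_Cauchy x'"
      unfolding weakly_unconditionally_Cauchy_def
    proof
      fix F :: "('a \<Rightarrow>\<^sub>L real) \<Rightarrow>\<^sub>L real"
      show "summable (\<lambda>n. \<bar>blinfun_apply F (x' n)\<bar>)"
      proof (rule summableI_nonneg_bounded)
        fix n
        define s where "s i = sgn (blinfun_apply F (x' i))" for i
        have s1: "\<bar>s i\<bar> \<le> 1" for i by (simp add: s_def abs_sgn_eq)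
        have "norm (\<Sum>i<n. s i *\<^sub>R x' i) \<le> C"
        proof (rule norm_blinfun_bound[OF C(2)])
          fix v
          have "\<bar>\<Sum>i<n. s i * h i v\<bar> \<le> (\<Sum>i<n. \<bar>s i * h i v\<bar>)" by (rule sum_abs)
          also have "\<dots> \<le> (\<Sum>i<n. h i \<bar>v\<bar>)"
          proof (rule sum_mono)
            fix i
            have "\<bar>s i * h i v\<bar> \<le> \<bar>h i v\<bar>" using s1[of i] by (simp add: abs_mult mult_left_le_one_le)
            also have "\<dots> \<le> h i \<bar>v\<bar>" by (rule positive_functional_abs_le[OF h(1)])
            finally show "\<bar>s i * h i v\<bar> \<le> h i \<bar>v\<bar>" .
          qed
          also have "\<dots> \<le> g \<bar>v\<bar>" by (rule shares) simp
          also have "\<dots> \<le> C * norm v" using C(1)[of "\<bar>v\<bar>"] by (simp add: mult.commute)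
          finally show "norm (blinfun_apply (\<Sum>i<n. s i *\<^sub>R x' i) v) \<le> C * norm v"
            by (simp add: blinfun.sum_left blinfun.scaleR_left x')
        qed
        then have "norm F * norm (\<Sum>i<n. s i *\<^sub>R x' i) \<le> norm F * C" by (intro mult_left_mono) auto
        moreover have "(\<Sum>i<n. \<bar>blinfun_apply F (x' i)\<bar>) = blinfun_apply F (\<Sum>i<n. s i *\<^sub>R x' i)"
          by (simp add: blinfun.sum_right blinfun.scaleR_right s_def abs_sgn mult.commute)
        moreover have "blinfun_apply F (\<Sum>i<n. s i *\<^sub>R x' i) \<le> norm F * norm (\<Sum>i<n. s i *\<^sub>R x' i)"
          using norm_blinfun[of F "\<Sum>i<n. s i *\<^sub>R x' i"] by simp
        ultimately show "(\<Sum>i<n. \<bar>blinfun_apply F (x' i)\<bar>) \<le> norm F * C" by linarith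
      qed simp
    qed
    then have lim: "(\<lambda>n. SUP x\<in>K. ennreal \<bar>blinfun_apply (x' n) x\<bar>) \<longlonglongrightarrow> 0"
      using V by (simp add: V_star_set_def)
    have "0 < ennreal (e / 2)" using e(1) by simp
    from order_tendstoD(2)[OF lim this]
    obtain n0 where n0: "\<And>n. n0 \<le> n \<Longrightarrow> (SUP x\<in>K. ennreal \<bar>blinfun_apply (x' n) x\<bar>) < ennreal (e / 2)"
      by (auto simp: eventually_sequentially)
    obtain n where n: "n0 \<le> n" "e \<le> \<bar>blinfun_apply f (x n)\<bar>" using e(2) by blast
    have "e / 2 \<le> g (z n)" using n(2) g(2)[of "x n"] z(4)[of n] by simp
    have null: "h n v = 0" if v: "0 \<le> v" "inf v (z n) = 0" for v
    proof (rule antisym)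
      show "h n v \<le> 0"
      proof (rule ccontr)
        assume "\<not> ?thesis"
        then obtain t where "0 \<le> t" "0 < g (inf v (t *\<^sub>R z n))" using h(3)[OF v(1), of 0 n] by auto
        then show False using inf_scaleR_eq_0[OF v(1) z(1) v(2)] g.zero by simp
      qed
      show "0 \<le> h n v" using h(1) v by (simp add: positive_functional_def)
    qed
    have ge: "e / 2 \<le> h n v" if "z n \<le> v" for v
      using h(2)[of v 1 n] that z(1)[of n] \<open>e / 2 \<le> g (z n)\<close> by (simp add: inf_absorb2 order_trans[of 0 "z n"])
    have parts: "h n (y n) = h n (pprt (y n)) - h n (- nprt (y n))"
      using linear_diff[OF h_lin, of n "pprt (y n)" "- nprt (y n)"] prts[of "y n"] by simp
    have "e / 2 \<le> \<bar>h n (y n)\<bar>"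
      using z(3)[of n]
    proof
      assume *: "z n \<le> pprt (y n)"
      have "inf (- nprt (y n)) (z n) = 0"
        by (rule disjoint_mono[OF trans[OF inf_commute pprt_inf_nprt] _ order_refl z(1) *]) simp
      then have "h n (- nprt (y n)) = 0" by (intro null) auto
      then show ?thesis using ge[OF *] parts by simp
    next
      assume *: "z n \<le> - nprt (y n)"
      have "inf (pprt (y n)) (z n) = 0"
        by (rule disjoint_mono[OF pprt_inf_nprt _ order_refl z(1) *]) simp
      then have "h n (pprt (y n)) = 0" by (intro null) auto
      then show ?thesis using ge[OF *] parts by simp
    qed
    then have "ennreal (e / 2) \<le> ennreal \<bar>blinfun_apply (x' n) (y n)\<bar>" by (simp add: x' ennreal_leI)
    also have "\<dots> \<le> (SUP x\<in>K. ennreal \<bar>blinfun_apply (x' n) x\<bar>)" by (rule SUP_upper[OF y])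
    also have "\<dots> < ennreal (e / 2)" by (rule n0[OF n(1)])
    finally show False by simp
  qed
qed

theorem proposition0p1:
  fixes K :: "'a::banach_lattice set"
  assumes "bounded K"
  shows "(RDP_set TYPE(('a, 'u) universe) K \<longleftrightarrow> V_star_set K) \<and>
    (V_star_set K \<longleftrightarrow> disjointly_weakly_compact K) \<and>
    (disjointly_weakly_compact K \<longleftrightarrow>
      almost_DP_images_relatively_weakly_compact TYPE(('a, 'u) universe) K)"
proof -
  have 1: "RDP_set TYPE(('a, 'u) universe) K \<Longrightarrow> V_star_set K" by (rule RDP_imp_V_star)
  have 2: "V_star_set K \<Longrightarrow> disjointly_weakly_compact K" by (rule V_star_imp_disjointly_weakly_compact)
  have 3: "disjointly_weakly_compact K \<Longrightarrow>
      almost_DP_images_relatively_weakly_compact TYPE(('a, 'u) universe) K"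
    using disjointly_weakly_compact_imp_almost_DP_image[OF assms]
    by (auto simp: almost_DP_images_relatively_weakly_compact_def)
  have 4: "almost_DP_images_relatively_weakly_compact TYPE(('a, 'u) universe) K \<Longrightarrow>
      RDP_set TYPE(('a, 'u) universe) K"
    by (auto simp: almost_DP_images_relatively_weakly_compact_def RDP_set_def
        almost_Dunford_Pettis_operator_def Dunford_Pettis_operator_def)
  show ?thesis using 1 2 3 4 by blast
qed

end
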